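(* Let $f:\mathbb{R}^n\to\mathbb{R}$ be a Morse polynomial function of degree $d$. Assume that $f$ achieves a minimum value $f^*$ on $\mathbb{R}^n$. Then there exists an integer $N$ such that $f^*_{N,grad}=f^*$, where $$f^*_{N,grad}:=\max\Big\{\gamma\in\mathbb{R} : f-\gamma-\sum_{i=1}^n\phi_i\frac{\partial f}{\partial x_i}\in\sum\mathbb{R}[X]^2\ \text{for some}\ \phi_1,\dots,\phi_n\in\mathbb{R}[X]_{2N-d+1}\Big\}.$$
   Context: $\mathbb{R}[X]=\mathbb{R}[x_1,\dots,x_n]$; $\mathbb{R}[X]_k$ is the vector space of polynomials of degree at most $k$; $\sum\mathbb{R}[X]^2$ is the set of finite sums of squares of polynomials in $\mathbb{R}[X]$. A polynomial function $f:\mathbb{R}^n\to\mathbb{R}$ is Morse if at every critical point $p\in\mathbb{R}^n$ of $f$ the Hessian matrix $D^2f(p)$ is invertible. *)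

theory Defs
  imports "HOL-Analysis.Analysis" "HOL-Library.Poly_Mapping"
begin

text \<open>
  The polynomial ring over the reals with variables indexed by a finite type \<open>'n\<close>: finitely
  supported maps from monomials (exponent vectors) to coefficients, with the convolution product
  of \<^theory>\<open>HOL-Library.Poly_Mapping\<close>.
\<close>

type_synonym 'n rpoly = "('n \<Rightarrow>\<^sub>0 nat) \<Rightarrow>\<^sub>0 real"

definition const_poly :: "real \<Rightarrow> 'n rpoly" where
  "const_poly c = Poly_Mapping.single 0 c"

definition monom_eval :: "('n::finite \<Rightarrow>\<^sub>0 nat) \<Rightarrow> real ^ 'n \<Rightarrow> real" where
  "monom_eval m x = (\<Prod>i\<in>UNIV. (x $ i) ^ Poly_Mapping.lookup m i)"

definition poly_eval :: "('n::finite) rpoly \<Rightarrow> real ^ 'n \<Rightarrow> real" where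
  "poly_eval f x = (\<Sum>m\<in>Poly_Mapping.keys f. Poly_Mapping.lookup f m * monom_eval m x)"

definition monom_degree :: "('n::finite \<Rightarrow>\<^sub>0 nat) \<Rightarrow> nat" where
  "monom_degree m = (\<Sum>i\<in>UNIV. Poly_Mapping.lookup m i)"

text \<open>Total degree; the zero polynomial gets degree 0.\<close>

definition total_degree :: "('n::finite) rpoly \<Rightarrow> nat" where
  "total_degree f = Max (insert 0 (monom_degree ` Poly_Mapping.keys f))"

text \<open>
  The bound is an integer because \<open>2N - d + 1\<close> can be negative; in that case only the zero
  polynomial remains.
\<close>

definition polys_upto :: "int \<Rightarrow> ('n::finite) rpoly set" where
  "polys_upto k = {f. f = 0 \<or> int (total_degree f) \<le> k}"

text \<open>
  Formal partial derivative. A monomial not involving the variable \<open>i\<close> contributes 0 because its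
  coefficient is multiplied by 0. It agrees with the analytic one by
  \<open>partial_deriv_poly_eval\<close> below.
\<close>

definition poly_partial :: "'n::finite \<Rightarrow> 'n rpoly \<Rightarrow> 'n rpoly" where
  "poly_partial i f = (\<Sum>m\<in>Poly_Mapping.keys f.
     Poly_Mapping.single (m - Poly_Mapping.single i 1)
       (Poly_Mapping.lookup f m * real (Poly_Mapping.lookup m i)))"

definition sums_of_squares :: "('n::finite) rpoly set" where
  "sums_of_squares = {p. \<exists>qs. p = sum_list (map (\<lambda>q. q ^ 2) qs)}"

definition partial_deriv :: "'n::finite \<Rightarrow> (real ^ 'n \<Rightarrow> real) \<Rightarrow> real ^ 'n \<Rightarrow> real" where
  "partial_deriv i g x = frechet_derivative g (at x) (axis i 1)"

definition hessian :: "(real ^ 'n::finite \<Rightarrow> real) \<Rightarrow> real ^ 'n \<Rightarrow> real ^ 'n ^ 'n" where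
  "hessian g p = (\<chi> i j. partial_deriv i (partial_deriv j g) p)"

definition critical_point :: "(real ^ 'n::finite \<Rightarrow> real) \<Rightarrow> real ^ 'n \<Rightarrow> bool" where
  "critical_point g p \<longleftrightarrow> (g has_derivative (\<lambda>h. 0)) (at p)"

text \<open>
  Only applied to polynomial functions, for which the derivatives chosen by
  \<open>frechet_derivative\<close> exist.
\<close>

definition morse :: "(real ^ 'n::finite \<Rightarrow> real) \<Rightarrow> bool" where
  "morse g \<longleftrightarrow> (\<forall>p. critical_point g p \<longrightarrow> invertible (hessian g p))"

definition grad_sos_bounds :: "('n::finite) rpoly \<Rightarrow> int \<Rightarrow> real set" where
  "grad_sos_bounds f N = {\<gamma>. \<exists>\<phi> :: 'n \<Rightarrow> 'n rpoly.
     (\<forall>i. \<phi> i \<in> polys_upto (2 * N - int (total_degree f) + 1)) \<and>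
     f - const_poly \<gamma> - (\<Sum>i\<in>UNIV. \<phi> i * poly_partial i f) \<in> sums_of_squares}"

definition is_maximum :: "real set \<Rightarrow> real \<Rightarrow> bool" where
  "is_maximum S a \<longleftrightarrow> a \<in> S \<and> (\<forall>b\<in>S. b \<le> a)"

lemma poly_eval_superset:
  assumes "finite A" "Poly_Mapping.keys f \<subseteq> A"
  shows "poly_eval f x = (\<Sum>m\<in>A. Poly_Mapping.lookup f m * monom_eval m x)"
  unfolding poly_eval_def
  by (rule sum.mono_neutral_left) (use assms in \<open>auto simp: in_keys_iff\<close>)

lemma poly_eval_zero [simp]: "poly_eval 0 x = 0"
  by (simp add: poly_eval_def)

lemma poly_eval_add: "poly_eval (f + g) x = poly_eval f x + poly_eval g x"
proof -
  let ?A = "Poly_Mapping.keys f \<union> Poly_Mapping.keys g"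
  have "poly_eval (f + g) x = (\<Sum>m\<in>?A. Poly_Mapping.lookup (f + g) m * monom_eval m x)"
    by (rule poly_eval_superset) (auto simp: Poly_Mapping.keys_add)
  moreover have "poly_eval f x = (\<Sum>m\<in>?A. Poly_Mapping.lookup f m * monom_eval m x)"
    by (rule poly_eval_superset) auto
  moreover have "poly_eval g x = (\<Sum>m\<in>?A. Poly_Mapping.lookup g m * monom_eval m x)"
    by (rule poly_eval_superset) auto
  ultimately show ?thesis
    by (simp add: lookup_add algebra_simps sum.distrib)
qed

lemma poly_eval_sum: "poly_eval (\<Sum>a\<in>A. f a) x = (\<Sum>a\<in>A. poly_eval (f a) x)"
  by (induction A rule: infinite_finite_induct) (auto simp: poly_eval_add)

lemma poly_eval_single: "poly_eval (Poly_Mapping.single m c) x = c * monom_eval m x"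
  by (cases "c = 0") (auto simp: poly_eval_def)

lemma poly_eval_partial:
  "poly_eval (poly_partial i f) x =
     (\<Sum>m\<in>Poly_Mapping.keys f. Poly_Mapping.lookup f m * (real (Poly_Mapping.lookup m i) * monom_eval (m - Poly_Mapping.single i 1) x))"
  by (simp add: poly_partial_def poly_eval_sum poly_eval_single mult.assoc)

lemma monom_eval_diff_single:
  "monom_eval (m - Poly_Mapping.single i 1) x =
     (x $ i) ^ (Poly_Mapping.lookup m i - 1) * (\<Prod>j\<in>UNIV - {i}. (x $ j) ^ Poly_Mapping.lookup m j)"
proof -
  have "monom_eval (m - Poly_Mapping.single i 1) x =
      (x $ i) ^ Poly_Mapping.lookup (m - Poly_Mapping.single i 1) i *
      (\<Prod>j\<in>UNIV - {i}. (x $ j) ^ Poly_Mapping.lookup (m - Poly_Mapping.single i 1) j)"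
    unfolding monom_eval_def by (rule prod.remove) auto
  also have "(\<Prod>j\<in>UNIV - {i}. (x $ j) ^ Poly_Mapping.lookup (m - Poly_Mapping.single i 1) j) =
      (\<Prod>j\<in>UNIV - {i}. (x $ j) ^ Poly_Mapping.lookup m j)"
    by (rule prod.cong) (auto simp: minus_poly_mapping.rep_eq lookup_single)
  finally show ?thesis
    by (simp add: minus_poly_mapping.rep_eq)
qed

lemma has_derivative_monom_eval:
  "(monom_eval m has_derivative
     (\<lambda>h. \<Sum>i\<in>UNIV. h $ i * (real (Poly_Mapping.lookup m i) * monom_eval (m - Poly_Mapping.single i 1) x))) (at x)"
proof -
  have "((\<lambda>x. (x $ i) ^ Poly_Mapping.lookup m i) has_derivative
      (\<lambda>h. real (Poly_Mapping.lookup m i) * (h $ i) * (x $ i) ^ (Poly_Mapping.lookup m i - 1))) (at x)" for i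
    by (rule derivative_eq_intros bounded_linear.has_derivative[OF bounded_linear_vec_nth]
          has_derivative_ident)+ (auto simp: fun_eq_iff)
  then have "((\<lambda>x. \<Prod>i\<in>UNIV. (x $ i) ^ Poly_Mapping.lookup m i) has_derivative
      (\<lambda>h. \<Sum>i\<in>UNIV. real (Poly_Mapping.lookup m i) * (h $ i) * (x $ i) ^ (Poly_Mapping.lookup m i - 1) *
         (\<Prod>j\<in>UNIV - {i}. (x $ j) ^ Poly_Mapping.lookup m j))) (at x)"
    by (rule has_derivative_prod)
  then show ?thesis
    unfolding monom_eval_diff_single by (simp add: monom_eval_def[abs_def] algebra_simps)
qed

lemma has_derivative_poly_eval:
  "(poly_eval f has_derivative (\<lambda>h. \<Sum>i\<in>UNIV. h $ i * poly_eval (poly_partial i f) x)) (at x)"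
proof -
  have "((\<lambda>x. \<Sum>m\<in>Poly_Mapping.keys f. Poly_Mapping.lookup f m * monom_eval m x) has_derivative
      (\<lambda>h. \<Sum>m\<in>Poly_Mapping.keys f. Poly_Mapping.lookup f m * (\<Sum>i\<in>UNIV. h $ i *
         (real (Poly_Mapping.lookup m i) * monom_eval (m - Poly_Mapping.single i 1) x)))) (at x)"
    by (intro has_derivative_sum has_derivative_mult_right has_derivative_monom_eval)
  moreover have "(\<Sum>m\<in>Poly_Mapping.keys f. Poly_Mapping.lookup f m * (\<Sum>i\<in>UNIV. h $ i *
         (real (Poly_Mapping.lookup m i) * monom_eval (m - Poly_Mapping.single i 1) x))) =
      (\<Sum>i\<in>UNIV. h $ i * poly_eval (poly_partial i f) x)" for h
    unfolding poly_eval_partial sum_distrib_left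
    by (subst sum.swap) (simp add: mult.left_commute)
  ultimately show ?thesis
    by (simp add: poly_eval_def[abs_def])
qed

lemma partial_deriv_poly_eval:
  "partial_deriv i (poly_eval f) = poly_eval (poly_partial i f)"
proof
  fix x
  have "partial_deriv i (poly_eval f) x =
      (\<Sum>j\<in>UNIV. axis i 1 $ j * poly_eval (poly_partial j f) x)"
    by (simp add: partial_deriv_def frechet_derivative_at[OF has_derivative_poly_eval, symmetric])
  also have "\<dots> = (\<Sum>j\<in>UNIV. if j = i then poly_eval (poly_partial j f) x else 0)"
    by (rule sum.cong) (auto simp: axis_def)
  finally show "partial_deriv i (poly_eval f) x = poly_eval (poly_partial i f) x"
    by simp
qed

lemma hessian_poly_eval:
  "hessian (poly_eval f) p = (\<chi> i j. poly_eval (poly_partial i (poly_partial j f)) p)"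
  by (simp add: hessian_def partial_deriv_poly_eval)

end

theory Submission
  imports Defs "HOL-Algebra.Algebraic_Closure_Type"
begin

text \<open>
  At a zero \<open>a\<close> of the gradient, \<open>\<nabla>f = H (x - a)\<close> with \<open>H(a)\<close> the invertible Hessian, so Cramer's
  rule yields \<open>e\<^sub>a\<close> with \<open>e\<^sub>a(a) = 1\<close> and \<open>e\<^sub>a (x\<^sub>k - a\<^sub>k)\<close> in the gradient ideal \<open>I\<close>. Modulo \<open>I\<close> the
  \<open>e\<^sub>a\<close> are orthogonal idempotents; their degree is bounded independently of \<open>a\<close>, so there are finitely
  many. The ideal generated by \<open>I\<close> and all \<open>e\<^sub>a\<close> has no real zero, so by the weak real Nullstellensatz
  it contains some \<open>1 + s\<close> with \<open>s\<close> a sum of squares. Hence \<open>-1\<close>, and with it every element, is a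
  sum of squares in the component of \<open>\<real>[X]/I\<close> complementary to the \<open>e\<^sub>a\<close>, whereas the component of \<open>e\<^sub>a\<close>
  is \<open>\<real>\<close>, in which \<open>f - f\<^sup>*\<close> takes the nonnegative value \<open>f(a) - f\<^sup>*\<close>.

  For the Nullstellensatz, an ideal maximal among those avoiding \<open>1 + \<Sum>\<real>[X]\<^sup>2\<close> is a real prime; its
  residue field embeds into a real closed field, obtained inside an algebraic closure from a maximal
  cone. Cohen--Hoermander elimination of one variable at a time carries the common zero found there
  back to \<open>\<real>\<close>.
\<close>

hide_const (open) Polynomials.lead_coeff Polynomials.degree Coset.order up_ring.coeff up_ring.monom module.smult

section \<open>Real closed fields\<close>

text \<open>The Morse condition constrains real critical points only. For f = (1 + x^2 + y^2)^2 it
  holds, yet the gradient vanishes on a whole complex curve; so the quotient by the gradient ideal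
  may have infinite dimension and cannot be decomposed along all complex zeros. Hence only the real
  zeros are split off, and the complement is never analysed further: g = ((g + 1)/2)^2 - ((g -
  1)/2)^2 turns the representation of -1 there into one of any g. Finiteness of the set of real
  critical points is linear algebra: the e_a are linearly independent in a space of polynomials of
  bounded degree. In the Nullstellensatz the residue field is not known to be algebraic over the
  reals, which is why a zero over a larger real closed field has to be brought back. Signs are
  compared along two homomorphisms out of one ring; once all variables are gone only real constants
  remain, and their signs agree in every ordered field containing the reals. Real closedness is used
  only as the intermediate value property for polynomials, which therefore serves as its
  definition.\<close>

class real_closed_field = linordered_field +
  assumes IVT_coeffs:
    "a < b \<Longrightarrow> (\<Sum>k\<le>n. c k * a ^ k) < 0 \<Longrightarrow> 0 < (\<Sum>k\<le>n. c k * b ^ k) \<Longrightarrow>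
      \<exists>x. a < x \<and> x < b \<and> (\<Sum>k\<le>n. c k * x ^ k) = 0"

lemma rcf_IVT_pos:
  fixes p :: "'a::real_closed_field poly"
  assumes "a < b" "poly p a < 0" "0 < poly p b"
  shows "\<exists>x. a < x \<and> x < b \<and> poly p x = 0"
  using IVT_coeffs[of a b "coeff p" "degree p"] assms by (simp add: poly_altdef)

lemma rcf_IVT:
  fixes p :: "'a::real_closed_field poly"
  assumes "a < b" "poly p a * poly p b < 0"
  shows "\<exists>x. a < x \<and> x < b \<and> poly p x = 0"
  using rcf_IVT_pos[of a b p] rcf_IVT_pos[of a b "-p"] assms
  by (auto simp: mult_less_0_iff)

instance real :: real_closed_field
proof
  fix a b :: real and c :: "nat \<Rightarrow> real" and n
  assume *: "a < b" "(\<Sum>k\<le>n. c k * a ^ k) < 0" "0 < (\<Sum>k\<le>n. c k * b ^ k)"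
  have "\<exists>x\<ge>a. x \<le> b \<and> (\<Sum>k\<le>n. c k * x ^ k) = 0"
    using * by (intro IVT') (auto intro!: continuous_intros)
  then obtain x where x: "a \<le> x" "x \<le> b" "(\<Sum>k\<le>n. c k * x ^ k) = 0"
    by blast
  with * have "x \<noteq> a" "x \<noteq> b"
    by auto
  with x show "\<exists>x. a < x \<and> x < b \<and> (\<Sum>k\<le>n. c k * x ^ k) = 0"
    by (intro exI[of _ x]) auto
qed

lemma rcf_Rolle_consecutive:
  fixes p :: "'a::real_closed_field poly"
  assumes "a < b" "p \<noteq> 0" "poly p a = 0" "poly p b = 0"
    and no_root: "\<And>x. a < x \<Longrightarrow> x < b \<Longrightarrow> poly p x \<noteq> 0"
  shows "\<exists>c. a < c \<and> c < b \<and> poly (pderiv p) c = 0"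
proof -
  obtain q where q: "p = [:- a, 1:] ^ order a p * q" "\<not> [:- a, 1:] dvd q"
    using order_decomp[OF \<open>p \<noteq> 0\<close>] by blast
  have "q \<noteq> 0"
    using q \<open>p \<noteq> 0\<close> by auto
  obtain g where g: "q = [:- b, 1:] ^ order b q * g" "\<not> [:- b, 1:] dvd g"
    using order_decomp[OF \<open>q \<noteq> 0\<close>] by blast
  have "order a p \<noteq> 0"
    using assms by (simp add: order_root)
  then obtain m where m: "order a p = Suc m"
    using not0_implies_Suc by blast
  have "poly q b = 0"
  proof -
    have "poly p b = (b - a) ^ order a p * poly q b"
      by (subst q(1)) simp
    then show ?thesis
      using assms by simp
  qed
  then have "order b q \<noteq> 0"
    using \<open>q \<noteq> 0\<close> by (simp add: order_root)
  then obtain n where n: "order b q = Suc n"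
    using not0_implies_Suc by blast
  have p_eq: "p = [:- a, 1:] ^ Suc m * ([:- b, 1:] ^ Suc n * g)"
    using q g m n by simp
  have ga: "poly g a \<noteq> 0"
    using q(2) g(1) by (metis dvd_mult poly_eq_0_iff_dvd)
  have gb: "poly g b \<noteq> 0"
    using g(2) by (simp add: poly_eq_0_iff_dvd)
  have pos: "0 < poly g a * poly g b"
  proof (rule ccontr)
    assume "\<not> 0 < poly g a * poly g b"
    with ga gb have "poly g a * poly g b < 0"
      by (meson mult_eq_0_iff not_less_iff_gr_or_eq)
    then obtain x where "a < x" "x < b" "poly g x = 0"
      using rcf_IVT[OF \<open>a < b\<close>] by blast
    with no_root[of x] show False
      by (simp add: p_eq)
  qed
  define h where "h = smult (of_nat (Suc m)) ([:- b, 1:] * g) + smult (of_nat (Suc n)) ([:- a, 1:] * g)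
      + [:- a, 1:] * [:- b, 1:] * pderiv g"
  have dp: "pderiv p = [:- a, 1:] ^ m * [:- b, 1:] ^ n * h"
    unfolding p_eq pderiv_mult pderiv_power_Suc h_def
    by (simp add: algebra_simps pderiv_pCons one_pCons[symmetric] del: mult_pCons_left mult_pCons_right of_nat_Suc)
  have "poly h a = - (of_nat (Suc m) * (b - a) * poly g a)" "poly h b = of_nat (Suc n) * (b - a) * poly g b"
    by (simp_all add: h_def algebra_simps)
  then have "poly h a * poly h b = - (of_nat (Suc m) * of_nat (Suc n) * (b - a)^2 * (poly g a * poly g b))"
    by (simp add: power2_eq_square)
  also have "\<dots> < 0"
    using \<open>a < b\<close> pos by (simp add: zero_less_mult_iff del: of_nat_Suc)
  finally obtain c where "a < c" "c < b" "poly h c = 0"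
    using rcf_IVT[OF \<open>a < b\<close>] by blast
  then show ?thesis
    by (intro exI[of _ c]) (simp add: dp)
qed

lemma rcf_Rolle:
  fixes p :: "'a::real_closed_field poly"
  assumes "a < b" "poly p a = 0" "poly p b = 0"
  shows "\<exists>c. a < c \<and> c < b \<and> poly (pderiv p) c = 0"
proof (cases "p = 0")
  case True
  then show ?thesis
    using dense[OF \<open>a < b\<close>] by auto
next
  case False
  \<comment> \<open>\<open>Min R\<close> is the root following \<open>a\<close>; used in place of
    \<open>b\<close>, it leaves no root in between.\<close>
  define R where "R = {x. poly p x = 0 \<and> a < x}"
  have R: "finite R" "R \<noteq> {}"
    using poly_roots_finite[OF False] assms by (auto simp: R_def)
  have "Min R \<in> R" and least: "\<And>x. x \<in> R \<Longrightarrow> Min R \<le> x"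
    using R by auto
  then have "a < Min R" "poly p (Min R) = 0" "Min R \<le> b"
    using assms by (auto simp: R_def)
  moreover have "poly p x \<noteq> 0" if "a < x" "x < Min R" for x
    using least[of x] that by (auto simp: R_def)
  ultimately obtain c where "a < c" "c < Min R" "poly (pderiv p) c = 0"
    using rcf_Rolle_consecutive[of a "Min R" p] False assms by blast
  then show ?thesis
    using \<open>Min R \<le> b\<close> by (intro exI[of _ c]) auto
qed

lemma rcf_MVT:
  fixes p :: "'a::real_closed_field poly"
  assumes "a < b"
  shows "\<exists>c. a < c \<and> c < b \<and> poly p b - poly p a = (b - a) * poly (pderiv p) c"
proof -
  define s where "s = (poly p b - poly p a) / (b - a)"
  define q where "q = p - smult s [:- a, 1:] - [:poly p a:]"
  have s: "s * (b - a) = poly p b - poly p a"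
    using assms by (simp add: s_def)
  have "poly q a = 0" "poly q b = 0"
    using s by (auto simp: q_def algebra_simps)
  then obtain c where "a < c" "c < b" "poly (pderiv q) c = 0"
    using rcf_Rolle[OF assms] by blast
  then show ?thesis
    using assms by (intro exI[of _ c])
      (auto simp: q_def s[symmetric] pderiv_diff pderiv_smult pderiv_pCons)
qed

text \<open>The bound is the leading coefficient rather than 0 so that the induction along
  \<open>pCons\<close> closes: beyond 1 + |a| / lc, multiplication by x gains enough to absorb the
  new constant term.\<close>

lemma poly_ge_lead_coeff_at_top:
  fixes p :: "'a::linordered_field poly"
  assumes "lead_coeff p > 0"
  shows "\<exists>B. \<forall>x\<ge>B. lead_coeff p \<le> poly p x"
  using assms
proof (induction p)
  case 0
  then show ?case by simp
next
  case (pCons a p)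
  show ?case
  proof (cases "p = 0")
    case True
    then show ?thesis by (auto intro: exI[of _ 0])
  next
    case False
    then have lc: "lead_coeff p > 0"
      using pCons.prems by simp
    then obtain B where B: "\<And>x. x \<ge> B \<Longrightarrow> lead_coeff p \<le> poly p x"
      using pCons.IH by blast
    have "lead_coeff p \<le> poly (pCons a p) x" if "x \<ge> max B (1 + \<bar>a\<bar> / lead_coeff p)" for x
    proof -
      have "lead_coeff p + \<bar>a\<bar> = (1 + \<bar>a\<bar> / lead_coeff p) * lead_coeff p"
        using lc False by (simp add: field_simps)
      also have "\<dots> \<le> x * lead_coeff p"
        using that lc by (intro mult_right_mono) auto
      also have "\<dots> \<le> x * poly p x"
      proof (intro mult_left_mono B)
        have "0 \<le> 1 + \<bar>a\<bar> / lead_coeff p"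
          using lc by (simp add: add_nonneg_nonneg)
        then show "0 \<le> x" using that by auto
      qed (use that in auto)
      finally show ?thesis
        by (simp add: algebra_simps abs_if split: if_splits)
    qed
    moreover have "lead_coeff (pCons a p) = lead_coeff p"
      using False by simp
    ultimately show ?thesis
      by metis
  qed
qed

lemma poly_pos_at_bot:
  fixes p :: "'a::linordered_field poly"
  assumes "(- 1) ^ degree p * lead_coeff p > 0"
  shows "\<exists>B. \<forall>x\<le>B. 0 < poly p x"
proof -
  define q where "q = pcompose p [:0, - 1:]"
  have "lead_coeff q = (- 1) ^ degree p * lead_coeff p"
    unfolding q_def by (subst lead_coeff_comp) auto
  with assms obtain B where "\<And>x. x \<ge> B \<Longrightarrow> 0 < poly q x"
    using poly_ge_lead_coeff_at_top[of q] by (metis less_le_trans)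
  from this[of "- x" for x] have "\<forall>x\<le>- B. 0 < poly p x"
    by (simp add: q_def poly_pcompose)
  then show ?thesis ..
qed

section \<open>Sign patterns and elimination of one variable\<close>

definition same_sign :: "'a::linordered_field \<Rightarrow> 'b::linordered_field \<Rightarrow> bool" where
  "same_sign a b \<longleftrightarrow> (0 < a \<longleftrightarrow> 0 < b) \<and> (a < 0 \<longleftrightarrow> b < 0)"

definition same_gap :: "'a::linorder set \<Rightarrow> 'a \<Rightarrow> 'a \<Rightarrow> bool" where
  "same_gap A x y \<longleftrightarrow> x \<notin> A \<and> y \<notin> A \<and> (\<forall>u\<in>A. u < x \<longleftrightarrow> u < y)"

text \<open>
  The sign of a polynomial at the upper end of the gap of \<open>A\<close> around \<open>x\<close>, read off from the
  leading coefficient if that end is infinite; dually for \<open>lower_value\<close>.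
\<close>

definition upper_value :: "'a::linordered_field set \<Rightarrow> 'a \<Rightarrow> 'a poly \<Rightarrow> 'a" where
  "upper_value A x p =
    (if \<forall>u\<in>A. \<not> x < u then lead_coeff p else poly p (Min {u\<in>A. x < u}))"

definition lower_value :: "'a::linordered_field set \<Rightarrow> 'a \<Rightarrow> 'a poly \<Rightarrow> 'a" where
  "lower_value A x p =
    (if \<forall>u\<in>A. \<not> u < x then (- 1) ^ degree p * lead_coeff p else poly p (Max {u\<in>A. u < x}))"

text \<open>An order isomorphism between finite sets of points of two fields. Read for two pairs in
  both orders, the equivalence also makes the relation one-to-one.\<close>

definition cut_matching :: "('a::linorder \<times> 'b::linorder) set \<Rightarrow> bool" where
  "cut_matching M \<longleftrightarrow> finite M \<and> (\<forall>(u, v)\<in>M. \<forall>(u', v')\<in>M. u < u' \<longleftrightarrow> v < v')"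

definition same_cut :: "('a::linorder \<times> 'b::linorder) set \<Rightarrow> 'a \<Rightarrow> 'b \<Rightarrow> bool" where
  "same_cut M x y \<longleftrightarrow> x \<notin> Domain M \<and> y \<notin> Range M \<and> (\<forall>(u, v)\<in>M. u < x \<longleftrightarrow> v < y)"

text \<open>Equality of sign diagrams. Every \<open>x\<close> of a gap is compared with every
  \<open>y\<close> of the corresponding gap, so both signs are also forced to be constant on
  gaps.\<close>

definition matches :: "('a::linordered_field \<times> 'b::linordered_field) set \<Rightarrow> 'a poly \<Rightarrow> 'b poly \<Rightarrow> bool" where
  "matches M p q \<longleftrightarrow> (\<forall>x y. (x, y) \<in> M \<or> same_cut M x y \<longrightarrow> same_sign (poly p x) (poly q y))"

lemma same_sign_converse: "same_sign a b \<longleftrightarrow> same_sign b a"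
  by (auto simp: same_sign_def)

lemma same_sign_sym: "same_sign a b \<Longrightarrow> same_sign b a"
  by (auto simp: same_sign_def)

lemma same_sign_minus [simp]: "same_sign (- a) (- b) \<longleftrightarrow> same_sign a b"
  by (auto simp: same_sign_def)

lemma same_sign_zero_iff: "same_sign a b \<Longrightarrow> a = 0 \<longleftrightarrow> b = 0"
  unfolding same_sign_def by (metis linorder_neq_iff)

lemma same_sign_mult: "same_sign a b \<Longrightarrow> same_sign c d \<Longrightarrow> same_sign (a * c) (b * d)"
  by (auto simp: same_sign_def zero_less_mult_iff mult_less_0_iff)

lemma same_sign_mult_cancel:
  "same_sign c d \<Longrightarrow> c \<noteq> 0 \<Longrightarrow> same_sign (c * a) (d * b) \<Longrightarrow> same_sign a b"
  by (auto simp: same_sign_def zero_less_mult_iff mult_less_0_iff linorder_neq_iff)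

lemma same_gap_refl: "x \<notin> A \<Longrightarrow> same_gap A x x"
  by (auto simp: same_gap_def)

lemma same_gap_between:
  assumes "same_gap A x y" "x \<le> z" "z \<le> y"
  shows "same_gap A x z"
  using assms unfolding same_gap_def
  by (metis antisym_conv2 less_le_trans order_less_le_trans linorder_not_less order_le_less_trans)

lemma upper_value_cases:
  fixes A :: "'a::linordered_field set"
  assumes "finite A" "x \<notin> A"
  obtains (bounded) u where "u \<in> A" "x < u" "\<And>z. x < z \<Longrightarrow> z < u \<Longrightarrow> same_gap A x z"
      "\<And>p. upper_value A x p = poly p u"
  | (unbounded) "\<And>z. x < z \<Longrightarrow> same_gap A x z" "\<And>p. upper_value A x p = lead_coeff p"
proof (cases "\<forall>u\<in>A. \<not> x < u")
  case True
  have "same_gap A x z" if "x < z" for z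
    using True assms(2) that unfolding same_gap_def by (metis less_trans linorder_neqE)
  with True show ?thesis
    by (intro that(2)) (auto simp: upper_value_def)
next
  case False
  have fin: "finite {u\<in>A. x < u}" and ne: "{u\<in>A. x < u} \<noteq> {}"
    using False assms by auto
  have mem: "Min {u\<in>A. x < u} \<in> {u\<in>A. x < u}"
    using Min_in[OF fin ne] .
  have least: "Min {u\<in>A. x < u} \<le> w" if "w \<in> A" "x < w" for w
    using Min_le[OF fin] that by blast
  show ?thesis
  proof (rule that(1)[of "Min {u\<in>A. x < u}"])
    fix z
    assume z: "x < z" "z < Min {u\<in>A. x < u}"
    have "w < x" if "w \<in> A" "w \<le> z" for w
      using least[of w] that z assms(2) by (metis leD le_less_trans linorder_neqE)
    then show "same_gap A x z"
      using z assms(2) unfolding same_gap_def by (metis less_imp_le less_trans order_refl less_asym)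
  qed (use mem False in \<open>auto simp: upper_value_def\<close>)
qed

lemma lower_value_cases:
  fixes A :: "'a::linordered_field set"
  assumes "finite A" "x \<notin> A"
  obtains (bounded) u where "u \<in> A" "u < x" "\<And>z. u < z \<Longrightarrow> z < x \<Longrightarrow> same_gap A x z"
      "\<And>p. lower_value A x p = poly p u"
  | (unbounded) "\<And>z. z < x \<Longrightarrow> same_gap A x z"
      "\<And>p. lower_value A x p = (- 1) ^ degree p * lead_coeff p"
proof (cases "\<forall>u\<in>A. \<not> u < x")
  case True
  have "same_gap A x z" if "z < x" for z
    using True assms(2) that unfolding same_gap_def by (metis less_trans)
  with True show ?thesis
    by (intro that(2)) (auto simp: lower_value_def)
next
  case False
  have fin: "finite {u\<in>A. u < x}" and ne: "{u\<in>A. u < x} \<noteq> {}"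
    using False assms by auto
  have mem: "Max {u\<in>A. u < x} \<in> {u\<in>A. u < x}"
    using Max_in[OF fin ne] .
  have greatest: "w \<le> Max {u\<in>A. u < x}" if "w \<in> A" "w < x" for w
    using Max_ge[OF fin] that by blast
  show ?thesis
  proof (rule that(1)[of "Max {u\<in>A. u < x}"])
    fix z
    assume z: "Max {u\<in>A. u < x} < z" "z < x"
    have "w < z" if "w \<in> A" "w < x" for w
      using greatest[OF that] z by simp
    then show "same_gap A x z"
      using z assms(2) unfolding same_gap_def by (metis less_trans less_irrefl)
  qed (use mem False in \<open>auto simp: lower_value_def\<close>)
qed

section \<open>Increasing polynomials on a gap: signs at the ends and roots\<close>

lemma increasing_on_gap:
  fixes p :: "'a::real_closed_field poly"
  assumes "x < y" and "\<And>z. x < z \<Longrightarrow> z < y \<Longrightarrow> 0 < poly (pderiv p) z"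
  shows "poly p x < poly p y"
proof -
  obtain c where "x < c" "c < y" "poly p y - poly p x = (y - x) * poly (pderiv p) c"
    using rcf_MVT[OF assms(1)] by blast
  with assms show ?thesis
    by (metis diff_gt_0_iff_gt mult_pos_pos)
qed

text \<open>Strict monotonicity lifts the value at the right end above \<open>poly p x\<close>; if
  that end is infinite, a negative leading coefficient would make \<open>p\<close> negative far to
  the right.\<close>

lemma upper_value_pos:
  fixes p :: "'a::real_closed_field poly"
  assumes A: "finite A" "x \<notin> A" and inc: "\<And>z. same_gap A x z \<Longrightarrow> 0 < poly (pderiv p) z"
    and "0 \<le> poly p x"
  shows "0 < upper_value A x p"
  using A
proof (cases rule: upper_value_cases)
  case (bounded u)
  then have "poly p x < poly p u"
    by (intro increasing_on_gap inc) auto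
  with bounded assms show ?thesis by simp
next
  case unbounded
  have inc': "poly p x' < poly p y" if "x \<le> x'" "x' < y" for x' y
    using that by (intro increasing_on_gap inc unbounded) auto
  have "lead_coeff p \<noteq> 0"
    using inc[OF same_gap_refl[OF A(2)]] by auto
  moreover have "\<not> lead_coeff p < 0"
  proof
    assume "lead_coeff p < 0"
    then obtain B where B: "\<And>z. z \<ge> B \<Longrightarrow> 0 < poly (- p) z"
      using poly_ge_lead_coeff_at_top[of "- p"] by (metis lead_coeff_minus less_le_trans neg_0_less_iff_less)
    have "0 < poly p (max B (x + 1))"
      using inc'[of x "max B (x + 1)"] assms by (simp add: less_max_iff_disj)
    with B[of "max B (x + 1)"] show False by simp
  qed
  ultimately show ?thesis
    unfolding unbounded(2) by (metis linorder_neqE)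
qed

text \<open>The intermediate value property between \<open>x\<close> and the right end of its gap;
  if that end is infinite, a far point where \<open>p\<close> is positive takes its place.\<close>

lemma upper_value_root:
  fixes p :: "'a::real_closed_field poly"
  assumes A: "finite A" "x \<notin> A" and "poly p x < 0" "0 < upper_value A x p"
  shows "\<exists>z. x < z \<and> same_gap A x z \<and> poly p z = 0"
  using A
proof (cases rule: upper_value_cases)
  case (bounded u)
  then show ?thesis
    using assms rcf_IVT_pos[of x u p] by auto
next
  case unbounded
  with assms obtain B where B: "\<And>z. z \<ge> B \<Longrightarrow> 0 < poly p z"
    using poly_ge_lead_coeff_at_top[of p] by (metis less_le_trans)
  have "x < max B (x + 1)"
    by (simp add: less_max_iff_disj)
  with rcf_IVT_pos[OF this, of p] assms B[of "max B (x + 1)"] unbounded show ?thesis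
    by auto
qed

lemma lower_value_neg:
  fixes p :: "'a::real_closed_field poly"
  assumes A: "finite A" "x \<notin> A" and inc: "\<And>z. same_gap A x z \<Longrightarrow> 0 < poly (pderiv p) z"
    and "poly p x \<le> 0"
  shows "lower_value A x p < 0"
  using A
proof (cases rule: lower_value_cases)
  case (bounded u)
  then have "poly p u < poly p x"
    by (intro increasing_on_gap inc) auto
  with bounded assms show ?thesis by simp
next
  case unbounded
  have inc': "poly p y < poly p x'" if "x' \<le> x" "y < x'" for x' y
    using that by (intro increasing_on_gap inc unbounded) auto
  have "lead_coeff p \<noteq> 0"
    using inc[OF same_gap_refl[OF A(2)]] by auto
  moreover have "\<not> 0 < (- 1) ^ degree p * lead_coeff p"
  proof
    assume "0 < (- 1) ^ degree p * lead_coeff p"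
    then obtain B where B: "\<And>z. z \<le> B \<Longrightarrow> 0 < poly p z"
      using poly_pos_at_bot[of "p"] by metis
    have "poly p (min B (x - 1)) < 0"
      using inc'[of x "min B (x - 1)"] assms by (simp add: min_less_iff_disj)
    with B[of "min B (x - 1)"] show False by simp
  qed
  ultimately show ?thesis
    unfolding unbounded(2) by (metis linorder_neqE mult_eq_0_iff power_eq_0_iff neg_equal_0_iff_equal one_neq_zero)
qed

lemma lower_value_root:
  fixes p :: "'a::real_closed_field poly"
  assumes A: "finite A" "x \<notin> A" and "0 < poly p x" "lower_value A x p < 0"
  shows "\<exists>z. z < x \<and> same_gap A x z \<and> poly p z = 0"
  using A
proof (cases rule: lower_value_cases)
  case (bounded u)
  then show ?thesis
    using assms rcf_IVT_pos[of u x p] by auto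
next
  case unbounded
  with assms have "0 < (- 1) ^ degree (- p) * lead_coeff (- p)"
    by simp
  then obtain B where B: "\<And>z. z \<le> B \<Longrightarrow> 0 < poly (- p) z"
    using poly_pos_at_bot[of "- p"] by metis
  have "min B (x - 1) < x"
    by (simp add: min_less_iff_disj)
  with rcf_IVT_pos[OF this, of p] assms B[of "min B (x - 1)"] unbounded show ?thesis
    by auto
qed

section \<open>Matchings between points of two fields and their corresponding gaps\<close>

lemma cut_matching_finite:
  assumes "cut_matching M"
  shows "finite M" "finite (Domain M)" "finite (Range M)"
  using assms by (auto simp: cut_matching_def finite_Domain finite_Range)

lemma cut_matching_less: "cut_matching M \<Longrightarrow> (u, v) \<in> M \<Longrightarrow> (u', v') \<in> M \<Longrightarrow> u < u' \<longleftrightarrow> v < v'"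
  by (auto simp: cut_matching_def)

lemma cut_matching_converse: "cut_matching M \<Longrightarrow> cut_matching (M\<inverse>)"
  unfolding cut_matching_def by auto

lemma same_cut_converse: "same_cut (M\<inverse>) y x \<longleftrightarrow> same_cut M x y"
  unfolding same_cut_def by auto

lemma same_cut_gapI:
  assumes "same_cut M x y" "same_gap (Domain M) x x'" "same_gap (Range M) y y'"
  shows "same_cut M x' y'"
  using assms unfolding same_cut_def same_gap_def by (auto 0 4)

lemma same_cut_imp_same_gap:
  assumes "same_cut M x y" "same_cut M x' y"
  shows "same_gap (Domain M) x x'"
  using assms unfolding same_cut_def same_gap_def by (auto 0 4)

lemma same_cut_greater:
  assumes "same_cut M x y" "(u, v) \<in> M"
  shows "x < u \<longleftrightarrow> y < v"
  using assms unfolding same_cut_def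
  by (metis (mono_tags, lifting) Domain.DomainI Range.intros case_prodD linorder_less_linear order_less_asym)

text \<open>As \<open>M\<close> is monotone and is cut alike by \<open>x\<close> and
  \<open>y\<close>, the next point right of \<open>x\<close> is matched with the next point right of
  \<open>y\<close>; if there is none, the leading coefficients decide.\<close>

lemma upper_value_same_sign:
  assumes "cut_matching M" "same_cut M x y" "same_sign (lead_coeff p) (lead_coeff q)"
    and "\<And>u v. (u, v) \<in> M \<Longrightarrow> same_sign (poly p u) (poly q v)"
  shows "same_sign (upper_value (Domain M) x p) (upper_value (Range M) y q)"
proof (cases "\<forall>u\<in>Domain M. \<not> x < u")
  case True
  then have "\<forall>v\<in>Range M. \<not> y < v"
    using same_cut_greater[OF assms(2)] by blast
  with True assms(3) show ?thesis
    by (simp add: upper_value_def)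
next
  case False
  then have False': "\<not> (\<forall>v\<in>Range M. \<not> y < v)"
    using same_cut_greater[OF assms(2)] by blast
  let ?U = "{u\<in>Domain M. x < u}" and ?V = "{v\<in>Range M. y < v}"
  have fin: "finite ?U" "finite ?V" and ne: "?U \<noteq> {}" "?V \<noteq> {}"
    using cut_matching_finite[OF assms(1)] False False' by auto
  from Min_in[OF fin(1) ne(1)] obtain v where v: "(Min ?U, v) \<in> M" "x < Min ?U"
    by auto
  have "Min ?V = v"
  proof (rule Min_eqI[OF fin(2)])
    show "v \<in> ?V"
      using v same_cut_greater[OF assms(2)] by blast
    fix w assume "w \<in> ?V"
    then obtain t where t: "(t, w) \<in> M" "y < w" by auto
    then have "Min ?U \<le> t"
      using same_cut_greater[OF assms(2)] fin by (intro Min_le) auto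
    then show "v \<le> w"
      using cut_matching_less[OF assms(1) t(1) v(1)] by (simp add: not_less[symmetric])
  qed
  with v(1) assms(4) show ?thesis
    unfolding upper_value_def if_not_P[OF False] if_not_P[OF False'] by simp
qed

lemma lower_value_same_sign:
  assumes "cut_matching M" "same_cut M x y" "same_sign (lead_coeff p) (lead_coeff q)"
    and "degree p = degree q"
    and "\<And>u v. (u, v) \<in> M \<Longrightarrow> same_sign (poly p u) (poly q v)"
  shows "same_sign (lower_value (Domain M) x p) (lower_value (Range M) y q)"
proof -
  have less: "u < x \<longleftrightarrow> v < y" if "(u, v) \<in> M" for u v
    using assms(2) that unfolding same_cut_def by blast
  show ?thesis
  proof (cases "\<forall>u\<in>Domain M. \<not> u < x")
    case True
    then have "\<forall>v\<in>Range M. \<not> v < y"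
      using less by blast
    with True assms(3,4) show ?thesis
      by (cases "even (degree q)") (simp_all add: lower_value_def)
  next
    case False
    then have False': "\<not> (\<forall>v\<in>Range M. \<not> v < y)"
      using less by blast
    let ?U = "{u\<in>Domain M. u < x}" and ?V = "{v\<in>Range M. v < y}"
    have fin: "finite ?U" "finite ?V" and ne: "?U \<noteq> {}" "?V \<noteq> {}"
      using cut_matching_finite[OF assms(1)] False False' by auto
    from Max_in[OF fin(1) ne(1)] obtain v where v: "(Max ?U, v) \<in> M" "Max ?U < x"
      by auto
    have "Max ?V = v"
    proof (rule Max_eqI[OF fin(2)])
      show "v \<in> ?V"
        using v less by blast
      fix w assume "w \<in> ?V"
      then obtain t where t: "(t, w) \<in> M" "w < y" by auto
      then have "t \<le> Max ?U"
        using less fin by (intro Max_ge) auto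
      then show "w \<le> v"
        using cut_matching_less[OF assms(1) v(1) t(1)] by (simp add: not_less[symmetric])
    qed
    with v(1) assms(5) show ?thesis
      unfolding lower_value_def if_not_P[OF False] if_not_P[OF False'] by simp
  qed
qed

text \<open>Suppose \<open>poly p x\<close> is positive but \<open>poly q y\<close> is not. The
  positive upper value passes from \<open>p\<close> to \<open>q\<close> and gives \<open>q\<close> a
  root at or right of \<open>y\<close>; the negative lower value passes from \<open>q\<close> to
  \<open>p\<close> and gives \<open>p\<close> a root left of \<open>x\<close>. These two roots lie
  in corresponding gaps, contradicting \<open>roots\<close>. The other sign is dual.\<close>

lemma gap_sign_increasing:
  fixes M :: "('a::real_closed_field \<times> 'b::real_closed_field) set"
  assumes M: "cut_matching M" and cut: "same_cut M x y"
    and deg: "degree p = degree q" and lc: "same_sign (lead_coeff p) (lead_coeff q)"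
    and val: "\<And>u v. (u, v) \<in> M \<Longrightarrow> same_sign (poly p u) (poly q v)"
    and inc: "\<And>z. same_gap (Domain M) x z \<Longrightarrow> 0 < poly (pderiv p) z"
      "\<And>z. same_gap (Range M) y z \<Longrightarrow> 0 < poly (pderiv q) z"
    and roots: "\<And>u v. same_cut M u v \<Longrightarrow> poly p u = 0 \<Longrightarrow> poly q v = 0 \<Longrightarrow> y \<noteq> v \<and> (u < x \<longleftrightarrow> v < y)"
  shows "0 < poly p x \<Longrightarrow> 0 < poly q y" and "poly p x < 0 \<Longrightarrow> poly q y < 0"
proof -
  note fin = cut_matching_finite[OF M]
  have x: "x \<notin> Domain M" and y: "y \<notin> Range M"
    using cut by (auto simp: same_cut_def)
  note upper = upper_value_same_sign[OF M cut lc val] and lower = lower_value_same_sign[OF M cut lc deg val]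
  note pair = same_cut_gapI[OF cut]
  show "0 < poly q y" if px: "0 < poly p x"
  proof (rule ccontr)
    assume neg: "\<not> 0 < poly q y"
    have "0 < upper_value (Domain M) x p"
      using px by (intro upper_value_pos fin x inc) auto
    then have "0 < upper_value (Range M) y q"
      using upper by (simp add: same_sign_def)
    then obtain v where v: "y \<le> v" "same_gap (Range M) y v" "poly q v = 0"
      using upper_value_root[OF fin(3) y, of q] same_gap_refl[OF y] neg
      by (metis less_imp_le linorder_neqE order_refl)
    have "lower_value (Range M) y q < 0"
      using neg by (intro lower_value_neg fin y inc) auto
    then have "lower_value (Domain M) x p < 0"
      using lower by (simp add: same_sign_def)
    then obtain u where u: "u < x" "same_gap (Domain M) x u" "poly p u = 0"
      using lower_value_root[OF fin(2) x px] by blast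
    show False
      using roots[OF pair[OF u(2) v(2)] u(3) v(3)] u(1) v(1) by auto
  qed
  show "poly q y < 0" if px: "poly p x < 0"
  proof (rule ccontr)
    assume pos: "\<not> poly q y < 0"
    have "lower_value (Domain M) x p < 0"
      using px by (intro lower_value_neg fin x inc) auto
    then have "lower_value (Range M) y q < 0"
      using lower by (simp add: same_sign_def)
    then obtain v where v: "v \<le> y" "same_gap (Range M) y v" "poly q v = 0"
      using lower_value_root[OF fin(3) y, of q] same_gap_refl[OF y] pos
      by (metis less_imp_le linorder_neqE order_refl)
    have "0 < upper_value (Range M) y q"
      using pos by (intro upper_value_pos fin y inc) auto
    then have "0 < upper_value (Domain M) x p"
      using upper by (simp add: same_sign_def)
    then obtain u where u: "x < u" "same_gap (Domain M) x u" "poly p u = 0"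
      using upper_value_root[OF fin(2) x px] by blast
    show False
      using roots[OF pair[OF u(2) v(2)] u(3) v(3)] u(1) v(1) by auto
  qed
qed

text \<open>A gap contains an open interval, which is infinite in a dense order. Hence only the zero
  polynomial vanishes on a whole gap.\<close>

lemma infinite_same_gap:
  fixes A :: "'a::linordered_field set"
  assumes "finite A" "x \<notin> A"
  shows "infinite {z. same_gap A x z}"
proof -
  obtain u where "x < u" "\<And>z. x < z \<Longrightarrow> z < u \<Longrightarrow> same_gap A x z"
    using assms
  proof (cases rule: upper_value_cases)
    case unbounded
    then show ?thesis using that[of "x + 1"] by auto
  qed (use that in blast)
  then have "{x<..<u} \<subseteq> {z. same_gap A x z}" "infinite {x<..<u}"
    by (auto simp: infinite_Ioo)
  then show ?thesis
    using finite_subset by blast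
qed

text \<open>Partners of points left of \<open>x\<close> lie below partners of points right of
  \<open>x\<close>, and a dense order without endpoints has room for \<open>y\<close> between or
  beyond these finite sets.\<close>

lemma same_cut_exists:
  fixes M :: "('a::linordered_field \<times> 'b::linordered_field) set"
  assumes M: "cut_matching M" and x: "x \<notin> Domain M"
  shows "\<exists>y. same_cut M x y"
proof -
  define L where "L = {v. \<exists>u. (u, v) \<in> M \<and> u < x}"
  define U where "U = {v. \<exists>u. (u, v) \<in> M \<and> x < u}"
  have fin: "finite L" "finite U"
    using cut_matching_finite(3)[OF M] by (auto simp: L_def U_def elim!: rev_finite_subset)
  have LU: "l < v" if "l \<in> L" "v \<in> U" for l v
    using that cut_matching_less[OF M] by (force simp: L_def U_def)
  have "\<exists>y. (\<forall>l\<in>L. l < y) \<and> (\<forall>v\<in>U. y < v)"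
  proof (cases "L = {}"; cases "U = {}")
    assume "L \<noteq> {}" "U \<noteq> {}"
    then have "Max L < Min U"
      using LU fin by auto
    then obtain y where "Max L < y" "y < Min U"
      using dense by blast
    then show ?thesis
      using \<open>L \<noteq> {}\<close> \<open>U \<noteq> {}\<close> fin by auto
  next
    assume "L = {}" "U \<noteq> {}"
    then show ?thesis
      using lt_ex[of "Min U"] fin by auto
  next
    assume "L \<noteq> {}" "U = {}"
    then show ?thesis
      using gt_ex[of "Max L"] fin by auto
  qed auto
  then obtain y where y: "\<And>l. l \<in> L \<Longrightarrow> l < y" "\<And>v. v \<in> U \<Longrightarrow> y < v"
    by blast
  have "(u < x \<longleftrightarrow> v < y) \<and> v \<noteq> y" if "(u, v) \<in> M" for u v
  proof (cases "u < x")
    case True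
    then have "v \<in> L" using that by (auto simp: L_def)
    with True y(1) show ?thesis by auto
  next
    case False
    then have "x < u" using that x by (metis DomainI linorder_neqE)
    then have "v \<in> U" using that by (auto simp: U_def)
    with False y(2)[of v] show ?thesis by auto
  qed
  with x have "same_cut M x y"
    unfolding same_cut_def by blast
  then show ?thesis ..
qed

text \<open>
  Provided the derivatives already match, \<open>p\<close> and \<open>q\<close> have at most one root in each gap, so pairing
  the roots that lie in corresponding gaps keeps the matching monotone.
\<close>

definition extend_matching ::
  "('a::linordered_field \<times> 'b::linordered_field) set \<Rightarrow> 'a poly \<Rightarrow> 'b poly \<Rightarrow> ('a \<times> 'b) set" where
  "extend_matching M p q = M \<union> {(u, v). same_cut M u v \<and> poly p u = 0 \<and> poly q v = 0}"

lemma matches_converse: "matches M p q \<Longrightarrow> matches (M\<inverse>) q p"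
  unfolding matches_def same_cut_converse by (metis converseD same_sign_converse)

lemma matches_uminus: "matches M p q \<Longrightarrow> matches M (- p) (- q)"
  unfolding matches_def by simp

lemma extend_matching_converse: "extend_matching (M\<inverse>) q p = (extend_matching M p q)\<inverse>"
  unfolding extend_matching_def same_cut_converse by auto

lemma same_cut_mono: "same_cut M' x y \<Longrightarrow> M \<subseteq> M' \<Longrightarrow> same_cut M x y"
  unfolding same_cut_def by blast

lemma matches_mono:
  assumes "matches M p' q'"
  shows "matches (extend_matching M p q) p' q'"
  unfolding matches_def
proof (intro allI impI)
  fix x y
  assume "(x, y) \<in> extend_matching M p q \<or> same_cut (extend_matching M p q) x y"
  moreover have "M \<subseteq> extend_matching M p q"
    by (auto simp: extend_matching_def)
  ultimately have "(x, y) \<in> M \<or> same_cut M x y"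
    using same_cut_mono by (auto simp: extend_matching_def)
  with assms show "same_sign (poly p' x) (poly q' y)"
    unfolding matches_def by blast
qed

context
  fixes M :: "('a::real_closed_field \<times> 'b::real_closed_field) set"
    and p :: "'a poly" and q :: "'b poly"
  assumes M: "cut_matching M" and deg: "degree p = degree q" "0 < degree p"
    and deriv: "matches M (pderiv p) (pderiv q)"
begin

text \<open>A single zero of the derivative of \<open>p\<close> in the gap would, by the matching,
  make the derivative of \<open>q\<close> vanish on the whole corresponding gap, hence identically;
  in characteristic 0 the positive degree forbids this.\<close>

lemma pderiv_nonzero_in_gap:
  assumes "same_cut M x y"
  shows "poly (pderiv p) x \<noteq> 0"
proof
  assume 0: "poly (pderiv p) x = 0"
  have y: "y \<notin> Range M" and x: "x \<notin> Domain M"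
    using assms by (auto simp: same_cut_def)
  have "poly (pderiv q) z = 0" if "same_gap (Range M) y z" for z
    using same_cut_gapI[OF assms same_gap_refl[OF x] that] deriv 0
    unfolding matches_def by (metis same_sign_zero_iff)
  then have "{z. same_gap (Range M) y z} \<subseteq> {z. poly (pderiv q) z = 0}"
    by blast
  moreover have "pderiv q \<noteq> 0"
    using deg by (simp add: pderiv_eq_0_iff)
  ultimately show False
    using infinite_same_gap[OF cut_matching_finite(3)[OF M] y] poly_roots_finite finite_subset by blast
qed

lemma root_unique_in_gap:
  assumes "same_cut M u v" "same_cut M u' v" "poly p u = 0" "poly p u' = 0"
  shows "u = u'"
proof -
  have False if *: "u < u'" "same_cut M u v" "same_cut M u' v" "poly p u = 0" "poly p u' = 0" for u u'
  proof -
    obtain c where c: "u < c" "c < u'" "poly (pderiv p) c = 0"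
      using rcf_Rolle * by blast
    have v: "v \<notin> Range M"
      using * by (auto simp: same_cut_def)
    have "same_cut M c v"
      using same_cut_gapI[OF *(2) same_gap_between[OF same_cut_imp_same_gap[OF *(2,3)]] same_gap_refl[OF v]] c
      by simp
    then show False
      using pderiv_nonzero_in_gap c(3) by blast
  qed
  then show ?thesis
    using assms by (metis linorder_neqE)
qed

lemma extend_matching_less:
  assumes "(u, v) \<in> extend_matching M p q" "(u', v') \<in> extend_matching M p q" "u < u'"
  shows "v < v'"
proof -
  have old: "same_cut M u v" if "(u, v) \<notin> M" "(u, v) \<in> extend_matching M p q" for u v
    using that by (auto simp: extend_matching_def)
  consider "(u, v) \<in> M" "(u', v') \<in> M" | "(u, v) \<in> M" "same_cut M u' v'"
    | "same_cut M u v" "(u', v') \<in> M" | "(u, v) \<notin> M" "(u', v') \<notin> M"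
    using old assms by blast
  then show ?thesis
  proof cases
    case 1
    then show ?thesis using cut_matching_less[OF M] assms(3) by blast
  next
    case 2
    then show ?thesis using assms(3) unfolding same_cut_def by blast
  next
    case 3
    then show ?thesis using assms(3) same_cut_greater by blast
  next
    \<comment> \<open>Two new pairs. Roots in the same gap would coincide, so some old matched point
      separates \<open>u\<close> from \<open>u'\<close>, and its partner separates \<open>v\<close>
      from \<open>v'\<close>.\<close>
    case 4
    then have uv: "same_cut M u v" "poly p u = 0" and uv': "same_cut M u' v'" "poly p u' = 0"
      using assms by (auto simp: extend_matching_def)
    show ?thesis
    proof (cases "same_gap (Domain M) u' u")
      case True
      have "v' \<notin> Range M"
        using uv' by (auto simp: same_cut_def)
      then have "same_cut M u v'"
        using same_cut_gapI[OF uv'(1) True] same_gap_refl by blast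
      then have "u = u'"
        using root_unique_in_gap uv uv' by blast
      with assms show ?thesis by simp
    next
      case False
      have "u \<notin> Domain M" "u' \<notin> Domain M"
        using uv uv' by (auto simp: same_cut_def)
      with False obtain w t where w: "(w, t) \<in> M" "\<not> (w < u \<longleftrightarrow> w < u')"
        by (auto simp: same_gap_def)
      then have "u < w" "w < u'"
        using assms(3) \<open>u \<notin> Domain M\<close> by (metis less_trans linorder_neqE DomainI)+
      then have "v < t" "t < v'"
        using same_cut_greater[OF uv(1) w(1)] uv'(1) w(1) unfolding same_cut_def by auto
      then show ?thesis by (rule less_trans)
    qed
  qed
qed

end

context
  fixes M :: "('a::real_closed_field \<times> 'b::real_closed_field) set"
    and p :: "'a poly" and q :: "'b poly"
  assumes M: "cut_matching M" and deg: "degree p = degree q" "0 < degree p"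
    and deriv: "matches M (pderiv p) (pderiv q)"
begin

lemma cut_matching_extend: "cut_matching (extend_matching M p q)"
  unfolding cut_matching_def
proof (intro conjI)
  have "p \<noteq> 0" "q \<noteq> 0"
    using deg by auto
  then have "finite ({u. poly p u = 0} \<times> {v. poly q v = 0})"
    by (intro finite_cartesian_product poly_roots_finite)
  then have "finite {(u, v). same_cut M u v \<and> poly p u = 0 \<and> poly q v = 0}"
    by (rule rev_finite_subset) auto
  then show "finite (extend_matching M p q)"
    using cut_matching_finite(1)[OF M] by (simp add: extend_matching_def)
next
  \<comment> \<open>The reverse implication is the same fact with the two fields exchanged.\<close>
  have conv: "v < v' \<Longrightarrow> u < u'"
    if "(u, v) \<in> extend_matching M p q" "(u', v') \<in> extend_matching M p q" for u v u' v'
    using extend_matching_less[of "M\<inverse>" q p v u v' u'] that M deg matches_converse[OF deriv]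
    by (simp add: extend_matching_converse cut_matching_converse)
  then show "\<forall>(u, v)\<in>extend_matching M p q. \<forall>(u', v')\<in>extend_matching M p q. (u < u') = (v < v')"
    using extend_matching_less[OF M deg deriv] by blast
qed

lemma matches_extend:
  assumes lc: "same_sign (lead_coeff p) (lead_coeff q)"
    and val: "\<And>u v. (u, v) \<in> M \<Longrightarrow> same_sign (poly p u) (poly q v)"
  shows "matches (extend_matching M p q) p q"
  unfolding matches_def
proof (intro allI impI)
  fix x y
  assume "(x, y) \<in> extend_matching M p q \<or> same_cut (extend_matching M p q) x y"
  then consider "(x, y) \<in> M" | "poly p x = 0" "poly q y = 0" | "same_cut (extend_matching M p q) x y"
    by (auto simp: extend_matching_def)
  then show "same_sign (poly p x) (poly q y)"
  proof cases
    case 1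
    then show ?thesis by (rule val)
  next
    case 3
    have cut: "same_cut M x y"
      using same_cut_mono[OF 3] by (auto simp: extend_matching_def)
    have x: "x \<notin> Domain M" and y: "y \<notin> Range M"
      using cut by (auto simp: same_cut_def)
    have roots: "x \<noteq> u \<and> y \<noteq> v \<and> (u < x \<longleftrightarrow> v < y)"
      if "same_cut M u v" "poly p u = 0" "poly q v = 0" for u v
    proof -
      have "(u, v) \<in> extend_matching M p q"
        using that by (simp add: extend_matching_def)
      with 3 show ?thesis
        unfolding same_cut_def by blast
    qed
    \<comment> \<open>Stated for arbitrary \<open>p\<close> and \<open>q\<close>, so that it also
      applies to their negatives when the derivative is negative at \<open>x\<close>.\<close>
    have pos: "same_sign (poly p x) (poly q y)"
      if deg: "degree p = degree q" and deriv: "matches M (pderiv p) (pderiv q)" and lc: "same_sign (lead_coeff p) (lead_coeff q)"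
        and val: "\<And>u v. (u, v) \<in> M \<Longrightarrow> same_sign (poly p u) (poly q v)"
        and roots: "\<And>u v. same_cut M u v \<Longrightarrow> poly p u = 0 \<Longrightarrow> poly q v = 0 \<Longrightarrow>
           x \<noteq> u \<and> y \<noteq> v \<and> (u < x \<longleftrightarrow> v < y)"
        and dp: "0 < poly (pderiv p) x" for p :: "'a poly" and q :: "'b poly"
    proof -
      \<comment> \<open>The sign of one derivative at the single point \<open>x\<close> spreads over
        the whole gap of \<open>y\<close>, and from there back over the whole gap of
        \<open>x\<close>.\<close>
      have dq: "0 < poly (pderiv q) z" if "same_gap (Range M) y z" for z
        using same_cut_gapI[OF cut same_gap_refl[OF x] that] deriv dp
        unfolding matches_def same_sign_def by blast
      have dp': "0 < poly (pderiv p) z" if "same_gap (Domain M) x z" for z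
        using same_cut_gapI[OF cut that same_gap_refl[OF y]] deriv dq[OF same_gap_refl[OF y]]
        unfolding matches_def same_sign_def by blast
      have roots': "x \<noteq> u \<and> (v < y \<longleftrightarrow> u < x)"
        if "same_cut (M\<inverse>) v u" "poly q v = 0" "poly p u = 0" for u v
        using roots[of u v] that by (auto simp: same_cut_converse)
      note fwd = gap_sign_increasing[OF M cut deg lc val dp' dq]
      note bwd = gap_sign_increasing[OF cut_matching_converse[OF M] cut[folded same_cut_converse[of M y x]] deg[symmetric] ]
      have "0 < poly q y \<Longrightarrow> 0 < poly p x" "poly q y < 0 \<Longrightarrow> poly p x < 0"
        by (rule bwd; use lc val dp' dq roots' in \<open>auto intro: same_sign_sym\<close>)+
      moreover have "0 < poly p x \<Longrightarrow> 0 < poly q y" "poly p x < 0 \<Longrightarrow> poly q y < 0"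
        by (rule fwd; use roots in \<open>auto\<close>)+
      ultimately show ?thesis
        unfolding same_sign_def by blast
    qed
    show ?thesis
    proof (cases "0 < poly (pderiv p) x")
      case True
      show ?thesis
        by (rule pos) (use deg deriv lc val roots True in auto)
    next
      case False
      then have "poly (pderiv p) x < 0"
        using pderiv_nonzero_in_gap[OF M deg deriv cut] by auto
      then have "same_sign (poly (- p) x) (poly (- q) y)"
        by (intro pos) (use deg matches_uminus[OF deriv] lc val roots in \<open>auto simp: pderiv_minus\<close>)
      then show ?thesis by simp
    qed
  qed (auto simp: same_sign_def)
qed

end

section \<open>Ring homomorphisms, formal derivatives and pseudo-remainders\<close>

definition unital_hom :: "('c::comm_ring_1 \<Rightarrow> 'd::comm_ring_1) \<Rightarrow> bool" where
  "unital_hom h \<longleftrightarrow> h 1 = 1 \<and> (\<forall>a b. h (a + b) = h a + h b) \<and> (\<forall>a b. h (a * b) = h a * h b)"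

lemma unital_hom_simps:
  assumes "unital_hom h"
  shows "h 0 = 0" "h 1 = 1" "h (a + b) = h a + h b" "h (a * b) = h a * h b" "h (- a) = - h a"
    "h (a - b) = h a - h b" "h (a ^ n) = h a ^ n" "h (of_nat n) = of_nat n" "h (sum f A) = (\<Sum>x\<in>A. h (f x))"
    "h (prod f A) = (\<Prod>x\<in>A. h (f x))"
proof -
  show *: "h 1 = 1" "h (a + b) = h a + h b" "h (a * b) = h a * h b" for a b
    using assms by (auto simp: unital_hom_def)
  show 0: "h 0 = 0"
    using *(2)[of 0 0] by simp
  show m: "h (- a) = - h a" for a
    using *(2)[of a "- a"] 0 by (simp add: eq_neg_iff_add_eq_0 add.commute)
  show "h (a - b) = h a - h b"
    using *(2)[of a "- b"] m by simp
  show "h (a ^ n) = h a ^ n"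
    by (induction n) (auto simp: *)
  show "h (of_nat n) = of_nat n"
    by (induction n) (auto simp: * 0)
  show "h (sum f A) = (\<Sum>x\<in>A. h (f x))"
    by (induction A rule: infinite_finite_induct) (auto simp: * 0)
  show "h (prod f A) = (\<Prod>x\<in>A. h (f x))"
    by (induction A rule: infinite_finite_induct) (auto simp: * 0)
qed

lemma coeff_map_poly_hom: "unital_hom h \<Longrightarrow> coeff (map_poly h p) n = h (coeff p n)"
  by (simp add: coeff_map_poly unital_hom_simps)

lemma unital_hom_map_poly:
  assumes "unital_hom h"
  shows "unital_hom (map_poly h)"
  unfolding unital_hom_def using assms
  by (auto intro!: poly_eqI simp: coeff_map_poly_hom coeff_mult unital_hom_simps map_poly_1')

lemma map_poly_hom_smult: "unital_hom h \<Longrightarrow> map_poly h (smult c p) = smult (h c) (map_poly h p)"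
  by (intro poly_eqI) (simp add: coeff_map_poly_hom unital_hom_simps)

lemma poly_map_poly_hom: "unital_hom h \<Longrightarrow> poly (map_poly h p) (h x) = h (poly p x)"
  by (induction p) (auto simp: map_poly_pCons unital_hom_simps)

text \<open>
  The library's \<^const>\<open>pderiv\<close> is unavailable over a coefficient ring with zero divisors.
\<close>

definition formal_deriv :: "'c::comm_ring_1 poly \<Rightarrow> 'c poly" where
  "formal_deriv p = (\<Sum>k<degree p. monom (of_nat (Suc k) * coeff p (Suc k)) k)"

text \<open>Stands in for \<open>p\<close> under a homomorphism that kills the leading
  coefficient.\<close>

definition drop_lead :: "'c::comm_ring_1 poly \<Rightarrow> 'c poly" where
  "drop_lead p = p - monom (lead_coeff p) (degree p)"

definition pseudo_rem :: "'c::comm_ring_1 poly \<Rightarrow> 'c poly \<Rightarrow> 'c poly" where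
  "pseudo_rem p q = snd (pseudo_divmod p q)"

lemma coeff_formal_deriv: "coeff (formal_deriv p) n = of_nat (Suc n) * coeff p (Suc n)"
  unfolding formal_deriv_def coeff_sum
  by (cases "n < degree p") (auto simp: coeff_eq_0 simp del: of_nat_Suc)

lemma degree_formal_deriv: "formal_deriv p = 0 \<or> degree (formal_deriv p) < degree p"
proof (cases "degree p")
  case 0
  then show ?thesis by (simp add: formal_deriv_def)
next
  case (Suc n)
  then have "degree (formal_deriv p) \<le> n"
    by (intro degree_le) (auto simp: coeff_formal_deriv coeff_eq_0)
  with Suc show ?thesis by simp
qed

lemma map_poly_formal_deriv:
  fixes h :: "'c::comm_ring_1 \<Rightarrow> 'd::idom"
  assumes "unital_hom h"
  shows "map_poly h (formal_deriv p) = pderiv (map_poly h p)"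
  by (intro poly_eqI)
    (simp add: coeff_map_poly_hom assms coeff_formal_deriv coeff_pderiv unital_hom_simps[OF assms] del: of_nat_Suc)

lemma degree_drop_lead: "drop_lead p = 0 \<or> degree (drop_lead p) < degree p"
proof (cases "degree p")
  case 0
  then obtain c where "p = [:c:]"
    by (metis degree_eq_zeroE)
  then show ?thesis by (simp add: drop_lead_def monom_0)
next
  case (Suc n)
  then have "degree (drop_lead p) \<le> n"
    by (intro degree_le) (auto simp: drop_lead_def coeff_eq_0)
  with Suc show ?thesis by simp
qed

lemma map_poly_drop_lead:
  assumes "unital_hom h" "h (lead_coeff p) = 0"
  shows "map_poly h (drop_lead p) = map_poly h p"
proof (rule poly_eqI)
  fix n
  show "coeff (map_poly h (drop_lead p)) n = coeff (map_poly h p) n"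
    unfolding coeff_map_poly_hom[OF assms(1)] drop_lead_def
    using assms by (cases "n = degree p") (simp_all add: unital_hom_simps(1))
qed

lemma pseudo_rem:
  assumes "q \<noteq> 0"
  shows "pseudo_rem p q = 0 \<or> degree (pseudo_rem p q) < degree q"
    and "\<exists>k w. smult (lead_coeff q ^ k) p = q * w + pseudo_rem p q"
  using pseudo_divmod[OF assms, of p "fst (pseudo_divmod p q)" "pseudo_rem p q"]
  by (auto simp: pseudo_rem_def)

text \<open>The operations of Cohen--Hoermander, demanded only from degree \<open>k\<close> on. They
  lower the degree, so closure is reached by letting \<open>k\<close> descend to 0; \<open>0\<close>
  is kept in the set because derivatives, truncations and remainders may vanish.\<close>

definition elimination_closed :: "nat \<Rightarrow> 'c::comm_ring_1 poly set \<Rightarrow> bool" where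
  "elimination_closed k S \<longleftrightarrow> finite S \<and> 0 \<in> S \<and>
    (\<forall>s\<in>S. k \<le> degree s \<longrightarrow> formal_deriv s \<in> S \<and> drop_lead s \<in> S) \<and>
    (\<forall>s\<in>S. \<forall>t\<in>S. k \<le> degree t \<and> 0 < degree t \<and> degree t \<le> degree s \<longrightarrow> pseudo_rem s t \<in> S)"

text \<open>One round at degree exactly \<open>k\<close> is enough: everything it produces is 0 or
  of degree below \<open>k\<close>, so no new operation at degree \<open>k\<close> or above
  arises.\<close>

lemma elimination_closed_Suc:
  assumes "elimination_closed (Suc k) S"
  shows "\<exists>S'. S \<subseteq> S' \<and> elimination_closed k S'"
proof -
  define N where "N = {formal_deriv s | s. s \<in> S \<and> degree s = k} \<union> {drop_lead s | s. s \<in> S \<and> degree s = k} \<union>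
    {pseudo_rem s t | s t. s \<in> S \<and> t \<in> S \<and> degree t = k \<and> 0 < degree t \<and> degree t \<le> degree s}"
  have S: "finite S" "0 \<in> S"
    using assms unfolding elimination_closed_def by blast+
  have "N \<subseteq> formal_deriv ` S \<union> drop_lead ` S \<union> (\<lambda>(s, t). pseudo_rem s t) ` (S \<times> S)"
    unfolding N_def by force
  then have fin: "finite N"
    by (rule finite_subset) (use S in simp)
  have small: "r = 0 \<or> degree r < k" if "r \<in> N" for r
  proof -
    from that consider s where "degree s = k" "r = formal_deriv s \<or> r = drop_lead s"
      | s t where "degree t = k" "0 < degree t" "r = pseudo_rem s t"
      unfolding N_def by blast
    then show ?thesis
    proof cases
      case 1
      then show ?thesis using degree_formal_deriv[of s] degree_drop_lead[of s] by auto
    next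
      case 2
      then have "t \<noteq> 0" by auto
      with 2 show ?thesis using pseudo_rem(1)[of t s] by auto
    qed
  qed
  \<comment> \<open>A new polynomial of degree at least \<open>k\<close> can only be 0, with
    \<open>k = 0\<close>, and is then already in \<open>S\<close>.\<close>
  have old: "s \<in> S" if "s \<in> S \<union> N" "k \<le> degree s" for s
    using that small[of s] S by auto
  have "elimination_closed k (S \<union> N)"
    unfolding elimination_closed_def
  proof (intro conjI ballI impI)
    fix s assume s: "s \<in> S \<union> N" "k \<le> degree s"
    then have "s \<in> S" by (rule old)
    have "formal_deriv s \<in> S \<union> N \<and> drop_lead s \<in> S \<union> N"
    proof (cases "degree s = k")
      case True
      with \<open>s \<in> S\<close> show ?thesis unfolding N_def by blast
    next
      case False
      with s(2) have "Suc k \<le> degree s" by simp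
      with assms \<open>s \<in> S\<close> show ?thesis unfolding elimination_closed_def by blast
    qed
    then show "formal_deriv s \<in> S \<union> N" "drop_lead s \<in> S \<union> N"
      by blast+
  next
    fix s t assume st: "s \<in> S \<union> N" "t \<in> S \<union> N" "k \<le> degree t \<and> 0 < degree t \<and> degree t \<le> degree s"
    then have "s \<in> S" "t \<in> S"
      using old[OF st(1)] old[OF st(2)] by (simp_all add: order_trans[of k "degree t"])
    show "pseudo_rem s t \<in> S \<union> N"
    proof (cases "degree t = k")
      case True
      with \<open>s \<in> S\<close> \<open>t \<in> S\<close> st(3) show ?thesis
        unfolding N_def by blast
    next
      case False
      with st(3) have "Suc k \<le> degree t" by simp
      with assms \<open>s \<in> S\<close> \<open>t \<in> S\<close> st(3) show ?thesis unfolding elimination_closed_def by blast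
    qed
  qed (use S fin in simp_all)
  then show ?thesis by blast
qed

lemma elimination_closure:
  fixes S :: "'c::comm_ring_1 poly set"
  assumes "finite S"
  shows "\<exists>S'. S \<subseteq> S' \<and> elimination_closed 0 S'"
proof -
  have descend: "\<exists>S'. S \<subseteq> S' \<and> elimination_closed 0 S'" if "elimination_closed k S"
    for k and S :: "'c poly set"
    using that
  proof (induction k arbitrary: S)
    case (Suc k)
    obtain S1 where S1: "S \<subseteq> S1" "elimination_closed k S1"
      using elimination_closed_Suc[OF Suc.prems] by blast
    from Suc.IH[OF S1(2)] S1(1) show ?case by blast
  qed blast
  define m where "m = Max (degree ` insert 0 S)"
  have le: "degree s \<le> m" if "s \<in> insert 0 S" for s
    unfolding m_def using assms that by (intro Max_ge) auto
  then have no: "\<not> Suc m \<le> degree s" if "s \<in> insert 0 S" for s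
    using that by (simp add: not_less_eq_eq)
  \<comment> \<open>Above all occurring degrees the closure conditions are vacuous.\<close>
  have "elimination_closed (Suc m) (insert 0 S)"
    unfolding elimination_closed_def using assms no by blast
  then show ?thesis
    using descend[of "Suc m" "insert 0 S"] by blast
qed

section \<open>One matching for all polynomials of an elimination-closed set\<close>

context
  fixes \<phi> :: "'c::comm_ring_1 \<Rightarrow> 'a::real_closed_field" and \<psi> :: "'c \<Rightarrow> 'b::real_closed_field"
    and S :: "'c poly set"
  assumes hom: "unital_hom \<phi>" "unital_hom \<psi>" and S: "elimination_closed 0 S"
    and signs: "\<And>s. s \<in> S \<Longrightarrow> same_sign (\<phi> (lead_coeff s)) (\<psi> (lead_coeff s))"
begin

text \<open>
  Every point of a matching is a root of a treated polynomial \<open>t\<close>. This determines the sign there of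
  a new polynomial \<open>s\<close>: it is that of the remainder of \<open>s\<close> by \<open>t\<close>, which has been treated before.
\<close>

definition simultaneous_matching :: "'c poly set \<Rightarrow> ('a \<times> 'b) set \<Rightarrow> bool" where
  "simultaneous_matching U M \<longleftrightarrow> cut_matching M \<and>
    (\<forall>s\<in>U. matches M (map_poly \<phi> s) (map_poly \<psi> s)) \<and>
    (\<forall>(u, v)\<in>M. \<exists>t\<in>U. \<phi> (lead_coeff t) \<noteq> 0 \<and> 0 < degree t \<and>
      poly (map_poly \<phi> t) u = 0 \<and> poly (map_poly \<psi> t) v = 0)"

lemma simultaneous_matching_values:
  assumes M: "simultaneous_matching U M" and U: "U \<subseteq> S" and s: "s \<in> S"
    and below: "\<And>t. t \<in> S \<Longrightarrow> degree t < degree s \<Longrightarrow> t \<in> U"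
    and above: "\<And>t. t \<in> U \<Longrightarrow> degree t \<le> degree s"
    and uv: "(u, v) \<in> M"
  shows "same_sign (poly (map_poly \<phi> s) u) (poly (map_poly \<psi> s) v)"
proof -
  obtain t where t: "t \<in> U" "\<phi> (lead_coeff t) \<noteq> 0" "0 < degree t"
      "poly (map_poly \<phi> t) u = 0" "poly (map_poly \<psi> t) v = 0"
    using M uv unfolding simultaneous_matching_def by blast
  then have "t \<noteq> 0" by auto
  obtain k w where kw: "smult (lead_coeff t ^ k) s = t * w + pseudo_rem s t"
    using pseudo_rem(2)[OF \<open>t \<noteq> 0\<close>] by blast
  have "pseudo_rem s t \<in> S"
    using S s t U above[OF t(1)] unfolding elimination_closed_def by blast
  moreover have "degree (pseudo_rem s t) < degree s"
    using pseudo_rem(1)[OF \<open>t \<noteq> 0\<close>, of s] above[OF t(1)] t(3) by auto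
  ultimately have "pseudo_rem s t \<in> U"
    using below by blast
  then have r: "same_sign (poly (map_poly \<phi> (pseudo_rem s t)) u) (poly (map_poly \<psi> (pseudo_rem s t)) v)"
    using M uv unfolding simultaneous_matching_def matches_def by blast
  note simps = unital_hom_simps[OF unital_hom_map_poly[OF hom(1)]] unital_hom_simps[OF unital_hom_map_poly[OF hom(2)]]
    unital_hom_simps[OF hom(1)] unital_hom_simps[OF hom(2)] map_poly_hom_smult[OF hom(1)] map_poly_hom_smult[OF hom(2)]
  have "\<phi> (lead_coeff t) ^ k * poly (map_poly \<phi> s) u = poly (map_poly \<phi> (pseudo_rem s t)) u"
    using arg_cong[OF kw, of "\<lambda>p. poly (map_poly \<phi> p) u"] t by (simp add: simps)
  moreover have "\<psi> (lead_coeff t) ^ k * poly (map_poly \<psi> s) v = poly (map_poly \<psi> (pseudo_rem s t)) v"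
    using arg_cong[OF kw, of "\<lambda>p. poly (map_poly \<psi> p) v"] t by (simp add: simps)
  \<comment> \<open>The multiplier produced by pseudo-division may be negative, but it has the same
    sign in both fields and is nonzero, so it cancels.\<close>
  moreover have "same_sign (\<phi> (lead_coeff t) ^ k) (\<psi> (lead_coeff t) ^ k)"
    using signs[of t] t(1) U by (induction k) (auto simp: same_sign_mult, simp add: same_sign_def)
  ultimately show ?thesis
    using r t(2) by (metis power_not_zero same_sign_mult_cancel)
qed

text \<open>The derivative, the truncation and the needed remainders of \<open>s\<close> have
  smaller degree and are treated already. If the leading coefficient vanishes under one
  homomorphism, it does so under both and \<open>drop_lead s\<close> decides; otherwise only the
  roots of \<open>s\<close> itself have to be added.\<close>

lemma simultaneous_matching_insert:
  assumes M: "simultaneous_matching U M" and U: "U \<subseteq> S" and s: "s \<in> S"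
    and below: "\<And>t. t \<in> S \<Longrightarrow> degree t < degree s \<Longrightarrow> t \<in> U"
    and above: "\<And>t. t \<in> U \<Longrightarrow> degree t \<le> degree s"
  shows "\<exists>M'. simultaneous_matching (insert s U) M'"
proof -
  let ?p = "map_poly \<phi> s" and ?q = "map_poly \<psi> s"
  have keep: "simultaneous_matching (insert s U) M" if "matches M ?p ?q"
    using that M unfolding simultaneous_matching_def by blast
  have const: "matches M [:a:] [:b:]" if "same_sign a b" for a :: 'a and b :: 'b
    using that by (simp add: matches_def)
  have lc: "same_sign (\<phi> (lead_coeff s)) (\<psi> (lead_coeff s))"
    using signs s by blast
  consider (const) "degree s = 0" | (drop) "0 < degree s" "\<phi> (lead_coeff s) = 0"
    | (add) "0 < degree s" "\<phi> (lead_coeff s) \<noteq> 0"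
    by auto
  then show ?thesis
  proof cases
    case const
    then obtain c where "s = [:c:]"
      by (metis degree_eq_zeroE)
    with lc have "matches M ?p ?q"
      using \<open>\<And>b a. same_sign a b \<Longrightarrow> matches M [:a:] [:b:]\<close> hom by (simp add: map_poly_pCons unital_hom_simps)
    then show ?thesis
      using keep by blast
  next
    case drop
    then have 0: "\<psi> (lead_coeff s) = 0"
      using same_sign_zero_iff[OF lc] by simp
    have "drop_lead s \<in> S"
      using S s by (auto simp: elimination_closed_def)
    moreover have "degree (drop_lead s) < degree s"
      using degree_drop_lead[of s] drop(1) by auto
    ultimately have "drop_lead s \<in> U"
      using below by blast
    with M have "matches M (map_poly \<phi> (drop_lead s)) (map_poly \<psi> (drop_lead s))"
      unfolding simultaneous_matching_def by blast
    then show ?thesis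
      using keep unfolding map_poly_drop_lead[OF hom(1) drop(2)] map_poly_drop_lead[OF hom(2) 0] by blast
  next
    case add
    then have nz: "\<psi> (lead_coeff s) \<noteq> 0"
      using same_sign_zero_iff[OF lc] by simp
    have deg: "degree ?p = degree s" "degree ?q = degree s"
      using add(2) nz by (auto intro!: map_poly_degree_eq)
    have lc': "lead_coeff ?p = \<phi> (lead_coeff s)" "lead_coeff ?q = \<psi> (lead_coeff s)"
      by (simp_all add: deg coeff_map_poly_hom hom)
    have "formal_deriv s \<in> S"
      using S s by (auto simp: elimination_closed_def)
    moreover have "degree (formal_deriv s) < degree s"
      using degree_formal_deriv[of s] add(1) by auto
    ultimately have "formal_deriv s \<in> U"
      using below by blast
    with M have "matches M (map_poly \<phi> (formal_deriv s)) (map_poly \<psi> (formal_deriv s))"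
      unfolding simultaneous_matching_def by blast
    then have deriv: "matches M (pderiv ?p) (pderiv ?q)"
      unfolding map_poly_formal_deriv[OF hom(1)] map_poly_formal_deriv[OF hom(2)] .
    have M': "cut_matching M"
      using M by (simp add: simultaneous_matching_def)
    have deg': "degree ?p = degree ?q" "0 < degree ?p"
      using deg add(1) by auto
    have "simultaneous_matching (insert s U) (extend_matching M ?p ?q)"
      unfolding simultaneous_matching_def
    proof (intro conjI ballI)
      show "cut_matching (extend_matching M ?p ?q)"
        using cut_matching_extend[OF M' deg' deriv] .
    next
      fix t assume "t \<in> insert s U"
      then show "matches (extend_matching M ?p ?q) (map_poly \<phi> t) (map_poly \<psi> t)"
      proof
        assume "t = s"
        have "matches (extend_matching M ?p ?q) ?p ?q"
          by (rule matches_extend[OF M' deg' deriv])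
            (use lc simultaneous_matching_values[OF M U s below above] in \<open>auto simp only: lc'\<close>)
        with \<open>t = s\<close> show ?thesis by simp
      next
        assume "t \<in> U"
        then show ?thesis
          using M matches_mono unfolding simultaneous_matching_def by blast
      qed
    next
      fix x assume x: "x \<in> extend_matching M ?p ?q"
      show "case x of (u, v) \<Rightarrow> \<exists>t\<in>insert s U. \<phi> (lead_coeff t) \<noteq> 0 \<and> 0 < degree t \<and>
          poly (map_poly \<phi> t) u = 0 \<and> poly (map_poly \<psi> t) v = 0"
      proof (cases "x \<in> M")
        case True
        then show ?thesis
          using M unfolding simultaneous_matching_def by blast
      next
        case False
        then show ?thesis
          using x add by (auto simp: extend_matching_def)
      qed
    qed
    then show ?thesis by blast
  qed
qed

lemma simultaneous_matching_exists: "\<exists>M. simultaneous_matching S M"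
proof -
  have fin: "finite S"
    using S by (simp add: elimination_closed_def)
  have "\<exists>M. simultaneous_matching {s\<in>S. degree s < k} M" for k
  proof (induction k)
    case 0
    then show ?case
      by (intro exI[of _ "{}"]) (simp add: simultaneous_matching_def cut_matching_def)
  next
    case (Suc k)
    \<comment> \<open>Polynomials of equal degree can be inserted in any order, since each refers
      only to smaller degrees.\<close>
    have "\<exists>M. simultaneous_matching ({s\<in>S. degree s < k} \<union> B) M" if "finite B" "B \<subseteq> {s\<in>S. degree s = k}" for B
      using that
    proof (induction B rule: finite_induct)
      case empty
      then show ?case using Suc by simp
    next
      case (insert s B)
      then obtain M where M: "simultaneous_matching ({s\<in>S. degree s < k} \<union> B) M"
        by auto
      have "\<exists>M. simultaneous_matching (insert s ({s\<in>S. degree s < k} \<union> B)) M"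
        by (rule simultaneous_matching_insert[OF M]) (use insert.prems in auto)
      then show ?case by simp
    qed
    from this[of "{s\<in>S. degree s = k}"] have "\<exists>M. simultaneous_matching ({s\<in>S. degree s < k} \<union> {s\<in>S. degree s = k}) M"
      using fin by simp
    moreover have "{s\<in>S. degree s < k} \<union> {s\<in>S. degree s = k} = {s\<in>S. degree s < Suc k}"
      by auto
    ultimately show ?case by simp
  qed
  from this[of "Suc (Max (degree ` S))"] show ?thesis
    using fin by (simp add: less_Suc_eq_le cong: conj_cong)
qed

lemma same_signs_realised:
  "\<exists>y. \<forall>s\<in>S. same_sign (poly (map_poly \<phi> s) x) (poly (map_poly \<psi> s) y)"
proof -
  obtain M where M: "simultaneous_matching S M"
    using simultaneous_matching_exists by blast
  then have "\<exists>y. (x, y) \<in> M \<or> same_cut M x y"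
    using same_cut_exists[of M x] by (auto simp: simultaneous_matching_def)
  with M show ?thesis
    unfolding simultaneous_matching_def matches_def by blast
qed

end

text \<open>The tests \<open>T\<close> are the leading coefficients of the elimination closure. They
  lie in the coefficient ring and are fixed before the homomorphisms, which is what makes the
  elimination repeatable when that ring is itself a polynomial ring.\<close>

theorem sign_elimination:
  fixes S :: "'c::comm_ring_1 poly set"
  assumes "finite S"
  shows "\<exists>T::'c set. finite T \<and>
    (\<forall>(\<phi> :: 'c \<Rightarrow> 'a::real_closed_field) (\<psi> :: 'c \<Rightarrow> 'b::real_closed_field) x.
      unital_hom \<phi> \<longrightarrow> unital_hom \<psi> \<longrightarrow> (\<forall>t\<in>T. same_sign (\<phi> t) (\<psi> t)) \<longrightarrow>
      (\<exists>y. \<forall>s\<in>S. same_sign (poly (map_poly \<phi> s) x) (poly (map_poly \<psi> s) y)))"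
proof -
  obtain S' where S': "S \<subseteq> S'" "elimination_closed 0 S'"
    using elimination_closure[OF assms] by blast
  show ?thesis
  proof (intro exI[of _ "lead_coeff ` S'"] conjI allI impI)
    show "finite (lead_coeff ` S')"
      using S' by (simp add: elimination_closed_def)
  next
    fix \<phi> :: "'c \<Rightarrow> 'a" and \<psi> :: "'c \<Rightarrow> 'b" and x
    assume "unital_hom \<phi>" "unital_hom \<psi>" "\<forall>t\<in>lead_coeff ` S'. same_sign (\<phi> t) (\<psi> t)"
    with same_signs_realised[OF _ _ S'(2), of \<phi> \<psi> x] S'(1)
    show "\<exists>y. \<forall>s\<in>S. same_sign (poly (map_poly \<phi> s) x) (poly (map_poly \<psi> s) y)"
      by blast
  qed
qed

section \<open>Transfer from a real closed field to the reals\<close>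

text \<open>Evaluation with an arbitrary target ring: the same operation substitutes points of a
  real closed field and polynomials in other variables.\<close>

definition insertion :: "(real \<Rightarrow> 'a::comm_ring_1) \<Rightarrow> ('n::finite \<Rightarrow> 'a) \<Rightarrow> 'n rpoly \<Rightarrow> 'a" where
  "insertion \<iota> a f = (\<Sum>m\<in>Poly_Mapping.keys f. \<iota> (Poly_Mapping.lookup f m) * (\<Prod>i\<in>UNIV. a i ^ Poly_Mapping.lookup m i))"

definition var_poly :: "'n \<Rightarrow> 'n rpoly" where
  "var_poly i = Poly_Mapping.single (Poly_Mapping.single i 1) 1"

lemma rpoly_as_sum: "f = (\<Sum>m\<in>Poly_Mapping.keys f. Poly_Mapping.single m (Poly_Mapping.lookup f m))"
proof (rule poly_mapping_eqI)
  fix k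
  have "(\<Sum>m\<in>Poly_Mapping.keys f. Poly_Mapping.lookup (Poly_Mapping.single m (Poly_Mapping.lookup f m)) k)
      = (\<Sum>m\<in>Poly_Mapping.keys f. if m = k then Poly_Mapping.lookup f k else 0)"
    by (rule sum.cong) (auto simp: lookup_single)
  then show "Poly_Mapping.lookup f k = Poly_Mapping.lookup (\<Sum>m\<in>Poly_Mapping.keys f. Poly_Mapping.single m (Poly_Mapping.lookup f m)) k"
    by (simp add: lookup_sum in_keys_iff)
qed

context
  fixes \<iota> :: "real \<Rightarrow> 'a::comm_ring_1" and a :: "'n::finite \<Rightarrow> 'a"
  assumes \<iota>: "unital_hom \<iota>"
begin

lemma insertion_superset:
  assumes "finite A" "Poly_Mapping.keys f \<subseteq> A"
  shows "insertion \<iota> a f = (\<Sum>m\<in>A. \<iota> (Poly_Mapping.lookup f m) * (\<Prod>i\<in>UNIV. a i ^ Poly_Mapping.lookup m i))"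
  unfolding insertion_def
  by (rule sum.mono_neutral_left) (use assms in \<open>auto simp: in_keys_iff unital_hom_simps(1)[OF \<iota>]\<close>)

lemma insertion_zero: "insertion \<iota> a 0 = 0"
  by (simp add: insertion_def)

lemma insertion_add: "insertion \<iota> a (f + g) = insertion \<iota> a f + insertion \<iota> a g"
proof -
  let ?A = "Poly_Mapping.keys f \<union> Poly_Mapping.keys g"
  have "finite ?A" "Poly_Mapping.keys f \<subseteq> ?A" "Poly_Mapping.keys g \<subseteq> ?A" "Poly_Mapping.keys (f + g) \<subseteq> ?A"
    using Poly_Mapping.keys_add[of f g] by auto
  then show ?thesis
    by (simp add: insertion_superset[of ?A] lookup_add unital_hom_simps(3)[OF \<iota>] distrib_right sum.distrib)
qed

lemma insertion_sum: "insertion \<iota> a (\<Sum>x\<in>A. f x) = (\<Sum>x\<in>A. insertion \<iota> a (f x))"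
  by (induction A rule: infinite_finite_induct) (auto simp: insertion_add insertion_zero)

lemma insertion_single:
  "insertion \<iota> a (Poly_Mapping.single m c) = \<iota> c * (\<Prod>i\<in>UNIV. a i ^ Poly_Mapping.lookup m i)"
  by (cases "c = 0") (auto simp: insertion_def unital_hom_simps(1)[OF \<iota>])

lemma insertion_mult: "insertion \<iota> a (f * g) = insertion \<iota> a f * insertion \<iota> a g"
proof -
  have "f * g = (\<Sum>m\<in>Poly_Mapping.keys f. \<Sum>n\<in>Poly_Mapping.keys g.
      Poly_Mapping.single (m + n) (Poly_Mapping.lookup f m * Poly_Mapping.lookup g n))"
    by (subst (1) rpoly_as_sum[of f], subst (1) rpoly_as_sum[of g]) (simp add: sum_product mult_single)
  then have "insertion \<iota> a (f * g) = (\<Sum>m\<in>Poly_Mapping.keys f. \<Sum>n\<in>Poly_Mapping.keys g.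
      (\<iota> (Poly_Mapping.lookup f m) * (\<Prod>i\<in>UNIV. a i ^ Poly_Mapping.lookup m i)) *
      (\<iota> (Poly_Mapping.lookup g n) * (\<Prod>i\<in>UNIV. a i ^ Poly_Mapping.lookup n i)))"
    by (simp add: insertion_sum insertion_single unital_hom_simps(4)[OF \<iota>] lookup_add power_add prod.distrib ac_simps)
  then show ?thesis
    by (simp add: insertion_def sum_product)
qed

lemma insertion_const: "insertion \<iota> a (const_poly c) = \<iota> c"
  by (simp add: const_poly_def insertion_single)

lemma unital_hom_insertion: "unital_hom (insertion \<iota> a)"
  using insertion_const[of 1]
  by (simp add: unital_hom_def insertion_add insertion_mult const_poly_def unital_hom_simps(2)[OF \<iota>])

lemma insertion_var: "insertion \<iota> a (var_poly i) = a i"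
proof -
  have "(\<Prod>j\<in>UNIV. a j ^ Poly_Mapping.lookup (Poly_Mapping.single i 1) j) = (\<Prod>j\<in>UNIV. if j = i then a i else 1)"
    by (rule prod.cong) (auto simp: lookup_single)
  then show ?thesis
    by (simp add: var_poly_def insertion_single unital_hom_simps(2)[OF \<iota>])
qed

end

lemma hom_insertion:
  assumes "unital_hom h"
  shows "h (insertion \<iota> a f) = insertion (\<lambda>c. h (\<iota> c)) (\<lambda>i. h (a i)) f"
  by (simp add: insertion_def unital_hom_simps[OF assms])

lemma unital_hom_const_poly: "unital_hom const_poly"
  by (simp add: unital_hom_def const_poly_def single_add mult_single)

lemma unital_hom_comp: "unital_hom g \<Longrightarrow> unital_hom h \<Longrightarrow> unital_hom (\<lambda>x. g (h x))"
  by (simp add: unital_hom_def)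

lemma single_as_prod: "Poly_Mapping.single m 1 = (\<Prod>i\<in>UNIV. var_poly i ^ Poly_Mapping.lookup m i)"
  for m :: "'n::finite \<Rightarrow>\<^sub>0 nat"
proof -
  have pow: "var_poly i ^ k = Poly_Mapping.single (Poly_Mapping.single i k) 1" for i :: 'n and k
    by (induction k) (auto simp: var_poly_def mult_single single_add[symmetric] add.commute)
  have prod: "(\<Prod>i\<in>A. Poly_Mapping.single (g i) (1::real)) = Poly_Mapping.single (\<Sum>i\<in>A. g i) 1"
    if "finite A" for A :: "'n set" and g :: "'n \<Rightarrow> 'n \<Rightarrow>\<^sub>0 nat"
    using that by (induction A rule: finite_induct) (auto simp: mult_single)
  have "m = (\<Sum>i\<in>UNIV. Poly_Mapping.single i (Poly_Mapping.lookup m i))"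
    by (rule poly_mapping_eqI) (simp add: lookup_sum lookup_single when_def)
  then show ?thesis
    by (simp add: pow prod)
qed

lemma insertion_id: "insertion const_poly var_poly f = f"
proof -
  have "insertion const_poly var_poly f = (\<Sum>m\<in>Poly_Mapping.keys f. Poly_Mapping.single m (Poly_Mapping.lookup f m))"
    unfolding insertion_def
    by (rule sum.cong) (auto simp: single_as_prod[symmetric] const_poly_def mult_single)
  then show ?thesis
    using rpoly_as_sum[of f] by simp
qed

text \<open>The universal property of the polynomial ring: constants and variables generate
  it.\<close>

lemma hom_eq_insertion:
  assumes "unital_hom h"
  shows "h f = insertion (\<lambda>c. h (const_poly c)) (\<lambda>i. h (var_poly i)) f"
  using hom_insertion[OF assms, of const_poly var_poly f] by (simp add: insertion_id)

lemma unital_hom_ident: "unital_hom (\<lambda>x. x)"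
  by (simp add: unital_hom_def)

lemma poly_eval_insertion: "poly_eval f x = insertion (\<lambda>c. c) (\<lambda>i. x $ i) f"
  by (simp add: poly_eval_def insertion_def monom_eval_def)

lemma unital_hom_poly_eval: "unital_hom (\<lambda>f. poly_eval f x)"
  unfolding poly_eval_insertion by (rule unital_hom_insertion[OF unital_hom_ident])

text \<open>The coefficients stay in the full ring \<open>'n rpoly\<close>, though variable
  \<open>i\<close> no longer occurs in them, so eliminating a variable does not change the
  ring.\<close>

definition in_variable :: "'n::finite \<Rightarrow> 'n rpoly \<Rightarrow> 'n rpoly poly" where
  "in_variable i = insertion (\<lambda>c. [:const_poly c:]) (\<lambda>j. if j = i then [:0, 1:] else [:var_poly j:])"

lemma poly_in_variable:
  fixes a :: "'n::finite \<Rightarrow> 'a::idom"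
  assumes \<iota>: "unital_hom \<iota>"
  shows "poly (map_poly (insertion \<iota> a) (in_variable i f)) y = insertion \<iota> (a(i := y)) f"
proof -
  note hom = unital_hom_insertion[OF \<iota>, of a]
  have "unital_hom (\<lambda>p. poly (map_poly (insertion \<iota> a) p) y)"
    using unital_hom_simps[OF unital_hom_map_poly[OF hom]] by (simp add: unital_hom_def)
  then have "poly (map_poly (insertion \<iota> a) (in_variable i f)) y =
      insertion (\<lambda>c. poly (map_poly (insertion \<iota> a) [:const_poly c:]) y)
        (\<lambda>j. poly (map_poly (insertion \<iota> a) (if j = i then [:0, 1:] else [:var_poly j:])) y) f"
    unfolding in_variable_def by (rule hom_insertion)
  also have "(\<lambda>c. poly (map_poly (insertion \<iota> a) [:const_poly c:]) y) = \<iota>"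
    by (auto simp: map_poly_pCons unital_hom_simps[OF hom] insertion_const[OF \<iota>])
  also have "(\<lambda>j. poly (map_poly (insertion \<iota> a) (if j = i then [:0, 1:] else [:var_poly j:])) y) = a(i := y)"
    by (auto simp: map_poly_pCons unital_hom_simps[OF hom] insertion_var[OF \<iota>])
  finally show ?thesis .
qed

text \<open>To move from \<open>a\<close> to \<open>a'\<close>, all coordinates in \<open>V\<close>
  other than \<open>i\<close> are moved by the induction hypothesis, which preserves the tests for
  variable \<open>i\<close>; then coordinate \<open>i\<close> is moved by one-variable elimination.
  The coordinates of \<open>b'\<close> are whatever the elimination yields.\<close>

lemma sign_elimination_variables:
  fixes S :: "'n::finite rpoly set"
  assumes "finite V" "finite S"
  shows "\<exists>T. finite T \<and>
    (\<forall>(\<iota> :: real \<Rightarrow> 'a::real_closed_field) (\<kappa> :: real \<Rightarrow> 'b::real_closed_field) a b a'.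
      unital_hom \<iota> \<longrightarrow> unital_hom \<kappa> \<longrightarrow>
      (\<forall>t\<in>T. same_sign (insertion \<iota> a t) (insertion \<kappa> b t)) \<longrightarrow> (\<forall>i. i \<notin> V \<longrightarrow> a' i = a i) \<longrightarrow>
      (\<exists>b'. \<forall>s\<in>S. same_sign (insertion \<iota> a' s) (insertion \<kappa> b' s)))"
  using assms
proof (induction V arbitrary: S rule: finite_induct)
  case empty
  have "a' = a" if "\<forall>i. i \<notin> {} \<longrightarrow> a' i = a i" for a a' :: "'n \<Rightarrow> 'a"
    using that by auto
  with empty show ?case
    by (intro exI[of _ S]) blast
next
  case (insert i V)
  obtain T1 where T1: "finite T1"
    "\<And>(\<phi> :: 'n rpoly \<Rightarrow> 'a) (\<psi> :: 'n rpoly \<Rightarrow> 'b) x. unital_hom \<phi> \<Longrightarrow> unital_hom \<psi> \<Longrightarrow>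
       \<forall>t\<in>T1. same_sign (\<phi> t) (\<psi> t) \<Longrightarrow>
       \<exists>y. \<forall>s\<in>in_variable i ` S. same_sign (poly (map_poly \<phi> s) x) (poly (map_poly \<psi> s) y)"
    using sign_elimination[of "in_variable i ` S", where 'a='a and 'b='b] insert.prems by blast
  obtain T where T: "finite T"
    "\<And>(\<iota> :: real \<Rightarrow> 'a) (\<kappa> :: real \<Rightarrow> 'b) a b a'. unital_hom \<iota> \<Longrightarrow> unital_hom \<kappa> \<Longrightarrow>
      \<forall>t\<in>T. same_sign (insertion \<iota> a t) (insertion \<kappa> b t) \<Longrightarrow> \<forall>i. i \<notin> V \<longrightarrow> a' i = a i \<Longrightarrow>
      \<exists>b'. \<forall>s\<in>T1. same_sign (insertion \<iota> a' s) (insertion \<kappa> b' s)"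
    using insert.IH[OF T1(1)] by blast
  show ?case
  proof (intro exI[of _ T] conjI allI impI T(1))
    fix \<iota> :: "real \<Rightarrow> 'a" and \<kappa> :: "real \<Rightarrow> 'b" and a b a'
    assume hom: "unital_hom \<iota>" "unital_hom \<kappa>"
      and signs: "\<forall>t\<in>T. same_sign (insertion \<iota> a t) (insertion \<kappa> b t)"
      and off: "\<forall>j. j \<notin> insert i V \<longrightarrow> a' j = a j"
    then have "\<forall>j. j \<notin> V \<longrightarrow> (a'(i := a i)) j = a j"
      by auto
    then obtain b' where b': "\<forall>s\<in>T1. same_sign (insertion \<iota> (a'(i := a i)) s) (insertion \<kappa> b' s)"
      using T(2)[OF hom signs] by blast
    obtain y where y: "\<forall>s\<in>in_variable i ` S. same_sign
        (poly (map_poly (insertion \<iota> (a'(i := a i))) s) (a' i)) (poly (map_poly (insertion \<kappa> b') s) y)"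
      using T1(2)[OF unital_hom_insertion[OF hom(1)] unital_hom_insertion[OF hom(2)] b'] by blast
    have "\<forall>s\<in>S. same_sign (insertion \<iota> a' s) (insertion \<kappa> (b'(i := y)) s)"
      using y by (simp add: poly_in_variable hom)
    then show "\<exists>b'. \<forall>s\<in>S. same_sign (insertion \<iota> a' s) (insertion \<kappa> b' s)"
      by (intro exI[of _ "b'(i := y)"])
  qed
qed

text \<open>Nonnegative reals are squares, so their images are nonnegative; a unital homomorphism
  out of a field is injective.\<close>

lemma same_sign_real_hom:
  fixes \<iota> :: "real \<Rightarrow> 'a::linordered_field"
  assumes "unital_hom \<iota>"
  shows "same_sign (\<iota> c) c"
proof -
  have nonneg: "0 \<le> \<iota> c" if "0 \<le> c" for c
    using unital_hom_simps(7)[OF assms, of "sqrt c" 2] that by simp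
  have inj: "c = 0" if "\<iota> c = 0" for c
  proof (rule ccontr)
    assume "c \<noteq> 0"
    then have "\<iota> c * \<iota> (inverse c) = 1"
      using unital_hom_simps(4)[OF assms, of c "inverse c"] unital_hom_simps(2)[OF assms] by simp
    with that show False by simp
  qed
  have pos: "0 < \<iota> c" if "0 < c" for c
    using nonneg[of c] inj[of c] that by (auto simp: order_less_le)
  have "\<iota> c < 0" if "c < 0"
    using pos[of "- c"] that unital_hom_simps(5)[OF assms] by simp
  with pos show ?thesis
    unfolding same_sign_def using unital_hom_simps(1)[OF assms] nonneg
    by (metis linorder_neqE not_less less_asym)
qed

theorem sign_transfer_to_reals:
  fixes S :: "'n::finite rpoly set" and \<Psi> :: "'n rpoly \<Rightarrow> 'a::real_closed_field"
  assumes "finite S" "unital_hom \<Psi>"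
  shows "\<exists>x. \<forall>s\<in>S. same_sign (\<Psi> s) (poly_eval s x)"
proof -
  define \<iota> where "\<iota> c = \<Psi> (const_poly c)" for c
  have \<iota>: "unital_hom \<iota>"
    unfolding \<iota>_def by (rule unital_hom_comp[OF assms(2) unital_hom_const_poly])
  obtain T :: "'n rpoly set" where T: "\<And>(\<iota> :: real \<Rightarrow> 'a) (\<kappa> :: real \<Rightarrow> real) a b a'.
      unital_hom \<iota> \<Longrightarrow> unital_hom \<kappa> \<Longrightarrow>
      \<forall>t\<in>T. same_sign (insertion \<iota> a t) (insertion \<kappa> b t) \<Longrightarrow> \<forall>i. i \<notin> UNIV \<longrightarrow> a' i = a i \<Longrightarrow>
      \<exists>b'. \<forall>s\<in>S. same_sign (insertion \<iota> a' s) (insertion \<kappa> b' s)"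
    using sign_elimination_variables[OF finite_class.finite_UNIV assms(1), where 'a='a and 'b=real] by blast
  \<comment> \<open>With every variable eliminated, the tests may be compared at the origin, where
    their values are images of real numbers.\<close>
  have "insertion \<iota> (\<lambda>i. 0) t = \<iota> (insertion (\<lambda>c. c) (\<lambda>i. 0) t)" for t :: "'n rpoly"
    by (simp add: hom_insertion[OF \<iota>] unital_hom_simps(1)[OF \<iota>])
  then have "\<forall>t\<in>T. same_sign (insertion \<iota> (\<lambda>i. 0) t) (insertion (\<lambda>c. c) (\<lambda>i. 0) t)"
    by (simp add: same_sign_real_hom[OF \<iota>])
  then obtain b where "\<forall>s\<in>S. same_sign (insertion \<iota> (\<lambda>i. \<Psi> (var_poly i)) s) (insertion (\<lambda>c. c) b s)"
    using T[OF \<iota> unital_hom_ident] by blast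
  then show ?thesis
    by (intro exI[of _ "\<chi> i. b i"])
      (simp add: poly_eval_insertion hom_eq_insertion[OF assms(2), folded \<iota>_def, symmetric])
qed

section \<open>Maximal cones in an algebraically closed field\<close>

text \<open>A preordering of the subfield \<open>cone_field P\<close>. Only squares of differences
  of cone elements are required, that is squares of that subfield: in the algebraically closed
  ambient field -1 is a square.\<close>

definition real_cone :: "'a::field set \<Rightarrow> bool" where
  "real_cone P \<longleftrightarrow> 1 \<in> P \<and> (\<forall>x\<in>P. \<forall>y\<in>P. x + y \<in> P \<and> x * y \<in> P \<and> (x - y)\<^sup>2 \<in> P) \<and>
    (\<forall>x\<in>P. inverse x \<in> P) \<and> - 1 \<notin> P"

text \<open>The competing cones may generate larger subfields. Maximality thus gives totality of the
  order on the subfield and, through algebraic extensions, its real closedness at one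
  stroke.\<close>

definition maximal_cone :: "'a::field set \<Rightarrow> bool" where
  "maximal_cone P \<longleftrightarrow> real_cone P \<and> (\<forall>Q. real_cone Q \<longrightarrow> P \<subseteq> Q \<longrightarrow> Q = P)"

definition cone_field :: "'a::field set \<Rightarrow> 'a set" where
  "cone_field P = {x - y | x y. x \<in> P \<and> y \<in> P}"

text \<open>For a field \<open>E\<close> containing \<open>P\<close>, the smallest candidate for a
  cone extending \<open>P\<close> to all of \<open>E\<close>.\<close>

inductive_set cone_span :: "'a::field set \<Rightarrow> 'a set \<Rightarrow> 'a set" for P E where
  zero: "0 \<in> cone_span P E"
| add: "t \<in> cone_span P E \<Longrightarrow> c \<in> P \<Longrightarrow> e \<in> E \<Longrightarrow> t + c * e\<^sup>2 \<in> cone_span P E"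

lemma real_coneD:
  assumes "real_cone P"
  shows "1 \<in> P" "x \<in> P \<Longrightarrow> y \<in> P \<Longrightarrow> x + y \<in> P" "x \<in> P \<Longrightarrow> y \<in> P \<Longrightarrow> x * y \<in> P"
    "x \<in> P \<Longrightarrow> y \<in> P \<Longrightarrow> (x - y)\<^sup>2 \<in> P" "x \<in> P \<Longrightarrow> inverse x \<in> P" "- 1 \<notin> P"
  using assms unfolding real_cone_def by blast+

lemma real_cone_zero: "real_cone P \<Longrightarrow> 0 \<in> P"
  using real_coneD(4)[of P 1 1] real_coneD(1)[of P] by simp

lemma mult_inverse_square: "x * (inverse x)\<^sup>2 = inverse x" for x :: "'a::field"
  by (cases "x = 0") (simp_all add: power2_eq_square mult.assoc[symmetric])

lemma maximal_cone_exists: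
  assumes "real_cone P0"
  shows "\<exists>P. maximal_cone P \<and> P0 \<subseteq> P"
proof -
  let ?A = "{Q. real_cone Q \<and> P0 \<subseteq> Q}"
  have "\<exists>M\<in>?A. \<forall>N\<in>?A. M \<subseteq> N \<longrightarrow> N = M"
  proof (rule subset_Zorn_nonempty)
    show "{Q. real_cone Q \<and> P0 \<subseteq> Q} \<noteq> {}"
      using assms by blast
  next
    fix C assume C: "C \<noteq> {}" "subset.chain {Q. real_cone Q \<and> P0 \<subseteq> Q} C"
    have cone: "real_cone Q \<and> P0 \<subseteq> Q" if "Q \<in> C" for Q
      using C that by (auto simp: subset.chain_def)
    have common: "\<exists>Q\<in>C. x \<in> Q \<and> y \<in> Q" if "x \<in> \<Union>C" "y \<in> \<Union>C" for x y
      using C that unfolding subset_chain_def by blast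
    have "real_cone (\<Union>C)"
      unfolding real_cone_def
    proof (intro conjI ballI)
      show "1 \<in> \<Union>C" "- 1 \<notin> \<Union>C"
        using C(1) cone real_coneD(1,6) by blast+
    next
      fix x y assume "x \<in> \<Union>C" "y \<in> \<Union>C"
      then obtain Q where "Q \<in> C" "x \<in> Q" "y \<in> Q"
        using common by blast
      then show "x + y \<in> \<Union>C" "x * y \<in> \<Union>C" "(x - y)\<^sup>2 \<in> \<Union>C"
        using cone real_coneD(2-4) by blast+
    next
      fix x assume "x \<in> \<Union>C"
      then show "inverse x \<in> \<Union>C"
        using cone real_coneD(5) by blast
    qed
    then show "\<Union>C \<in> {Q. real_cone Q \<and> P0 \<subseteq> Q}"
      using C(1) cone by blast
  qed
  then obtain M where M: "real_cone M" "P0 \<subseteq> M" "\<And>N. real_cone N \<Longrightarrow> P0 \<subseteq> N \<Longrightarrow> M \<subseteq> N \<Longrightarrow> N = M"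
    by auto
  have "maximal_cone M"
    unfolding maximal_cone_def using M by (meson order_trans)
  with M(2) show ?thesis by blast
qed

context
  fixes P :: "'a::field set"
  assumes P: "real_cone P"
begin

lemma cone_subset_field: "P \<subseteq> cone_field P"
  unfolding cone_field_def using real_cone_zero[OF P] by force

lemma cone_field_square: "x \<in> cone_field P \<Longrightarrow> x\<^sup>2 \<in> P"
  unfolding cone_field_def using real_coneD(4)[OF P] by blast

lemma cone_field_add: "x \<in> cone_field P \<Longrightarrow> y \<in> cone_field P \<Longrightarrow> x + y \<in> cone_field P"
proof -
  assume "x \<in> cone_field P" "y \<in> cone_field P"
  then obtain a b c d where "x = a - b" "y = c - d" "a \<in> P" "b \<in> P" "c \<in> P" "d \<in> P"
    unfolding cone_field_def by blast
  then have "x + y = (a + c) - (b + d)" "a + c \<in> P" "b + d \<in> P"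
    using real_coneD(2)[OF P] by auto
  then show ?thesis
    unfolding cone_field_def by blast
qed

lemma cone_field_minus: "x \<in> cone_field P \<Longrightarrow> - x \<in> cone_field P"
  unfolding cone_field_def by force

lemma cone_field_mult: "x \<in> cone_field P \<Longrightarrow> y \<in> cone_field P \<Longrightarrow> x * y \<in> cone_field P"
proof -
  assume "x \<in> cone_field P" "y \<in> cone_field P"
  then obtain a b c d where *: "x = a - b" "y = c - d" "a \<in> P" "b \<in> P" "c \<in> P" "d \<in> P"
    unfolding cone_field_def by blast
  have "x * y = (a * c + b * d) - (a * d + b * c)"
    unfolding *(1,2) by (simp add: algebra_simps)
  moreover have "a * c + b * d \<in> P" "a * d + b * c \<in> P"
    using * real_coneD(2,3)[OF P] by auto
  ultimately show ?thesis
    unfolding cone_field_def by blast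
qed

lemma cone_field_inverse: "x \<in> cone_field P \<Longrightarrow> inverse x \<in> cone_field P"
proof -
  assume x: "x \<in> cone_field P"
  have "inverse (x\<^sup>2) \<in> cone_field P"
    using real_coneD(5)[OF P cone_field_square[OF x]] cone_subset_field by blast
  with x have "x * inverse (x\<^sup>2) \<in> cone_field P"
    by (rule cone_field_mult)
  then show ?thesis
    by (simp add: power_inverse[symmetric] mult_inverse_square)
qed

lemma cone_field_zero: "0 \<in> cone_field P" and cone_field_one: "1 \<in> cone_field P"
  using cone_subset_field real_cone_zero[OF P] real_coneD(1)[OF P] by auto

lemma cone_two_nonzero: "(2::'a) \<noteq> 0"
proof
  assume "(2::'a) = 0"
  then have "- 1 = (1::'a)"
    by (metis add_eq_0_iff2 one_add_one)
  then show False
    using real_coneD(1,6)[OF P] by metis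
qed

text \<open>4 x = (x + 1)^2 - (x - 1)^2, and 2 has its inverse in the cone.\<close>

lemma mem_cone_field_if_squares:
  assumes "(x + 1)\<^sup>2 \<in> P" "(x - 1)\<^sup>2 \<in> P"
  shows "x \<in> cone_field P"
proof -
  have "2 \<in> P"
    using real_coneD(1,2)[OF P] by (metis one_add_one)
  then have "inverse 2 * inverse 2 \<in> cone_field P"
    using real_coneD(3,5)[OF P] cone_subset_field by blast
  moreover have "(x + 1)\<^sup>2 - (x - 1)\<^sup>2 \<in> cone_field P"
    using assms unfolding cone_field_def by blast
  ultimately have "((x + 1)\<^sup>2 - (x - 1)\<^sup>2) * (inverse 2 * inverse 2) \<in> cone_field P"
    using cone_field_mult by blast
  also have "(x + 1)\<^sup>2 - (x - 1)\<^sup>2 = x * 2 * 2"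
    by (simp add: power2_eq_square algebra_simps)
  also have "x * 2 * 2 * (inverse 2 * inverse 2) = x"
    using cone_two_nonzero by (metis mult.assoc mult.commute mult.right_neutral right_inverse)
  finally show ?thesis .
qed

lemma cone_antisym:
  assumes "x \<in> P" "- x \<in> P"
  shows "x = 0"
proof (rule ccontr)
  assume "x \<noteq> 0"
  have "- x * inverse x \<in> P"
    using assms real_coneD(3,5)[OF P] by blast
  with \<open>x \<noteq> 0\<close> show False
    using real_coneD(6)[OF P] by simp
qed

context
  fixes E :: "'a set"
  assumes PE: "P \<subseteq> E"
    and E: "\<And>x y. x \<in> E \<Longrightarrow> y \<in> E \<Longrightarrow> x + y \<in> E" "\<And>x y. x \<in> E \<Longrightarrow> y \<in> E \<Longrightarrow> x * y \<in> E"
      "\<And>x. x \<in> E \<Longrightarrow> - x \<in> E" "\<And>x. x \<in> E \<Longrightarrow> inverse x \<in> E"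
begin

lemma cone_span_in: "t \<in> cone_span P E \<Longrightarrow> t \<in> E"
  by (induction rule: cone_span.induct)
    (use real_cone_zero[OF P] PE in \<open>auto intro!: E simp: power2_eq_square\<close>)

lemma cone_span_add: "s \<in> cone_span P E \<Longrightarrow> t \<in> cone_span P E \<Longrightarrow> t + s \<in> cone_span P E"
  by (induction rule: cone_span.induct) (auto simp: add.assoc[symmetric] intro: cone_span.add)

lemma cone_span_single: "c \<in> P \<Longrightarrow> e \<in> E \<Longrightarrow> c * e\<^sup>2 \<in> cone_span P E"
  using cone_span.add[OF cone_span.zero, of c P e E] by simp

lemma cone_span_mult_single:
  assumes "t \<in> cone_span P E" "c \<in> P" "e \<in> E"
  shows "t * (c * e\<^sup>2) \<in> cone_span P E"
  using assms(1)
proof (induction rule: cone_span.induct)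
  case (add t d f)
  have "(d * c) * (f * e)\<^sup>2 \<in> cone_span P E"
    using add assms E real_coneD(3)[OF P] by (intro cone_span_single) auto
  with add have "t * (c * e\<^sup>2) + (d * c) * (f * e)\<^sup>2 \<in> cone_span P E"
    by (intro cone_span_add)
  then show ?case
    by (simp add: algebra_simps power2_eq_square)
qed (auto intro: cone_span.zero)

lemma cone_span_mult:
  assumes "s \<in> cone_span P E" "t \<in> cone_span P E"
  shows "t * s \<in> cone_span P E"
  using assms(1)
proof (induction rule: cone_span.induct)
  case (add s d f)
  then show ?case
    using cone_span_mult_single[OF assms(2), of d f] by (simp add: distrib_left cone_span_add)
qed (auto intro: cone_span.zero)

lemma real_cone_span:
  assumes "- 1 \<notin> cone_span P E"
  shows "real_cone (cone_span P E)"
  unfolding real_cone_def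
proof (intro conjI ballI assms)
  have one: "1 \<in> P" "1 \<in> E"
    using real_coneD(1)[OF P] PE by auto
  have sq: "e\<^sup>2 \<in> cone_span P E" if "e \<in> E" for e
    using cone_span_single[OF one(1) that] by simp
  show "1 \<in> cone_span P E"
    using sq[OF one(2)] by simp
  fix x assume x: "x \<in> cone_span P E"
  have "x * (inverse x)\<^sup>2 \<in> cone_span P E"
    using x by (intro cone_span_mult sq E cone_span_in)
  then show "inverse x \<in> cone_span P E"
    by (simp add: mult_inverse_square)
  fix y assume y: "y \<in> cone_span P E"
  show "x + y \<in> cone_span P E" "x * y \<in> cone_span P E"
    using x y by (auto intro: cone_span_add cone_span_mult)
  have "x + - y \<in> E"
    using x y by (intro E cone_span_in)
  then show "(x - y)\<^sup>2 \<in> cone_span P E"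
    using sq by fastforce
qed

text \<open>If -1 is not in the span, the span is a cone above \<open>P\<close>, hence equal to
  \<open>P\<close>. Then all squares of \<open>E\<close> lie in \<open>P\<close>, and every element
  of \<open>E\<close> is a multiple of a difference of two squares.\<close>

lemma maximal_cone_extension:
  assumes "maximal_cone P"
  shows "- 1 \<in> cone_span P E \<or> E \<subseteq> cone_field P"
proof (cases "- 1 \<in> cone_span P E")
  case False
  have one: "1 \<in> P" "1 \<in> E"
    using real_coneD(1)[OF P] PE by auto
  have "P \<subseteq> cone_span P E"
    using cone_span_single[of _ 1] one by force
  then have eq: "cone_span P E = P"
    using assms real_cone_span[OF False] by (auto simp: maximal_cone_def)
  have sq: "e\<^sup>2 \<in> P" if "e \<in> E" for e
    using cone_span_single[OF one(1) that] eq by simp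
  have "e \<in> cone_field P" if "e \<in> E" for e
  proof (rule mem_cone_field_if_squares)
    show "(e + 1)\<^sup>2 \<in> P"
      using that one by (intro sq E)
    have "e + - 1 \<in> E"
      using that one by (intro E)
    then show "(e - 1)\<^sup>2 \<in> P"
      using sq by fastforce
  qed
  then show ?thesis by blast
qed simp

end

text \<open>Adjoin \<open>a\<close>: either P + a P is a cone, so by maximality it is
  \<open>P\<close> and contains \<open>a\<close>, or -1 = s + a t, and then -a = (1 + s) / t lies in
  \<open>P\<close>.\<close>

lemma maximal_cone_total:
  assumes max: "maximal_cone P" and a: "a \<in> cone_field P"
  shows "a \<in> P \<or> - a \<in> P"
proof -
  define Q where "Q = {s + a * t | s t. s \<in> P \<and> t \<in> P}"
  have PQ: "P \<subseteq> Q"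
    unfolding Q_def using real_cone_zero[OF P] by force
  have Q_field: "x \<in> cone_field P" if "x \<in> Q" for x
    using that a cone_subset_field unfolding Q_def by (auto intro!: cone_field_add cone_field_mult)
  have Q_mult: "x * y \<in> Q" if xy: "x \<in> Q" "y \<in> Q" for x y
  proof -
    obtain s t s' t' where *: "x = s + a * t" "y = s' + a * t'" "s \<in> P" "t \<in> P" "s' \<in> P" "t' \<in> P"
      using xy unfolding Q_def by blast
    then have "x * y = (s * s' + a\<^sup>2 * (t * t')) + a * (s * t' + t * s')"
      by (simp add: algebra_simps power2_eq_square)
    moreover have "s * s' + a\<^sup>2 * (t * t') \<in> P" "s * t' + t * s' \<in> P"
      using * cone_field_square[OF a] real_coneD(2,3)[OF P] by auto
    ultimately show ?thesis
      unfolding Q_def by blast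
  qed
  show ?thesis
  proof (cases "- 1 \<in> Q")
    case True
    then obtain s t where st: "- 1 = s + a * t" "s \<in> P" "t \<in> P"
      unfolding Q_def by blast
    then have "t \<noteq> 0"
      using real_coneD(6)[OF P] by auto
    have "- a * t = 1 + s"
      using st(1) by (metis add.commute add_diff_cancel_right' diff_minus_eq_add minus_mult_left minus_diff_eq uminus_add_conv_diff)
    then have "- a = (1 + s) * inverse t"
      using \<open>t \<noteq> 0\<close> by (metis mult.assoc mult.right_neutral right_inverse)
    then show ?thesis
      using st real_coneD[OF P] by metis
  next
    case False
    have "real_cone Q"
      unfolding real_cone_def
    proof (intro conjI ballI False)
      show "1 \<in> Q"
        using real_coneD(1)[OF P] PQ by blast
      fix x assume x: "x \<in> Q"
      have "(inverse x)\<^sup>2 \<in> Q"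
        using cone_field_square[OF cone_field_inverse[OF Q_field[OF x]]] PQ by blast
      with x have "x * (inverse x)\<^sup>2 \<in> Q"
        by (rule Q_mult)
      then show "inverse x \<in> Q"
        by (simp add: mult_inverse_square)
      fix y assume y: "y \<in> Q"
      show "x * y \<in> Q"
        using x y by (rule Q_mult)
      obtain s t s' t' where *: "x = s + a * t" "y = s' + a * t'" "s \<in> P" "t \<in> P" "s' \<in> P" "t' \<in> P"
        using x y unfolding Q_def by blast
      then have "x + y = (s + s') + a * (t + t')" "s + s' \<in> P" "t + t' \<in> P"
        using real_coneD(2)[OF P] by (auto simp: algebra_simps)
      then show "x + y \<in> Q"
        unfolding Q_def by blast
      have "x + - y \<in> cone_field P"
        using x y by (intro cone_field_add cone_field_minus Q_field)
      then show "(x - y)\<^sup>2 \<in> Q"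
        using cone_field_square PQ by fastforce
    qed
    then have "Q = P"
      using max PQ by (auto simp: maximal_cone_def)
    moreover have "0 + a * 1 \<in> Q"
      unfolding Q_def using real_cone_zero[OF P] real_coneD(1)[OF P] by blast
    ultimately show ?thesis by simp
  qed
qed

end

text \<open>A nonzero element of least degree in the ideal generated by \<open>g\<close> and
  \<open>p\<close> divides both; since \<open>p\<close> does not divide \<open>g\<close>,
  irreducibility makes it constant.\<close>

lemma poly_bezout_irreducible:
  fixes p g :: "'a::field poly"
  assumes irred: "\<And>q r. p = q * r \<Longrightarrow> degree q = 0 \<or> degree r = 0" and "p \<noteq> 0" "\<not> p dvd g"
  shows "\<exists>u v. g * u + p * v = 1"
proof -
  define I where "I = {g * u + p * v | u v. True}"
  have gI: "g \<in> I" and pI: "p \<in> I"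
  proof -
    have "g * 1 + p * 0 = g" "g * 0 + p * 1 = p" by simp_all
    then show "g \<in> I" "p \<in> I" unfolding I_def by (metis (mono_tags, lifting) mem_Collect_eq)+
  qed
  define e where "e = arg_min degree (\<lambda>e. e \<in> I \<and> e \<noteq> 0)"
  have e: "e \<in> I" "e \<noteq> 0" and least: "\<And>h. h \<in> I \<Longrightarrow> h \<noteq> 0 \<Longrightarrow> degree e \<le> degree h"
    using arg_min_nat_lemma[of "\<lambda>e. e \<in> I \<and> e \<noteq> 0" p degree] pI \<open>p \<noteq> 0\<close> unfolding e_def by auto
  have dvd: "e dvd h" if "h \<in> I" for h
  proof -
    obtain u v where uv: "e = g * u + p * v"
      using e(1) unfolding I_def by blast
    obtain s t where st: "h = g * s + p * t"
      using \<open>h \<in> I\<close> unfolding I_def by blast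
    have "h mod e = h - e * (h div e)"
      by (simp add: minus_mult_div_eq_mod)
    also have "\<dots> = g * (s - u * (h div e)) + p * (t - v * (h div e))"
      using arg_cong[OF uv, of "\<lambda>e'. h - e' * (h div e)"] st by (simp add: algebra_simps)
    finally have "h mod e \<in> I"
      unfolding I_def by blast
    then have "h mod e = 0"
      using least[of "h mod e"] degree_mod_less[OF e(2), of h] by (metis leD)
    then show ?thesis by (simp add: dvd_eq_mod_eq_0)
  qed
  obtain k where k: "p = e * k"
    using dvd[OF pI] by blast
  have "degree k \<noteq> 0"
  proof
    assume "degree k = 0"
    then obtain c where c: "k = [:c:]"
      by (metis degree_eq_zeroE)
    with k \<open>p \<noteq> 0\<close> have "c \<noteq> 0" by auto
    with k c have "e = p * [:inverse c:]"
      by simp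
    then have "p dvd e" by (metis dvd_triv_left)
    with dvd[OF gI] \<open>\<not> p dvd g\<close> show False
      using dvd_trans by blast
  qed
  with irred[OF k] obtain c where c: "e = [:c:]"
    by (metis degree_eq_zeroE)
  with e(2) have "c \<noteq> 0" by auto
  obtain u v where "e = g * u + p * v"
    using e(1) unfolding I_def by blast
  then have "g * (u * [:inverse c:]) + p * (v * [:inverse c:]) = e * [:inverse c:]"
    by (simp add: algebra_simps)
  also have "\<dots> = 1"
    using c \<open>c \<noteq> 0\<close> by (simp add: one_pCons)
  finally show ?thesis by blast
qed

section \<open>The subfield of a maximal cone is real closed\<close>

context
  fixes P :: "'l::alg_closed_field set" and \<rho> :: "'f::linordered_field \<Rightarrow> 'l"
  assumes P: "maximal_cone P" and hom: "unital_hom \<rho>" and range: "range \<rho> = cone_field P"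
    and pos: "\<And>x. \<rho> x \<in> P \<longleftrightarrow> 0 \<le> x"
begin

lemma cone_of_maximal: "real_cone P"
  using P by (simp add: maximal_cone_def)

lemma rho_eq_zero_iff: "\<rho> x = 0 \<longleftrightarrow> x = 0"
proof
  assume "\<rho> x = 0"
  then have "\<rho> x \<in> P" "\<rho> (- x) \<in> P"
    using real_cone_zero[OF cone_of_maximal] by (simp_all add: unital_hom_simps(5)[OF hom])
  then show "x = 0"
    using pos by force
qed (simp add: unital_hom_simps(1)[OF hom])

text \<open>
  Artin--Schreier: for a root \<open>\<alpha>\<close> of an irreducible \<open>p\<close> that changes sign, an identity
  \<open>1 + \<Sum> c\<^sub>i q\<^sub>i\<^sup>2 = p k\<close> witnessing that the ordering does not extend to \<open>\<rho>(\<alpha>)\<close>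
  would force \<open>k\<close>, of smaller degree, to change sign too, hence to have a root.
\<close>

lemma maximal_cone_irreducible_no_sign_change:
  fixes p :: "'f poly"
  assumes irred: "\<And>q r. p = q * r \<Longrightarrow> degree q = 0 \<or> degree r = 0" and deg: "2 \<le> degree p"
    and ab: "a < b" "poly p a * poly p b < 0"
    and IH: "\<And>k a b. degree k < degree p \<Longrightarrow> a < b \<Longrightarrow> poly k a * poly k b < 0 \<Longrightarrow> \<exists>x. poly k x = (0::'f)"
  shows False
proof -
  have "p \<noteq> 0" using deg by auto
  have "degree (map_poly \<rho> p) = degree p"
    using rho_eq_zero_iff \<open>p \<noteq> 0\<close> by (intro map_poly_degree_eq) simp
  then obtain \<alpha> where \<alpha>: "poly (map_poly \<rho> p) \<alpha> = 0"
    using alg_closed_imp_poly_has_root[of "map_poly \<rho> p"] deg by auto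
  define ev where "ev g = poly (map_poly \<rho> g) \<alpha>" for g
  note simps = unital_hom_simps[OF unital_hom_map_poly[OF hom]]
  have ev: "ev (g + h) = ev g + ev h" "ev (g * h) = ev g * ev h" "ev (- g) = - ev g" "ev p = 0"
      "ev [:c:] = \<rho> c" "ev 1 = 1" "ev 0 = 0" for g h c
    using \<alpha> by (simp_all add: ev_def simps map_poly_pCons unital_hom_simps(1)[OF hom])
  have ev_mod: "ev (g mod p) = ev g" for g
  proof -
    have "ev (p * (g div p) + g mod p) = ev (g mod p)"
      by (simp only: ev mult_zero_left add_0)
    then show ?thesis by simp
  qed
  \<comment> \<open>The field obtained by adjoining \<alpha>; inverses come from the Bezout identity
    modulo \<open>p\<close>.\<close>
  define E where "E = range ev"
  have E: "x + y \<in> E" "x * y \<in> E" "- x \<in> E" if "x \<in> E" "y \<in> E" for x y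
  proof -
    obtain g h where "x = ev g" "y = ev h"
      using \<open>x \<in> E\<close> \<open>y \<in> E\<close> unfolding E_def by blast
    then have "x + y = ev (g + h)" "x * y = ev (g * h)" "- x = ev (- g)"
      by (simp_all only: ev)
    then show "x + y \<in> E" "x * y \<in> E" "- x \<in> E"
      unfolding E_def by simp_all
  qed
  have inv: "inverse x \<in> E" if "x \<in> E" for x
  proof -
    obtain g where g: "x = ev g" using \<open>x \<in> E\<close> unfolding E_def by blast
    show ?thesis
    proof (cases "p dvd g")
      case True
      then obtain k where "g = p * k" by blast
      then show ?thesis using g that by (simp add: ev)
    next
      case False
      then obtain u v where "g * u + p * v = 1"
        using poly_bezout_irreducible[OF irred \<open>p \<noteq> 0\<close>] by blast
      then have "ev (g * u + p * v) = 1"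
        by (simp add: ev(6))
      then have "x * ev u = 1"
        by (simp add: ev g)
      then have "inverse x = ev u"
        by (metis inverse_unique)
      then show ?thesis unfolding E_def by simp
    qed
  qed
  have PE: "P \<subseteq> E"
  proof
    fix x assume "x \<in> P"
    then have "x \<in> range \<rho>"
      using cone_subset_field[OF cone_of_maximal] range by blast
    then obtain c where "x = ev [:c:]"
      using ev(5) by auto
    then show "x \<in> E" unfolding E_def by simp
  qed
  \<comment> \<open>Reducing each square root modulo \<open>p\<close> bounds the degree of the
    representing polynomial; this bound later makes the cofactor \<open>k\<close> shorter than
    \<open>p\<close>.\<close>
  have span: "\<exists>s. ev s = t \<and> (\<forall>x. 0 \<le> poly s x) \<and> degree s \<le> 2 * (degree p - 1)" if "t \<in> cone_span P E" for t
    using that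
  proof (induction rule: cone_span.induct)
    case zero
    then show ?case by (intro exI[of _ 0]) (simp add: ev)
  next
    case (add t c e)
    then obtain s where s: "ev s = t" "\<And>x. 0 \<le> poly s x" "degree s \<le> 2 * (degree p - 1)" by blast
    have "c \<in> range \<rho>"
      using \<open>c \<in> P\<close> cone_subset_field[OF cone_of_maximal] range by auto
    then obtain d where d: "c = \<rho> d"
      by auto
    with \<open>c \<in> P\<close> have "0 \<le> d"
      using pos by simp
    obtain h where h: "e = ev h"
      using \<open>e \<in> E\<close> unfolding E_def by blast
    define g where "g = h mod p"
    have "degree g < degree p"
      using degree_mod_less'[of p h] \<open>p \<noteq> 0\<close> deg unfolding g_def by (cases "h mod p = 0") auto
    then have "degree ([:d:] * (g * g)) \<le> 2 * (degree p - 1)"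
      using degree_mult_le[of "[:d:]" "g * g"] degree_mult_le[of g g] by simp
    then have "degree (s + [:d:] * (g * g)) \<le> 2 * (degree p - 1)"
      using s(3) by (intro degree_add_le)
    moreover have "ev (s + [:d:] * (g * g)) = t + c * e\<^sup>2"
      unfolding ev s(1) d h g_def ev_mod by (simp add: power2_eq_square)
    moreover have "\<forall>x. 0 \<le> poly (s + [:d:] * (g * g)) x"
      using s(2) \<open>0 \<le> d\<close> by (auto intro!: add_nonneg_nonneg mult_nonneg_nonneg)
    ultimately show ?case by blast
  qed
  from maximal_cone_extension[OF cone_of_maximal PE E(1,2) _ inv P] E(3)
  consider "- 1 \<in> cone_span P E" | "E \<subseteq> cone_field P"
    by blast
  then show False
  proof cases
    case 1
    then obtain s where s: "ev s = - 1" "\<And>x. 0 \<le> poly s x" "degree s \<le> 2 * (degree p - 1)"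
      using span by blast
    have pos1: "0 < poly (1 + s) x" for x
      using s(2)[of x] by (simp add: add_pos_nonneg)
    have "p dvd 1 + s"
    proof (rule ccontr)
      assume "\<not> p dvd 1 + s"
      then obtain u v where "(1 + s) * u + p * v = 1"
        using poly_bezout_irreducible[OF irred \<open>p \<noteq> 0\<close>] by blast
      then have "ev ((1 + s) * u + p * v) = 1"
        by (simp add: ev(6))
      then show False by (simp add: ev s)
    qed
    then obtain k where k: "1 + s = p * k" by blast
    have "k \<noteq> 0"
      using k pos1[of 0] by auto
    have "degree p + degree k = degree (1 + s)"
      unfolding k using \<open>p \<noteq> 0\<close> \<open>k \<noteq> 0\<close> by (simp add: degree_mult_eq)
    also have "\<dots> \<le> 2 * (degree p - 1)"
      using s(3) by (intro degree_add_le) auto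
    finally have "degree k < degree p"
      using deg by linarith
    moreover have "poly k a * poly k b < 0"
    proof -
      have "0 < poly p a * poly k a" "0 < poly p b * poly k b"
        using pos1[of a] pos1[of b] by (simp_all add: k)
      then show ?thesis
        using ab(2) by (auto simp: zero_less_mult_iff mult_less_0_iff)
    qed
    ultimately obtain x where "poly k x = 0"
      using IH ab(1) by blast
    then show False
      using pos1[of x] by (simp add: k)
  next
    \<comment> \<open>Now \<alpha> already lies in the subfield, so \<open>p\<close> has a linear
      factor, impossible for an irreducible polynomial of degree at least 2.\<close>
    case 2
    have "ev [:0, 1:] = \<alpha>"
      by (simp add: ev_def map_poly_pCons unital_hom_simps(1,2)[OF hom])
    then have "\<alpha> \<in> E"
      unfolding E_def by (metis rangeI)
    with 2 range obtain r where r: "\<alpha> = \<rho> r" by blast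
    then have "\<rho> (poly p r) = 0"
      using \<alpha> poly_map_poly_hom[OF hom, of p r] by simp
    then have "poly p r = 0"
      by (simp add: rho_eq_zero_iff)
    then obtain k where k: "p = [:- r, 1:] * k"
      by (metis poly_eq_0_iff_dvd dvdE)
    with \<open>p \<noteq> 0\<close> have "k \<noteq> 0" by auto
    then have "degree p = Suc (degree k)"
      unfolding k by (subst degree_mult_eq) auto
    with irred[OF k] deg show False by simp
  qed
qed

text \<open>If a product changes sign, one of its factors does; linear polynomials are solved
  directly, and irreducible ones of higher degree never change sign.\<close>

lemma maximal_cone_IVT:
  fixes p :: "'f poly"
  assumes "a < b" "poly p a * poly p b < 0"
  shows "\<exists>x. a < x \<and> x < b \<and> poly p x = 0"
  using assms
proof (induction "degree p" arbitrary: p a b rule: less_induct)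
  case less
  show ?case
  proof (cases "\<exists>q r. p = q * r \<and> degree q \<noteq> 0 \<and> degree r \<noteq> 0")
    case True
    then obtain q r where qr: "p = q * r" "degree q \<noteq> 0" "degree r \<noteq> 0" by blast
    then have "degree p = degree q + degree r"
      using degree_mult_eq[of q r] by force
    then have less': "degree q < degree p" "degree r < degree p"
      using qr by auto
    have "poly q a * poly q b < 0 \<or> poly r a * poly r b < 0"
      using less.prems(2) unfolding qr(1) poly_mult
      by (auto simp: mult_less_0_iff zero_less_mult_iff)
    then show ?thesis
      using less.hyps[OF less'(1) less.prems(1)] less.hyps[OF less'(2) less.prems(1)] qr(1) by fastforce
  next
    case irred: False
    consider "degree p = 0" | "degree p = 1" | "2 \<le> degree p" by linarith
    then show ?thesis
    proof cases
      case 1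
      then obtain c where "p = [:c:]" by (metis degree_eq_zeroE)
      with less.prems show ?thesis by (simp add: mult_less_0_iff)
    next
      case 2
      then obtain c0 c1 where p: "p = [:c0, c1:]" "c1 \<noteq> 0"
        by (metis degree_eq_zeroE degree_pCons_eq_if pCons_cases One_nat_def Suc_inject zero_neq_one pCons_0_0 degree_0)
      define r where "r = - c0 / c1"
      have "poly p x = c1 * (x - r)" for x
        using p by (simp add: r_def field_simps)
      then have *: "poly p r = 0" "poly p a * poly p b = c1\<^sup>2 * ((a - r) * (b - r))"
        by (simp_all add: power2_eq_square)
      then have "c1\<^sup>2 * ((a - r) * (b - r)) < 0"
        using less.prems(2) by simp
      then have "(a - r) * (b - r) < 0"
        by (simp add: mult_less_0_iff[of "c1\<^sup>2"] power2_less_0 not_less)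
      with * less.prems(1) show ?thesis
        by (intro exI[of _ r]) (auto simp: mult_less_0_iff)
    next
      case 3
      have False
      proof (rule maximal_cone_irreducible_no_sign_change[of p a b])
        fix k :: "'f poly" and a b assume "degree k < degree p" "a < b" "poly k a * poly k b < 0"
        then show "\<exists>x. poly k x = (0::'f)"
          using less.hyps by blast
      qed (use irred 3 less.prems in blast)+
      then show ?thesis ..
    qed
  qed
qed

end

section \<open>The weak real Nullstellensatz\<close>

lemma sos_zero: "0 \<in> sums_of_squares"
  unfolding sums_of_squares_def by (rule CollectI, rule exI[of _ "[]"]) simp

lemma sos_square: "q\<^sup>2 \<in> sums_of_squares"
  unfolding sums_of_squares_def by (rule CollectI, rule exI[of _ "[q]"]) simp

lemma sos_add:
  assumes "p \<in> sums_of_squares" "q \<in> sums_of_squares"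
  shows "p + q \<in> sums_of_squares"
proof -
  obtain ps qs where "p = sum_list (map (\<lambda>q. q ^ 2) ps)" "q = sum_list (map (\<lambda>q. q ^ 2) qs)"
    using assms unfolding sums_of_squares_def by blast
  then have "p + q = sum_list (map (\<lambda>q. q ^ 2) (ps @ qs))"
    by simp
  then show ?thesis
    unfolding sums_of_squares_def by blast
qed

lemma sos_induct [consumes 1, case_names zero add]:
  assumes "s \<in> sums_of_squares" "Q 0" "\<And>q s. s \<in> sums_of_squares \<Longrightarrow> Q s \<Longrightarrow> Q (q\<^sup>2 + s)"
  shows "Q s"
proof -
  have "Q (sum_list (map (\<lambda>q. q ^ 2) qs))" for qs
  proof (induction qs)
    case (Cons q qs)
    have "sum_list (map (\<lambda>q. q ^ 2) qs) \<in> sums_of_squares"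
      unfolding sums_of_squares_def by blast
    with Cons assms(3) show ?case by simp
  qed (simp add: assms(2))
  then show ?thesis
    using assms(1) unfolding sums_of_squares_def by blast
qed

lemma sos_mult:
  assumes "s \<in> sums_of_squares" "t \<in> sums_of_squares"
  shows "s * t \<in> sums_of_squares"
  using assms(1)
proof (induction rule: sos_induct)
  case (add q s)
  have "q\<^sup>2 * t \<in> sums_of_squares"
    using assms(2)
  proof (induction rule: sos_induct)
    case (add r t)
    have "q\<^sup>2 * (r\<^sup>2 + t) = (q * r)\<^sup>2 + q\<^sup>2 * t"
      by (simp add: power_mult_distrib distrib_left)
    then show ?case
      using add sos_add sos_square by metis
  qed (simp add: sos_zero)
  with add show ?case
    by (simp add: distrib_right sos_add)
qed (simp add: sos_zero)

lemma sos_sum: "(\<And>x. x \<in> A \<Longrightarrow> f x \<in> sums_of_squares) \<Longrightarrow> (\<Sum>x\<in>A. f x) \<in> sums_of_squares"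
  by (induction A rule: infinite_finite_induct) (auto intro: sos_zero sos_add)

lemma sos_poly_eval_nonneg: "s \<in> sums_of_squares \<Longrightarrow> 0 \<le> poly_eval s x"
  by (induction rule: sos_induct)
    (simp_all add: unital_hom_simps[OF unital_hom_poly_eval])

section \<open>Ideals and real primes of the polynomial ring\<close>

definition poly_ideal :: "'n::finite rpoly set \<Rightarrow> bool" where
  "poly_ideal I \<longleftrightarrow> 0 \<in> I \<and> (\<forall>f\<in>I. \<forall>g\<in>I. f + g \<in> I) \<and> (\<forall>f\<in>I. \<forall>h. h * f \<in> I)"

definition real_prime :: "'n::finite rpoly set \<Rightarrow> bool" where
  "real_prime Q \<longleftrightarrow> poly_ideal Q \<and> 1 \<notin> Q \<and> (\<forall>f g. f * g \<in> Q \<longrightarrow> f \<in> Q \<or> g \<in> Q) \<and>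
    (\<forall>f. \<forall>s\<in>sums_of_squares. f\<^sup>2 + s \<in> Q \<longrightarrow> f \<in> Q)"

text \<open>A finite witness is required because sign transfer handles finitely many polynomials at
  a time; this spares a finite-generation argument.\<close>

definition point_free :: "'n::finite rpoly set \<Rightarrow> bool" where
  "point_free Q \<longleftrightarrow> (\<exists>G\<subseteq>Q. finite G \<and> (\<forall>x. \<exists>g\<in>G. poly_eval g x \<noteq> 0))"

lemma poly_idealD:
  assumes "poly_ideal I"
  shows "0 \<in> I" "f \<in> I \<Longrightarrow> g \<in> I \<Longrightarrow> f + g \<in> I" "f \<in> I \<Longrightarrow> h * f \<in> I" "f \<in> I \<Longrightarrow> f * h \<in> I"
    "f \<in> I \<Longrightarrow> - f \<in> I" "f \<in> I \<Longrightarrow> g \<in> I \<Longrightarrow> f - g \<in> I"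
proof -
  show *: "0 \<in> I" "f \<in> I \<Longrightarrow> g \<in> I \<Longrightarrow> f + g \<in> I" "f \<in> I \<Longrightarrow> h * f \<in> I" for f g h
    using assms by (auto simp: poly_ideal_def)
  show "f \<in> I \<Longrightarrow> f * h \<in> I"
    using *(3)[of f h] by (simp add: mult.commute)
  show uminus: "f \<in> I \<Longrightarrow> - f \<in> I" for f
    using *(3)[of f "- 1"] by simp
  show "f \<in> I \<Longrightarrow> g \<in> I \<Longrightarrow> f - g \<in> I"
    using *(2)[of f "- g"] uminus by simp
qed

text \<open>Guarantees a real prime to choose below even if no counterexample exists.\<close>

lemma real_prime_point: "real_prime {f. poly_eval f x = 0}"
  unfolding real_prime_def poly_ideal_def
  by (auto simp: unital_hom_simps[OF unital_hom_poly_eval] add_nonneg_eq_0_iff sos_poly_eval_nonneg)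

text \<open>
  Types cannot depend on an ideal, so the residue domain and its real closure are built for one
  fixed real prime, chosen to be a counterexample to the real Nullstellensatz if there is one.
\<close>

definition chosen_prime :: "'n::finite rpoly set" where
  "chosen_prime = (SOME Q. real_prime Q \<and> ((\<exists>Q' :: 'n rpoly set. real_prime Q' \<and> point_free Q') \<longrightarrow> point_free Q))"

lemma chosen_prime:
  fixes Q :: "'n::finite rpoly set"
  shows "real_prime (chosen_prime :: 'n rpoly set)"
    and "real_prime Q \<Longrightarrow> point_free Q \<Longrightarrow> point_free (chosen_prime :: 'n rpoly set)"
proof -
  have "\<exists>Q :: 'n rpoly set. real_prime Q \<and> ((\<exists>Q' :: 'n rpoly set. real_prime Q' \<and> point_free Q') \<longrightarrow> point_free Q)"
    using real_prime_point by blast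
  from someI_ex[OF this, folded chosen_prime_def]
  show "real_prime (chosen_prime :: 'n rpoly set)"
    and "real_prime Q \<Longrightarrow> point_free Q \<Longrightarrow> point_free (chosen_prime :: 'n rpoly set)"
    by blast+
qed

lemma poly_ideal_chosen: "poly_ideal (chosen_prime :: 'n::finite rpoly set)"
  using chosen_prime(1) by (auto simp: real_prime_def)

\<comment> \<open>The residue domain of the chosen prime and its fraction field\<close>
quotient_type (overloaded) 'n residue = "'n::finite rpoly" / "\<lambda>f g. f - g \<in> chosen_prime"
proof (rule equivpI)
  note I = poly_idealD[OF poly_ideal_chosen]
  show "reflp (\<lambda>f g :: 'n rpoly. f - g \<in> chosen_prime)"
    using I(1) by (auto intro!: reflpI)
  show "symp (\<lambda>f g :: 'n rpoly. f - g \<in> chosen_prime)"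
    using I(5) by (metis (mono_tags, lifting) minus_diff_eq sympI)
  show "transp (\<lambda>f g :: 'n rpoly. f - g \<in> chosen_prime)"
  proof (rule transpI)
    fix f g h :: "'n rpoly"
    assume "f - g \<in> chosen_prime" "g - h \<in> chosen_prime"
    from I(2)[OF this] show "f - h \<in> chosen_prime" by simp
  qed
qed

instantiation residue :: (finite) idom
begin

lift_definition zero_residue :: "'a residue" is 0 .
lift_definition one_residue :: "'a residue" is 1 .

lift_definition plus_residue :: "'a residue \<Rightarrow> 'a residue \<Rightarrow> 'a residue" is "(+)"
proof -
  fix f f' g g' :: "'a rpoly"
  assume "f - f' \<in> chosen_prime" "g - g' \<in> chosen_prime"
  from poly_idealD(2)[OF poly_ideal_chosen this] show "f + g - (f' + g') \<in> chosen_prime"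
    by (simp add: algebra_simps)
qed

lift_definition minus_residue :: "'a residue \<Rightarrow> 'a residue \<Rightarrow> 'a residue" is "(-)"
proof -
  fix f f' g g' :: "'a rpoly"
  assume "f - f' \<in> chosen_prime" "g - g' \<in> chosen_prime"
  from poly_idealD(6)[OF poly_ideal_chosen this] show "f - g - (f' - g') \<in> chosen_prime"
    by (simp add: algebra_simps)
qed

lift_definition uminus_residue :: "'a residue \<Rightarrow> 'a residue" is uminus
proof -
  fix f f' :: "'a rpoly"
  assume "f - f' \<in> chosen_prime"
  from poly_idealD(5)[OF poly_ideal_chosen this] show "- f - - f' \<in> chosen_prime"
    by (simp add: algebra_simps)
qed

lift_definition times_residue :: "'a residue \<Rightarrow> 'a residue \<Rightarrow> 'a residue" is "(*)"
proof -
  fix f f' g g' :: "'a rpoly"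
  assume "f - f' \<in> chosen_prime" "g - g' \<in> chosen_prime"
  then have "g * (f - f') + f' * (g - g') \<in> chosen_prime"
    using poly_idealD[OF poly_ideal_chosen] by blast
  then show "f * g - f' * g' \<in> chosen_prime"
    by (simp add: algebra_simps)
qed

instance
proof
  note I = poly_idealD(1)[OF poly_ideal_chosen]
  fix a b c :: "'a residue"
  show "a * b * c = a * (b * c)" "a * b = b * a" "1 * a = a" "a + b + c = a + (b + c)" "a + b = b + a"
    "0 + a = a" "- a + a = 0" "a - b = a + - b" "(a + b) * c = a * c + b * c"
    "0 * a = 0" "a * 0 = 0" "a * (b + c) = a * b + a * c"
    by (transfer; simp add: algebra_simps I)+
  show "(0::'a residue) \<noteq> 1"
    by transfer (use chosen_prime(1) poly_idealD(5)[OF poly_ideal_chosen] in \<open>fastforce simp: real_prime_def\<close>)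
  show "a \<noteq> 0 \<Longrightarrow> b \<noteq> 0 \<Longrightarrow> a * b \<noteq> 0"
    by transfer (use chosen_prime(1) in \<open>auto simp: real_prime_def\<close>)
qed

end

lemma abs_residue_eq_0_iff: "abs_residue f = 0 \<longleftrightarrow> f \<in> chosen_prime"
  by transfer simp

lemma unital_hom_abs_residue: "unital_hom abs_residue"
  by (simp add: unital_hom_def one_residue.abs_eq plus_residue.abs_eq times_residue.abs_eq)

definition residue_embedding :: "'n::finite rpoly \<Rightarrow> 'n residue fract alg_closure" where
  "residue_embedding f = to_ac (Fract (abs_residue f) 1)"

lemma unital_hom_residue_embedding: "unital_hom residue_embedding"
  by (simp add: unital_hom_def residue_embedding_def unital_hom_simps[OF unital_hom_abs_residue]
      One_fract_def[symmetric] to_ac_add[symmetric] to_ac_mult[symmetric] del: to_ac_add to_ac_mult)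

lemma residue_embedding_eq_0_iff: "residue_embedding f = 0 \<longleftrightarrow> f \<in> chosen_prime"
  by (simp add: residue_embedding_def abs_residue_eq_0_iff[symmetric] Zero_fract_def eq_fract)

text \<open>The sums of squares of the residue field, each over a common square denominator.\<close>

definition square_cone :: "'n::finite residue fract alg_closure set" where
  "square_cone = {residue_embedding s / (residue_embedding d)\<^sup>2 | s d.
    s \<in> sums_of_squares \<and> d \<notin> chosen_prime}"

lemma real_cone_square_cone: "real_cone (square_cone :: 'n::finite residue fract alg_closure set)"
  unfolding real_cone_def
proof (intro conjI ballI)
  let ?j = "residue_embedding :: 'n rpoly \<Rightarrow> _" and ?C = "square_cone :: 'n residue fract alg_closure set"
  note j = unital_hom_simps[OF unital_hom_residue_embedding]
  have memI: "z \<in> ?C" if "z * (?j d)\<^sup>2 = ?j s" "s \<in> sums_of_squares" "?j d \<noteq> 0" for z s d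
  proof -
    have "z = ?j s / (?j d)\<^sup>2"
      using that by (simp add: field_simps)
    with that show ?thesis
      unfolding square_cone_def residue_embedding_eq_0_iff by blast
  qed
  have memE: "\<exists>s d. z * (?j d)\<^sup>2 = ?j s \<and> s \<in> sums_of_squares \<and> ?j d \<noteq> 0" if z: "z \<in> ?C" for z
  proof -
    obtain s d where sd: "z = ?j s / (?j d)\<^sup>2" "s \<in> sums_of_squares" "?j d \<noteq> 0"
      using z unfolding square_cone_def residue_embedding_eq_0_iff by blast
    then have "z * (?j d)\<^sup>2 = ?j s"
      by simp
    with sd show ?thesis by blast
  qed
  show "1 \<in> ?C"
    using memI[of 1 1 "1\<^sup>2"] sos_square[of "1 :: 'n rpoly"] by (simp add: j)
  show "- 1 \<notin> ?C"
  proof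
    assume "- 1 \<in> ?C"
    then obtain s d where sd: "- 1 * (?j d)\<^sup>2 = ?j s" "s \<in> sums_of_squares" "?j d \<noteq> 0"
      using memE by blast
    \<comment> \<open>Reality of the prime enters here: with d^2 + s it contains \<open>d\<close>,
      so the denominator would vanish.\<close>
    then have "?j (d\<^sup>2 + s) = 0"
      by (simp add: j sd(1)[symmetric])
    then have "d \<in> chosen_prime"
      using chosen_prime(1) sd(2) unfolding residue_embedding_eq_0_iff real_prime_def by blast
    with sd(3) show False
      by (simp add: residue_embedding_eq_0_iff)
  qed
  fix x :: "'n residue fract alg_closure" assume "x \<in> ?C"
  then obtain s d where sd: "x * (?j d)\<^sup>2 = ?j s" "s \<in> sums_of_squares" "?j d \<noteq> 0"
    using memE by blast
  show "inverse x \<in> ?C"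
  proof (cases "x = 0")
    case True
    then show ?thesis
      using memI[of 0 1 0] sos_zero sos_square[of "1 :: 'n rpoly"] by (simp add: j)
  next
    case False
    with sd have "?j s \<noteq> 0" by auto
    moreover have "d\<^sup>2 * s \<in> sums_of_squares"
      using sd sos_mult sos_square by blast
    moreover have "inverse x * (?j s)\<^sup>2 = ?j (d\<^sup>2 * s)"
      using False by (simp add: j sd(1)[symmetric] power2_eq_square field_simps)
    ultimately show ?thesis
      using memI by blast
  qed
  fix y :: "'n residue fract alg_closure" assume "y \<in> ?C"
  then obtain t e where te: "y * (?j e)\<^sup>2 = ?j t" "t \<in> sums_of_squares" "?j e \<noteq> 0"
    using memE by blast
  have de: "?j (d * e) \<noteq> 0"
    using sd te by (simp add: j)
  have "(x + y) * (?j (d * e))\<^sup>2 = ?j (s * e\<^sup>2 + t * d\<^sup>2)"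
    by (simp add: j sd(1)[symmetric] te(1)[symmetric] power2_eq_square algebra_simps)
  moreover have "s * e\<^sup>2 + t * d\<^sup>2 \<in> sums_of_squares"
    by (intro sos_add sos_mult sd te sos_square)
  ultimately show "x + y \<in> ?C"
    using memI de by blast
  have "(x * y) * (?j (d * e))\<^sup>2 = ?j (s * t)"
    by (simp add: j sd(1)[symmetric] te(1)[symmetric] power2_eq_square algebra_simps)
  then show "x * y \<in> ?C"
    using memI de sos_mult sd te by blast
  have "?j ((d * e)\<^sup>2) \<noteq> 0"
    using de by (simp add: j)
  moreover have "(x - y) * ?j ((d * e)\<^sup>2) = ?j (s * e\<^sup>2 - t * d\<^sup>2)"
    by (simp add: j sd(1)[symmetric] te(1)[symmetric] power2_eq_square algebra_simps)
  then have "((x - y) * ?j ((d * e)\<^sup>2))\<^sup>2 = ?j ((s * e\<^sup>2 - t * d\<^sup>2)\<^sup>2)"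
    by (simp only: j(7))
  then have "(x - y)\<^sup>2 * (?j ((d * e)\<^sup>2))\<^sup>2 = ?j ((s * e\<^sup>2 - t * d\<^sup>2)\<^sup>2)"
    by (simp only: power_mult_distrib)
  ultimately show "(x - y)\<^sup>2 \<in> ?C"
    using memI sos_square by blast
qed

definition order_cone :: "'n::finite residue fract alg_closure set" where
  "order_cone = (SOME P. maximal_cone P \<and> square_cone \<subseteq> P)"

lemma order_cone:
  "maximal_cone (order_cone :: 'n::finite residue fract alg_closure set)"
  "(square_cone :: 'n residue fract alg_closure set) \<subseteq> order_cone"
  using someI_ex[OF maximal_cone_exists[OF real_cone_square_cone]] unfolding order_cone_def by blast+

lemma real_cone_order_cone: "real_cone order_cone"
  by (rule order_cone(1)[unfolded maximal_cone_def, THEN conjunct1])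

section \<open>The real closed field cut out by the chosen maximal cone\<close>

typedef (overloaded) 'n rclosure = "cone_field (order_cone :: 'n::finite residue fract alg_closure set)"
  morphisms rclosure_val rclosure_of
  using cone_field_zero[OF real_cone_order_cone] by blast

setup_lifting type_definition_rclosure

instantiation rclosure :: (finite) linordered_field
begin

lift_definition zero_rclosure :: "'a rclosure" is 0
  by (rule cone_field_zero[OF real_cone_order_cone])
lift_definition one_rclosure :: "'a rclosure" is 1
  by (rule cone_field_one[OF real_cone_order_cone])
lift_definition plus_rclosure :: "'a rclosure \<Rightarrow> 'a rclosure \<Rightarrow> 'a rclosure" is "(+)"
  by (rule cone_field_add[OF real_cone_order_cone])
lift_definition times_rclosure :: "'a rclosure \<Rightarrow> 'a rclosure \<Rightarrow> 'a rclosure" is "(*)"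
  by (rule cone_field_mult[OF real_cone_order_cone])
lift_definition uminus_rclosure :: "'a rclosure \<Rightarrow> 'a rclosure" is uminus
  by (rule cone_field_minus[OF real_cone_order_cone])
lift_definition inverse_rclosure :: "'a rclosure \<Rightarrow> 'a rclosure" is inverse
  by (rule cone_field_inverse[OF real_cone_order_cone])
definition minus_rclosure :: "'a rclosure \<Rightarrow> 'a rclosure \<Rightarrow> 'a rclosure" where
  "minus_rclosure x y = x + - y"
definition divide_rclosure :: "'a rclosure \<Rightarrow> 'a rclosure \<Rightarrow> 'a rclosure" where
  "divide_rclosure x y = x * inverse y"
definition less_eq_rclosure :: "'a rclosure \<Rightarrow> 'a rclosure \<Rightarrow> bool" where
  "less_eq_rclosure x y \<longleftrightarrow> rclosure_val (y - x) \<in> order_cone"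
definition less_rclosure :: "'a rclosure \<Rightarrow> 'a rclosure \<Rightarrow> bool" where
  "less_rclosure x y \<longleftrightarrow> x \<le> y \<and> x \<noteq> y"
definition abs_rclosure :: "'a rclosure \<Rightarrow> 'a rclosure" where
  "abs_rclosure x = (if x < 0 then - x else x)"
definition sgn_rclosure :: "'a rclosure \<Rightarrow> 'a rclosure" where
  "sgn_rclosure x = (if x = 0 then 0 else if 0 < x then 1 else - 1)"

instance
proof
  note cone = real_coneD[OF real_cone_order_cone] real_cone_zero[OF real_cone_order_cone]
  note diff = minus_rclosure_def
  fix a b c :: "'a rclosure"
  show assoc: "a * b * c = a * (b * c)" "a * b = b * a" "1 * a = a" "a + b + c = a + (b + c)" "a + b = b + a"
    "0 + a = a" "- a + a = 0" "(a + b) * c = a * c + b * c" for a b c :: "'a rclosure"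
    by (transfer; simp add: algebra_simps)+
  show "a - b = a + - b" "a div b = a * inverse b"
    by (simp_all add: minus_rclosure_def divide_rclosure_def)
  show "a + b - a = b" "a - b - c = a - (b + c)" "0 * a = 0" "a * 0 = 0"
    unfolding minus_rclosure_def by (transfer; simp)+
  show "(0::'a rclosure) \<noteq> 1" "inverse (0::'a rclosure) = 0" "a \<noteq> 0 \<Longrightarrow> inverse a * a = 1"
    by (transfer; simp)+
  have val_diff: "rclosure_val (x - y) = rclosure_val x - rclosure_val y" for x y :: "'a rclosure"
    by (simp add: diff plus_rclosure.rep_eq uminus_rclosure.rep_eq)
  have le: "x \<le> y \<longleftrightarrow> rclosure_val y - rclosure_val x \<in> order_cone" for x y :: "'a rclosure"
    by (simp add: less_eq_rclosure_def val_diff)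
  show refl: "a \<le> a" for a :: "'a rclosure"
    by (simp add: le cone)
  show antisym: "a \<le> b \<Longrightarrow> b \<le> a \<Longrightarrow> a = b" for a b :: "'a rclosure"
    using cone_antisym[OF real_cone_order_cone, of "rclosure_val b - rclosure_val a"]
    by (simp add: le rclosure_val_inject)
  show "a < b \<longleftrightarrow> a \<le> b \<and> \<not> b \<le> a"
    using antisym refl by (auto simp: less_rclosure_def)
  show "a \<le> b \<Longrightarrow> b \<le> c \<Longrightarrow> a \<le> c"
    using cone(2)[of "rclosure_val b - rclosure_val a" "rclosure_val c - rclosure_val b"] by (simp add: le)
  show total: "a \<le> b \<or> b \<le> a" for a b :: "'a rclosure"
    using maximal_cone_total[OF real_cone_order_cone order_cone(1), of "rclosure_val (b - a)"] rclosure_val[of "b - a"]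
    by (simp add: le val_diff)
  show "a \<le> b \<Longrightarrow> c + a \<le> c + b"
    by (simp add: le plus_rclosure.rep_eq)
  show "a < b \<Longrightarrow> 0 < c \<Longrightarrow> c * a < c * b"
  proof -
    assume *: "a < b" "0 < c"
    then have "rclosure_val c * (rclosure_val b - rclosure_val a) \<in> order_cone"
      by (intro cone) (auto simp: less_rclosure_def le zero_rclosure.rep_eq)
    moreover have "c * a \<noteq> c * b"
      using * unfolding less_rclosure_def
      by (metis mult_cancel_left rclosure_val_inject times_rclosure.rep_eq zero_rclosure.rep_eq)
    ultimately show "c * a < c * b"
      by (simp add: less_rclosure_def le times_rclosure.rep_eq right_diff_distrib)
  qed
  show "\<bar>a\<bar> = (if a < 0 then - a else a)"
    by (simp add: abs_rclosure_def)
  show "sgn a = (if a = 0 then 0 else if 0 < a then 1 else - 1)"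
    by (simp add: sgn_rclosure_def)
qed

end

lemma unital_hom_rclosure_val: "unital_hom rclosure_val"
  by (simp add: unital_hom_def one_rclosure.rep_eq plus_rclosure.rep_eq times_rclosure.rep_eq)

instance rclosure :: (finite) real_closed_field
proof
  fix a b :: "'a rclosure" and c :: "nat \<Rightarrow> 'a rclosure" and n
  assume *: "a < b" "(\<Sum>k\<le>n. c k * a ^ k) < 0" "0 < (\<Sum>k\<le>n. c k * b ^ k)"
  define p where "p = (\<Sum>k\<le>n. monom (c k) k)"
  have p: "poly p x = (\<Sum>k\<le>n. c k * x ^ k)" for x
    by (simp add: p_def poly_sum poly_monom)
  have range: "range (rclosure_val :: 'a rclosure \<Rightarrow> _) = cone_field order_cone"
    using type_definition.Rep_range[OF type_definition_rclosure] .
  have pos: "rclosure_val x \<in> order_cone \<longleftrightarrow> 0 \<le> x" for x :: "'a rclosure"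
    by (simp add: less_eq_rclosure_def)
  have "poly p a * poly p b < 0"
    using * by (simp add: p mult_neg_pos)
  then have "\<exists>x. a < x \<and> x < b \<and> poly p x = 0"
    by (rule maximal_cone_IVT[OF order_cone(1) unital_hom_rclosure_val range pos *(1)])
  then show "\<exists>x. a < x \<and> x < b \<and> (\<Sum>k\<le>n. c k * x ^ k) = 0"
    by (simp add: p)
qed

definition closure_embedding :: "'n::finite rpoly \<Rightarrow> 'n rclosure" where
  "closure_embedding f = rclosure_of (residue_embedding f)"

text \<open>The cone contains the squares of all residues, in particular of those of f + 1 and f -
  1, so the residue of \<open>f\<close> lies in the subfield.\<close>

lemma rclosure_val_closure_embedding:
  fixes f :: "'n::finite rpoly"
  shows "rclosure_val (closure_embedding f) = residue_embedding f"
proof -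
  have sq: "(residue_embedding q)\<^sup>2 \<in> order_cone" for q :: "'n rpoly"
  proof -
    have "(residue_embedding q)\<^sup>2 = residue_embedding (q\<^sup>2) / (residue_embedding 1)\<^sup>2"
      by (simp add: unital_hom_simps[OF unital_hom_residue_embedding])
    moreover have "1 \<notin> (chosen_prime :: 'n rpoly set)"
      by (rule chosen_prime(1)[unfolded real_prime_def, THEN conjunct2, THEN conjunct1])
    ultimately show ?thesis
      using order_cone(2) sos_square unfolding square_cone_def by blast
  qed
  have "residue_embedding f \<in> cone_field order_cone"
    using sq[of "f + 1"] sq[of "f - 1"]
    by (intro mem_cone_field_if_squares[OF real_cone_order_cone])
      (simp_all add: unital_hom_simps[OF unital_hom_residue_embedding])
  then show ?thesis
    by (simp add: closure_embedding_def rclosure_of_inverse)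
qed

lemma unital_hom_closure_embedding: "unital_hom closure_embedding"
  by (simp add: unital_hom_def rclosure_val_inject[symmetric] rclosure_val_closure_embedding
      one_rclosure.rep_eq plus_rclosure.rep_eq times_rclosure.rep_eq
      unital_hom_simps[OF unital_hom_residue_embedding])

text \<open>Members of the chosen prime become 0 in its real closed field, and vanishing is a sign
  condition, so a finite set of them acquires a common real zero.\<close>

theorem real_prime_not_point_free:
  fixes Q :: "'n::finite rpoly set"
  assumes "real_prime Q"
  shows "\<not> point_free Q"
proof
  assume "point_free Q"
  then have "point_free (chosen_prime :: 'n rpoly set)"
    by (rule chosen_prime(2)[OF assms])
  then obtain G :: "'n rpoly set" where G: "G \<subseteq> chosen_prime" "finite G" "\<And>x. \<exists>g\<in>G. poly_eval g x \<noteq> 0"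
    unfolding point_free_def by blast
  obtain x where x: "\<And>g. g \<in> G \<Longrightarrow> same_sign (closure_embedding g) (poly_eval g x)"
    using sign_transfer_to_reals[OF G(2) unital_hom_closure_embedding] by blast
  have "closure_embedding g = 0" if "g \<in> G" for g
  proof -
    have "residue_embedding g = 0"
      using that G(1) by (auto simp: residue_embedding_eq_0_iff)
    then show ?thesis
      by (simp add: rclosure_val_inject[symmetric] rclosure_val_closure_embedding zero_rclosure.rep_eq)
  qed
  then have "poly_eval g x = 0" if "g \<in> G" for g
    using x[OF that] same_sign_zero_iff that by blast
  with G(3)[of x] show False by blast
qed

text \<open>By maximality, any \<open>a\<close> outside \<open>Q\<close> satisfies 1 + s = a u
  modulo \<open>Q\<close>. For a product f g in \<open>Q\<close>, multiplying two such relations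
  puts (1 + s)(1 + t) into \<open>Q\<close>; for f^2 + s in \<open>Q\<close>, squaring one gives (1
  + t)^2 + u^2 s in \<open>Q\<close>. Both have the excluded form.\<close>

lemma maximal_real_ideal_prime:
  fixes Q :: "'n::finite rpoly set"
  assumes Q: "poly_ideal Q" and proper: "\<And>s. s \<in> sums_of_squares \<Longrightarrow> 1 + s \<notin> Q"
    and max: "\<And>J. poly_ideal J \<Longrightarrow> Q \<subseteq> J \<Longrightarrow> (\<And>s. s \<in> sums_of_squares \<Longrightarrow> 1 + s \<notin> J) \<Longrightarrow> J = Q"
  shows "real_prime Q"
proof -
  have extend: "\<exists>s\<in>sums_of_squares. \<exists>u. 1 + s - a * u \<in> Q" if "a \<notin> Q" for a
  proof (rule ccontr)
    assume no: "\<not> ?thesis"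
    define J where "J = {q + a * u | q u. q \<in> Q}"
    have "poly_ideal J"
      unfolding poly_ideal_def
    proof (intro conjI ballI allI)
      have "0 = 0 + a * 0" by simp
      then show "0 \<in> J"
        unfolding J_def using poly_idealD(1)[OF Q] by blast
      fix f assume "f \<in> J"
      then obtain q u where f: "f = q + a * u" "q \<in> Q" unfolding J_def by blast
      {
        fix h
        have "h * f = h * q + a * (h * u)"
          by (simp add: f algebra_simps)
        then show "h * f \<in> J"
          unfolding J_def using poly_idealD(3)[OF Q f(2)] by blast
      next
        fix g assume "g \<in> J"
        then obtain r v where g: "g = r + a * v" "r \<in> Q" unfolding J_def by blast
        have "f + g = (q + r) + a * (u + v)"
          by (simp add: f g algebra_simps)
        then show "f + g \<in> J"
          unfolding J_def using poly_idealD(2)[OF Q f(2) g(2)] by blast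
      }
    qed
    moreover have "Q \<subseteq> J"
    proof
      fix q assume "q \<in> Q"
      moreover have "q = q + a * 0" by simp
      ultimately show "q \<in> J" unfolding J_def by blast
    qed
    moreover have "1 + s \<notin> J" if "s \<in> sums_of_squares" for s
    proof
      assume "1 + s \<in> J"
      then obtain q u where "1 + s = q + a * u" "q \<in> Q" unfolding J_def by blast
      then have "1 + s - a * u \<in> Q" by simp
      with no that show False by blast
    qed
    ultimately have "J = Q"
      by (rule max)
    moreover have "0 + a * 1 \<in> J"
      unfolding J_def using poly_idealD(1)[OF Q] by blast
    ultimately show False
      using \<open>a \<notin> Q\<close> by simp
  qed
  show ?thesis
    unfolding real_prime_def
  proof (intro conjI allI ballI impI Q)
    show "1 \<notin> Q"
      using proper[OF sos_zero] by simp
  next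
    fix f g assume fg: "f * g \<in> Q"
    show "f \<in> Q \<or> g \<in> Q"
    proof (rule ccontr)
      assume "\<not> ?thesis"
      then obtain s u t v where *: "s \<in> sums_of_squares" "1 + s - f * u \<in> Q"
          "t \<in> sums_of_squares" "1 + t - g * v \<in> Q"
        using extend by meson
      have "(1 + t) * (1 + s - f * u) + (f * u) * (1 + t - g * v) + (u * v) * (f * g) \<in> Q"
        by (rule poly_idealD(2)[OF Q poly_idealD(2)[OF Q poly_idealD(3)[OF Q *(2)] poly_idealD(3)[OF Q *(4)]]
              poly_idealD(3)[OF Q fg]])
      also have "(1 + t) * (1 + s - f * u) + (f * u) * (1 + t - g * v) + (u * v) * (f * g) = 1 + (s + t + s * t)"
        by (simp add: algebra_simps)
      finally show False
        using proper[OF sos_add[OF sos_add[OF *(1,3)] sos_mult[OF *(1,3)]]] by simp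
    qed
  next
    fix f s assume s: "s \<in> sums_of_squares" "f\<^sup>2 + s \<in> Q"
    show "f \<in> Q"
    proof (rule ccontr)
      assume "f \<notin> Q"
      then obtain t u where t: "t \<in> sums_of_squares" "1 + t - f * u \<in> Q"
        using extend by blast
      have "(1 + t + f * u) * (1 + t - f * u) + u\<^sup>2 * (f\<^sup>2 + s) \<in> Q"
        by (rule poly_idealD(2)[OF Q poly_idealD(3)[OF Q t(2)] poly_idealD(3)[OF Q s(2)]])
      also have "(1 + t + f * u) * (1 + t - f * u) + u\<^sup>2 * (f\<^sup>2 + s) = 1 + (t + t + t * t + u\<^sup>2 * s)"
        by (simp add: algebra_simps power2_eq_square)
      finally show False
        using proper[OF sos_add[OF sos_add[OF sos_add[OF t(1,1)] sos_mult[OF t(1,1)]] sos_mult[OF sos_square s(1)]]]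
        by simp
    qed
  qed
qed

theorem weak_real_Nullstellensatz:
  fixes I :: "'n::finite rpoly set"
  assumes I: "poly_ideal I" and "point_free I"
  shows "\<exists>s\<in>sums_of_squares. 1 + s \<in> I"
proof (rule ccontr)
  assume no: "\<not> ?thesis"
  let ?A = "{J. poly_ideal J \<and> I \<subseteq> J \<and> (\<forall>s\<in>sums_of_squares. 1 + s \<notin> J)}"
  have "\<exists>M\<in>?A. \<forall>N\<in>?A. M \<subseteq> N \<longrightarrow> N = M"
  proof (rule subset_Zorn_nonempty)
    show "?A \<noteq> {}"
      using I no by blast
  next
    fix C assume C: "C \<noteq> {}" "subset.chain ?A C"
    have mem: "poly_ideal J" "I \<subseteq> J" "\<forall>s\<in>sums_of_squares. 1 + s \<notin> J" if "J \<in> C" for J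
      using C(2) that by (auto simp: subset.chain_def)
    have common: "\<exists>J\<in>C. x \<in> J \<and> y \<in> J" if "x \<in> \<Union>C" "y \<in> \<Union>C" for x y
      using C that unfolding subset_chain_def by blast
    have "poly_ideal (\<Union>C)"
      unfolding poly_ideal_def
    proof (intro conjI ballI allI)
      show "0 \<in> \<Union>C"
        using C(1) mem(1) poly_idealD(1) by blast
    next
      fix f g assume "f \<in> \<Union>C" "g \<in> \<Union>C"
      then obtain J where "J \<in> C" "f \<in> J" "g \<in> J"
        using common by blast
      then show "f + g \<in> \<Union>C"
        using poly_idealD(2)[OF mem(1)] by blast
    next
      fix f h assume "f \<in> \<Union>C"
      then show "h * f \<in> \<Union>C"
        using poly_idealD(3)[OF mem(1)] by blast
    qed
    moreover have "I \<subseteq> \<Union>C"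
      using C(1) mem(2) by blast
    ultimately show "\<Union>C \<in> ?A"
      using mem(3) by blast
  qed
  then obtain M where MA: "M \<in> ?A" and max: "\<forall>N\<in>?A. M \<subseteq> N \<longrightarrow> N = M"
    by (rule bexE)
  then have M: "poly_ideal M" "I \<subseteq> M" "\<And>s. s \<in> sums_of_squares \<Longrightarrow> 1 + s \<notin> M"
    by simp_all
  have "real_prime M"
  proof (rule maximal_real_ideal_prime[OF M(1,3)])
    fix J assume J: "poly_ideal J" "M \<subseteq> J" "\<And>s. s \<in> sums_of_squares \<Longrightarrow> 1 + s \<notin> J"
    then have "J \<in> ?A"
      using M(2) by (simp add: subset_trans[OF M(2) J(2)])
    with max J(2) show "J = M" by simp
  qed
  moreover have "point_free M"
    using assms(2) M(2) unfolding point_free_def by (meson order_trans)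
  ultimately show False
    using real_prime_not_point_free by blast
qed

section \<open>Sums of squares modulo the gradient ideal\<close>

no_notation fps_nth (infixl "$" 75)

text \<open>An upper bound instead of the exact degree, because it forms a subspace and is stable
  under cancellation in sums.\<close>

definition deg_le :: "nat \<Rightarrow> 'n::finite rpoly set" where
  "deg_le k = {f. \<forall>m\<in>Poly_Mapping.keys f. monom_degree m \<le> k}"

lemma deg_le_mono: "f \<in> deg_le j \<Longrightarrow> j \<le> k \<Longrightarrow> f \<in> deg_le k"
  by (force simp: deg_le_def)

lemma deg_le_add: "f \<in> deg_le k \<Longrightarrow> g \<in> deg_le k \<Longrightarrow> f + g \<in> deg_le k"
  unfolding deg_le_def using Poly_Mapping.keys_add[of f g] by blast

lemma deg_le_mult:
  assumes "f \<in> deg_le j" "g \<in> deg_le k"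
  shows "f * g \<in> deg_le (j + k)"
  unfolding deg_le_def
proof (intro CollectI ballI)
  fix m assume "m \<in> Poly_Mapping.keys (f * g)"
  then obtain a b where ab: "m = a + b" "a \<in> Poly_Mapping.keys f" "b \<in> Poly_Mapping.keys g"
    using keys_mult[of f g] by blast
  then have "monom_degree m = monom_degree a + monom_degree b"
    by (simp add: monom_degree_def lookup_add sum.distrib)
  with ab assms show "monom_degree m \<le> j + k"
    by (auto simp: deg_le_def intro: add_mono)
qed

lemma deg_le_const: "const_poly c \<in> deg_le k"
  by (simp add: deg_le_def const_poly_def monom_degree_def)

lemma deg_le_0: "0 \<in> deg_le k"
  by (simp add: deg_le_def)

lemma deg_le_1: "1 \<in> deg_le k"
  by (simp add: deg_le_def monom_degree_def)

lemma deg_le_var: "var_poly i \<in> deg_le 1"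
  by (simp add: deg_le_def var_poly_def monom_degree_def lookup_single when_def)

lemma deg_le_uminus: "f \<in> deg_le k \<Longrightarrow> - f \<in> deg_le k"
  by (simp add: deg_le_def)

lemma deg_le_sum: "(\<And>x. x \<in> A \<Longrightarrow> f x \<in> deg_le k) \<Longrightarrow> (\<Sum>x\<in>A. f x) \<in> deg_le k"
  by (induction A rule: infinite_finite_induct) (auto intro: deg_le_0 deg_le_add)

lemma deg_le_prod: "(\<And>x. x \<in> A \<Longrightarrow> f x \<in> deg_le k) \<Longrightarrow> (\<Prod>x\<in>A. f x) \<in> deg_le (card A * k)"
proof (induction A rule: infinite_finite_induct)
  case (insert x A)
  then show ?case
    using deg_le_mult[of "f x" k "prod f A" "card A * k"] by simp
qed (auto intro: deg_le_1)

lemma deg_le_det: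
  fixes A :: "('m::finite rpoly)^'n^'n"
  assumes "\<And>i j. A $ i $ j \<in> deg_le k"
  shows "det A \<in> deg_le (CARD('n) * k)"
  unfolding det_def
proof (rule deg_le_sum)
  fix p :: "'n \<Rightarrow> 'n"
  have prod: "(\<Prod>i\<in>UNIV. A $ i $ p i) \<in> deg_le (CARD('n) * k)"
    by (rule deg_le_prod) (rule assms)
  show "of_int (sign p) * (\<Prod>i\<in>UNIV. A $ i $ p i) \<in> deg_le (CARD('n) * k)"
    using prod deg_le_uminus[OF prod] by (cases p rule: sign_cases) simp_all
qed

lemma deg_le_total_degree: "f \<in> deg_le (total_degree f)"
  by (simp add: deg_le_def total_degree_def)

lemma finite_monom_degree_le: "finite {m :: 'n::finite \<Rightarrow>\<^sub>0 nat. monom_degree m \<le> k}"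
proof (rule finite_imageD[of Poly_Mapping.lookup])
  have "Poly_Mapping.lookup ` {m :: 'n \<Rightarrow>\<^sub>0 nat. monom_degree m \<le> k} \<subseteq> PiE UNIV (\<lambda>_. {..k})"
  proof
    fix g :: "'n \<Rightarrow> nat" assume "g \<in> Poly_Mapping.lookup ` {m. monom_degree m \<le> k}"
    then obtain m :: "'n \<Rightarrow>\<^sub>0 nat" where m: "g = Poly_Mapping.lookup m" "monom_degree m \<le> k"
      by blast
    have "g i \<le> monom_degree m" for i
      unfolding monom_degree_def m(1) by (rule member_le_sum) auto
    with m(2) show "g \<in> PiE UNIV (\<lambda>_. {..k})"
      by (auto intro: order_trans)
  qed
  then show "finite (Poly_Mapping.lookup ` {m :: 'n \<Rightarrow>\<^sub>0 nat. monom_degree m \<le> k})"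
    by (rule finite_subset) (rule finite_PiE; simp)
  show "inj_on Poly_Mapping.lookup {m :: 'n \<Rightarrow>\<^sub>0 nat. monom_degree m \<le> k}"
    by (rule inj_onI) (rule poly_mapping_eqI, simp)
qed

text \<open>Hadamard's lemma with degree control. Allowing the cofactors the same degree as
  \<open>g\<close> is crude, but the bound does not depend on \<open>a\<close>, as the finiteness
  argument requires.\<close>

definition hadamard :: "real^'n \<Rightarrow> nat \<Rightarrow> 'n::finite rpoly \<Rightarrow> bool" where
  "hadamard a d g \<longleftrightarrow> g \<in> deg_le d \<and> (\<exists>h. (\<forall>k. h k \<in> deg_le d) \<and>
    g - const_poly (poly_eval g a) = (\<Sum>k\<in>UNIV. h k * (var_poly k - const_poly (a $ k))))"

lemmas poly_eval_simps = unital_hom_simps[OF unital_hom_poly_eval]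
lemmas const_poly_simps = unital_hom_simps[OF unital_hom_const_poly]

lemma poly_eval_const [simp]: "poly_eval (const_poly c) x = c"
  unfolding poly_eval_insertion by (rule insertion_const[OF unital_hom_ident])

lemma poly_eval_var [simp]: "poly_eval (var_poly i) x = x $ i"
  unfolding poly_eval_insertion by (rule insertion_var[OF unital_hom_ident])

lemma hadamard_const: "hadamard a d (const_poly c)"
  unfolding hadamard_def by (auto intro!: deg_le_const deg_le_0 exI[of _ "\<lambda>_. 0"])

lemma hadamard_var: "hadamard a 1 (var_poly i)"
proof -
  have "(\<Sum>k\<in>UNIV. (if k = i then 1 else 0) * (var_poly k - const_poly (a $ k))) = var_poly i - const_poly (a $ i)"
    by (subst sum.cong[OF refl, of _ _ "\<lambda>k. if k = i then var_poly i - const_poly (a $ i) else 0"]) auto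
  then show ?thesis
    unfolding hadamard_def
    by (intro conjI deg_le_var exI[of _ "\<lambda>k. if k = i then 1 else 0"]) (auto intro: deg_le_1 deg_le_0)
qed

lemma hadamard_mono: "hadamard a d g \<Longrightarrow> d \<le> e \<Longrightarrow> hadamard a e g"
  unfolding hadamard_def by (meson deg_le_mono)

lemma hadamard_add:
  assumes "hadamard a d g" "hadamard a d g'"
  shows "hadamard a d (g + g')"
proof -
  obtain h h' where h: "\<And>k. h k \<in> deg_le d" "g - const_poly (poly_eval g a) = (\<Sum>k\<in>UNIV. h k * (var_poly k - const_poly (a $ k)))"
    and h': "\<And>k. h' k \<in> deg_le d" "g' - const_poly (poly_eval g' a) = (\<Sum>k\<in>UNIV. h' k * (var_poly k - const_poly (a $ k)))"
    using assms unfolding hadamard_def by blast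
  have "(g + g') - const_poly (poly_eval (g + g') a) =
      (g - const_poly (poly_eval g a)) + (g' - const_poly (poly_eval g' a))"
    by (simp add: poly_eval_simps const_poly_simps)
  also have "\<dots> = (\<Sum>k\<in>UNIV. (h k + h' k) * (var_poly k - const_poly (a $ k)))"
    unfolding h(2) h'(2) by (simp add: sum.distrib[symmetric] distrib_right)
  finally have eq: "(g + g') - const_poly (poly_eval (g + g') a) = \<dots>" .
  have "g + g' \<in> deg_le d"
    using assms deg_le_add by (auto simp: hadamard_def)
  moreover have "\<forall>k. h k + h' k \<in> deg_le d"
    by (intro allI deg_le_add h h')
  ultimately show ?thesis
    unfolding hadamard_def using eq by (intro conjI exI[of _ "\<lambda>k. h k + h' k"])
qed

lemma hadamard_mult:
  assumes "hadamard a d g" "hadamard a e g'"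
  shows "hadamard a (d + e) (g * g')"
proof -
  obtain h h' where h: "\<And>k. h k \<in> deg_le d" "g - const_poly (poly_eval g a) = (\<Sum>k\<in>UNIV. h k * (var_poly k - const_poly (a $ k)))"
    and h': "\<And>k. h' k \<in> deg_le e" "g' - const_poly (poly_eval g' a) = (\<Sum>k\<in>UNIV. h' k * (var_poly k - const_poly (a $ k)))"
    using assms unfolding hadamard_def by blast
  have g: "g \<in> deg_le d" "g' \<in> deg_le e"
    using assms by (auto simp: hadamard_def)
  have "g * g' - const_poly (poly_eval (g * g') a) =
      g * (g' - const_poly (poly_eval g' a)) + const_poly (poly_eval g' a) * (g - const_poly (poly_eval g a))"
    by (simp add: poly_eval_simps const_poly_simps algebra_simps)
  also have "\<dots> = (\<Sum>k\<in>UNIV. (g * h' k + const_poly (poly_eval g' a) * h k) * (var_poly k - const_poly (a $ k)))"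
    unfolding h(2) h'(2) by (simp add: sum.distrib[symmetric] distrib_right sum_distrib_left mult.assoc)
  finally have eq: "g * g' - const_poly (poly_eval (g * g') a) = \<dots>" .
  have "g * h' k \<in> deg_le (d + e)" "const_poly (poly_eval g' a) * h k \<in> deg_le (e + d)" for k
    by (intro deg_le_mult g h h' deg_le_const)+
  then have "\<forall>k. g * h' k + const_poly (poly_eval g' a) * h k \<in> deg_le (d + e)"
    by (simp add: deg_le_add add.commute)
  with deg_le_mult[OF g] show ?thesis
    unfolding hadamard_def using eq
    by (intro conjI exI[of _ "\<lambda>k. g * h' k + const_poly (poly_eval g' a) * h k"])
qed

lemma hadamard_deg_le:
  assumes "g \<in> deg_le d"
  shows "hadamard a d g"
proof -
  have one: "hadamard a 0 1"
    using hadamard_const[of a 0 1] by (simp add: const_poly_simps)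
  have pow: "hadamard a n (var_poly i ^ n)" for i n
  proof (induction n)
    case (Suc n)
    then show ?case
      using hadamard_mult[OF hadamard_var Suc] by simp
  qed (simp add: one)
  have "hadamard a (\<Sum>i\<in>A. Poly_Mapping.lookup m i) (\<Prod>i\<in>A. var_poly i ^ Poly_Mapping.lookup m i)"
    if "finite A" for A and m :: "'a \<Rightarrow>\<^sub>0 nat"
    using that by (induction A rule: finite_induct) (auto simp: one intro: hadamard_mult pow)
  then have mono: "hadamard a (monom_degree m) (Poly_Mapping.single m 1)" for m
    by (simp add: monom_degree_def single_as_prod)
  have single: "hadamard a d (Poly_Mapping.single m c)" if "monom_degree m \<le> d" for m c
    using hadamard_mult[OF hadamard_const[of a 0 c] mono[of m]] that
    by (auto simp: const_poly_def mult_single intro: hadamard_mono)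
  have "hadamard a d (\<Sum>m\<in>M. Poly_Mapping.single m (Poly_Mapping.lookup g m))"
    if "finite M" "\<forall>m\<in>M. monom_degree m \<le> d" for M
    using that
  proof (induction M rule: finite_induct)
    case empty
    show ?case
      using hadamard_const[of a d 0] by (simp add: const_poly_simps)
  next
    case (insert m M)
    then show ?case by (auto intro: hadamard_add single)
  qed
  from this[of "Poly_Mapping.keys g"] assms show ?thesis
    unfolding rpoly_as_sum[symmetric] by (simp add: deg_le_def)
qed

lemma sum_axis_mult:
  fixes x :: "'n::finite \<Rightarrow> 'a::comm_semiring_1"
  shows "(\<Sum>k\<in>UNIV. axis i 1 $ k * x k) = x i" and "(\<Sum>k\<in>UNIV. x k * axis k 1 $ i) = x i"
proof -
  have "(\<Sum>k\<in>UNIV. axis i 1 $ k * x k) = (\<Sum>k\<in>UNIV. if k = i then x k else 0)"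
    "(\<Sum>k\<in>UNIV. x k * axis k 1 $ i) = (\<Sum>k\<in>UNIV. if k = i then x k else 0)"
    by (rule sum.cong; simp add: axis_def)+
  then show "(\<Sum>k\<in>UNIV. axis i 1 $ k * x k) = x i" and "(\<Sum>k\<in>UNIV. x k * axis k 1 $ i) = x i"
    by simp_all
qed

text \<open>When the product rule is applied at \<open>a\<close>, the terms in which a cofactor is
  differentiated carry a factor that vanishes there.\<close>

lemma hadamard_value:
  fixes a :: "real^'n::finite"
  assumes eq: "g - const_poly c = (\<Sum>k\<in>UNIV. h k * (var_poly k - const_poly (a $ k)))"
  shows "poly_eval (h i) a = poly_eval (poly_partial i g) a"
proof -
  have "poly_eval g = (\<lambda>x. c + (\<Sum>k\<in>UNIV. poly_eval (h k) x * (x $ k - a $ k)))"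
  proof
    fix x
    show "poly_eval g x = c + (\<Sum>k\<in>UNIV. poly_eval (h k) x * (x $ k - a $ k))"
      using arg_cong[OF eq, of "\<lambda>p. poly_eval p x"] by (simp add: poly_eval_simps algebra_simps)
  qed
  moreover have "((\<lambda>x. c + (\<Sum>k\<in>UNIV. poly_eval (h k) x * (x $ k - a $ k))) has_derivative
      (\<lambda>v. \<Sum>k\<in>UNIV. poly_eval (h k) a * v $ k)) (at a)"
    by (rule derivative_eq_intros has_derivative_poly_eval bounded_linear.has_derivative[OF bounded_linear_vec_nth]
          has_derivative_ident refl)+ simp
  ultimately have "(poly_eval g has_derivative (\<lambda>v. \<Sum>k\<in>UNIV. poly_eval (h k) a * v $ k)) (at a)"
    by simp
  from has_derivative_unique[OF this has_derivative_poly_eval]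
  have "(\<Sum>k\<in>UNIV. poly_eval (h k) a * axis i 1 $ k) = (\<Sum>k\<in>UNIV. axis i 1 $ k * poly_eval (poly_partial k g) a)"
    by (rule fun_cong)
  then show ?thesis
    by (simp only: mult.commute[of "poly_eval (h _) a"] sum_axis_mult)
qed

text \<open>Cramer's rule without division: replace row \<open>k\<close> of \<open>B\<close> by the
  combination of its rows with coefficients \<open>x\<close> and expand that row along the unit
  vectors. The \<open>d j\<close> are cofactors and thus independent of \<open>x\<close>.\<close>

lemma cramer_ideal:
  fixes B :: "'a::comm_ring_1^'n^'n"
  shows "\<exists>d. \<forall>x. x k * det B = (\<Sum>j\<in>UNIV. (\<Sum>i\<in>UNIV. x i * B $ i $ j) * d j)"
proof (intro exI allI)
  fix x :: "'n \<Rightarrow> 'a"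
  let ?D = "\<lambda>v. det (\<chi> i. if i = k then v else row i B)"
  have lin: "?D (\<Sum>j\<in>UNIV. c j *s v j) = (\<Sum>j\<in>UNIV. c j * ?D (v j))" for c and v :: "'n \<Rightarrow> 'a^'n"
    by (subst det_linear_row_sum) (simp_all add: det_row_mul)
  have row: "?D (row i B) = (if i = k then det B else 0)" for i
  proof (cases "i = k")
    case True
    then have "(\<chi> j. if j = k then row i B else row j B) = B"
      by (simp add: vec_eq_iff row_def)
    then show ?thesis
      using True by (simp only: if_True simp_thms)
  next
    case False
    have "row i (\<chi> j. if j = k then row i B else row j B) = row k (\<chi> j. if j = k then row i B else row j B)"
      using False by (simp add: vec_eq_iff row_def)
    with det_identical_rows[OF False this] False show ?thesis by simp
  qed
  have "(\<Sum>i\<in>UNIV. x i *s row i B) = (\<Sum>j\<in>UNIV. (\<Sum>i\<in>UNIV. x i * B $ i $ j) *s axis j 1)"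
    by (simp add: vec_eq_iff row_def sum_axis_mult)
  then have "(\<Sum>i\<in>UNIV. x i * ?D (row i B)) = (\<Sum>j\<in>UNIV. (\<Sum>i\<in>UNIV. x i * B $ i $ j) * ?D (axis j 1))"
    by (simp only: lin[symmetric])
  moreover have "(\<Sum>i\<in>UNIV. x i * ?D (row i B)) = (\<Sum>i\<in>UNIV. if i = k then x i * det B else 0)"
    by (rule sum.cong) (simp_all add: row)
  ultimately show "x k * det B = (\<Sum>j\<in>UNIV. (\<Sum>i\<in>UNIV. x i * B $ i $ j) * ?D (axis j 1))"
    by simp
qed

lemma poly_eval_det:
  fixes A :: "('m::finite rpoly)^'c^'c"
  shows "poly_eval (det A) x = det (\<chi> i j. poly_eval (A $ i $ j) x)"
proof -
  have "poly_eval (of_int (sign p)) x = of_int (sign p)" for p :: "'c \<Rightarrow> 'c"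
    by (cases p rule: sign_cases) (simp_all add: poly_eval_simps)
  then show ?thesis
    by (simp add: det_def poly_eval_simps)
qed

text \<open>The vectors \<open>e a\<close> are linearly independent in a space of dimension
  \<open>card M\<close>. The induction is Gaussian elimination: a pivot \<open>a0\<close> clears
  coordinate \<open>m0\<close> of all the others, and biorthogonality survives once
  \<open>a0\<close> is removed.\<close>

lemma finite_if_biorthogonal:
  fixes e w :: "'c \<Rightarrow> 'm \<Rightarrow> real"
  assumes "finite M" "\<And>a b. a \<in> C \<Longrightarrow> b \<in> C \<Longrightarrow> (\<Sum>m\<in>M. e a m * w b m) = (if a = b then 1 else 0)"
  shows "finite C"
  using assms
proof (induction M arbitrary: C e rule: finite_induct)
  case empty
  then have "C = {}" by fastforce
  then show ?case by simp
next
  case (insert m0 M)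
  show ?case
  proof (cases "\<forall>a\<in>C. e a m0 = 0")
    case True
    show ?thesis
    proof (rule insert.IH[of C e])
      fix a b assume "a \<in> C" "b \<in> C"
      then show "(\<Sum>m\<in>M. e a m * w b m) = (if a = b then 1 else 0)"
        using insert.prems[of a b] insert.hyps True by simp
    qed
  next
    case False
    then obtain a0 where a0: "a0 \<in> C" "e a0 m0 \<noteq> 0" by blast
    define e' where "e' a m = e a m - (e a m0 / e a0 m0) * e a0 m" for a m
    have "finite (C - {a0})"
    proof (rule insert.IH[of _ e'])
      fix a b assume ab: "a \<in> C - {a0}" "b \<in> C - {a0}"
      have "e' a m0 = 0"
        using a0 by (simp add: e'_def)
      then have "(\<Sum>m\<in>M. e' a m * w b m) = (\<Sum>m\<in>insert m0 M. e' a m * w b m)"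
        using insert.hyps by simp
      also have "\<dots> = (\<Sum>m\<in>insert m0 M. e a m * w b m) - (e a m0 / e a0 m0) * (\<Sum>m\<in>insert m0 M. e a0 m * w b m)"
        unfolding e'_def by (simp only: left_diff_distrib sum_subtractf sum_distrib_left mult.assoc)
      also have "\<dots> = (if a = b then 1 else 0)"
        using insert.prems[of a b] insert.prems[of a0 b] ab a0(1) by auto
      finally show "(\<Sum>m\<in>M. e' a m * w b m) = (if a = b then 1 else 0)" .
    qed
    then show ?thesis by simp
  qed
qed

section \<open>The gradient ideal and the real critical points\<close>

definition gradient_ideal :: "'n::finite rpoly \<Rightarrow> 'n rpoly set" where
  "gradient_ideal f = {\<Sum>i\<in>UNIV. \<phi> i * poly_partial i f | \<phi>. True}"

lemma gradient_idealI: "(\<Sum>i\<in>UNIV. \<phi> i * poly_partial i f) \<in> gradient_ideal f"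
  unfolding gradient_ideal_def by blast

lemma poly_ideal_gradient: "poly_ideal (gradient_ideal f)"
  unfolding poly_ideal_def
proof (intro conjI ballI allI)
  show "0 \<in> gradient_ideal f"
    using gradient_idealI[of "\<lambda>_. 0" f] by simp
  fix p assume "p \<in> gradient_ideal f"
  then obtain \<phi> where \<phi>: "p = (\<Sum>i\<in>UNIV. \<phi> i * poly_partial i f)"
    unfolding gradient_ideal_def by blast
  {
    fix h
    show "h * p \<in> gradient_ideal f"
      using gradient_idealI[of "\<lambda>i. h * \<phi> i" f] by (simp add: \<phi> sum_distrib_left mult.assoc)
  next
    fix q assume "q \<in> gradient_ideal f"
    then obtain \<psi> where \<psi>: "q = (\<Sum>i\<in>UNIV. \<psi> i * poly_partial i f)"
      unfolding gradient_ideal_def by blast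
    show "p + q \<in> gradient_ideal f"
      using gradient_idealI[of "\<lambda>i. \<phi> i + \<psi> i" f] by (simp add: \<phi> \<psi> sum.distrib distrib_right)
  }
qed

lemma partial_in_gradient_ideal: "poly_partial i f \<in> gradient_ideal f"
proof -
  have "(\<Sum>j\<in>UNIV. (if j = i then 1 else 0) * poly_partial j f) = poly_partial i f"
    by (subst sum.cong[OF refl, of _ _ "\<lambda>j. if j = i then poly_partial i f else 0"]) auto
  then show ?thesis
    using gradient_idealI[of "\<lambda>j. if j = i then 1 else 0" f] by simp
qed

definition gradient_zeros :: "'n::finite rpoly \<Rightarrow> (real^'n) set" where
  "gradient_zeros f = {a. \<forall>i. poly_eval (poly_partial i f) a = 0}"

lemma poly_ideal_sum: "poly_ideal I \<Longrightarrow> (\<And>x. x \<in> A \<Longrightarrow> f x \<in> I) \<Longrightarrow> (\<Sum>x\<in>A. f x) \<in> I"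
  by (induction A rule: infinite_finite_induct) (auto intro: poly_idealD)

lemma gradient_ideal_vanishes:
  assumes "p \<in> gradient_ideal f" "a \<in> gradient_zeros f"
  shows "poly_eval p a = 0"
  using assms by (auto simp: gradient_ideal_def gradient_zeros_def poly_eval_simps)

text \<open>
  At a nondegenerate zero \<open>a\<close> of the gradient the localised gradient ideal is already the maximal
  ideal: writing \<open>\<nabla>f = H (x - a)\<close>, the polynomial \<open>det H\<close> multiplies each \<open>x\<^sub>k - a\<^sub>k\<close> into it.
\<close>

lemma isolating_polynomial:
  fixes f :: "'n::finite rpoly"
  assumes morse: "morse (poly_eval f)" and a: "a \<in> gradient_zeros f"
    and d: "\<And>i. poly_partial i f \<in> deg_le d"
  shows "\<exists>e\<in>deg_le (CARD('n) * d). poly_eval e a = 1 \<and>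
    (\<forall>k. e * (var_poly k - const_poly (a $ k)) \<in> gradient_ideal f)"
proof -
  let ?P = "\<lambda>i h. (\<forall>k. h k \<in> deg_le d) \<and>
      poly_partial i f = (\<Sum>k\<in>UNIV. h k * (var_poly k - const_poly (a $ k)))"
  have "\<exists>h. ?P i h" for i
    using hadamard_deg_le[OF d[of i], of a] a
    unfolding hadamard_def gradient_zeros_def by (simp add: const_poly_simps)
  then have "\<exists>H. \<forall>i. ?P i (H i)"
    by (intro choice allI)
  then obtain H where "\<forall>i. ?P i (H i)"
    by (rule exE)
  then have H: "H i k \<in> deg_le d"
    "poly_partial i f = (\<Sum>k\<in>UNIV. H i k * (var_poly k - const_poly (a $ k)))" for i k
    by simp_all
  \<comment> \<open>Transposed: the value of \<open>B\<close> at \<open>a\<close> is then the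
    Hessian, and the gradient is the row vector of the x_k - a_k times \<open>B\<close>, as in
    \<open>cramer_ideal\<close>.\<close>
  define B :: "('n rpoly)^'n^'n" where "B = (\<chi> k i. H i k)"
  have H_value: "poly_eval (H i k) a = poly_eval (poly_partial k (poly_partial i f)) a" for i k
    by (rule hadamard_value[where c = 0]) (simp add: H(2)[of i] const_poly_simps)
  have "(poly_eval f has_derivative (\<lambda>v. 0)) (at a)"
    using has_derivative_poly_eval[of f a] a by (simp add: gradient_zeros_def)
  then have "invertible (hessian (poly_eval f) a)"
    using morse by (simp add: morse_def critical_point_def)
  moreover have "hessian (poly_eval f) a = (\<chi> k i. poly_eval (B $ k $ i) a)"
    by (simp add: hessian_poly_eval B_def H_value)
  ultimately have nz: "poly_eval (det B) a \<noteq> 0"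
    by (simp add: invertible_det_nz poly_eval_det)
  define e where "e = const_poly (inverse (poly_eval (det B) a)) * det B"
  have "det B \<in> deg_le (CARD('n) * d)"
    by (rule deg_le_det) (simp add: B_def H(1))
  then have "e \<in> deg_le (CARD('n) * d)"
    unfolding e_def using deg_le_mult[OF deg_le_const[of _ 0]] by fastforce
  moreover have "poly_eval e a = 1"
    using nz by (simp add: e_def poly_eval_simps)
  moreover have "e * (var_poly k - const_poly (a $ k)) \<in> gradient_ideal f" for k
  proof -
    obtain D where D: "\<And>x. x k * det B = (\<Sum>j\<in>UNIV. (\<Sum>i\<in>UNIV. x i * B $ i $ j) * D j)"
      using cramer_ideal[of k B] by blast
    have "(\<Sum>i\<in>UNIV. (var_poly i - const_poly (a $ i)) * B $ i $ j) = poly_partial j f" for j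
      unfolding H(2)[of j] B_def by (simp add: mult.commute)
    then have "(var_poly k - const_poly (a $ k)) * det B = (\<Sum>j\<in>UNIV. D j * poly_partial j f)"
      unfolding D[of "\<lambda>k. var_poly k - const_poly (a $ k)"] by (simp add: mult.commute)
    then have "(var_poly k - const_poly (a $ k)) * det B \<in> gradient_ideal f"
      using gradient_idealI[of D f] by simp
    from poly_idealD(3)[OF poly_ideal_gradient this, of "const_poly (inverse (poly_eval (det B) a))"]
    show ?thesis
      by (simp add: e_def ac_simps)
  qed
  ultimately show ?thesis by blast
qed

text \<open>By Hadamard's lemma h - h(a) is a combination of the x_k - a_k, each of which
  \<open>e\<close> carries into the ideal. So modulo the ideal, multiplying \<open>e\<close> by
  \<open>h\<close> only scales it by h(a).\<close>

lemma isolating_reduce: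
  fixes a :: "real^'n::finite"
  assumes "\<And>k. e * (var_poly k - const_poly (a $ k)) \<in> gradient_ideal f"
  shows "e * h - const_poly (poly_eval h a) * e \<in> gradient_ideal f"
proof -
  obtain q where q: "h - const_poly (poly_eval h a) = (\<Sum>k\<in>UNIV. q k * (var_poly k - const_poly (a $ k)))"
    using hadamard_deg_le[OF deg_le_total_degree[of h], of a] unfolding hadamard_def by blast
  have "e * h - const_poly (poly_eval h a) * e = e * (h - const_poly (poly_eval h a))"
    by (simp add: algebra_simps)
  also have "\<dots> = (\<Sum>k\<in>UNIV. q k * (e * (var_poly k - const_poly (a $ k))))"
    unfolding q by (simp add: sum_distrib_left ac_simps)
  also have "\<dots> \<in> gradient_ideal f"
    by (intro poly_ideal_sum poly_ideal_gradient poly_idealD(3) assms)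
  finally show ?thesis .
qed

theorem sos_modulo_gradient_ideal:
  fixes f g :: "'n::finite rpoly"
  assumes morse: "morse (poly_eval f)" and nonneg: "\<And>a. a \<in> gradient_zeros f \<Longrightarrow> 0 \<le> poly_eval g a"
  shows "\<exists>s\<in>sums_of_squares. g - s \<in> gradient_ideal f"
proof -
  let ?I = "gradient_ideal f" and ?C = "gradient_zeros f"
  note I = poly_ideal_gradient[of f]
  note ideal = poly_idealD[OF I]
  define d where "d = Max (range (\<lambda>i. total_degree (poly_partial i f)))"
  have d: "poly_partial i f \<in> deg_le d" for i
    by (rule deg_le_mono[OF deg_le_total_degree]) (simp add: d_def)
  obtain e where e: "\<And>a. a \<in> ?C \<Longrightarrow> e a \<in> deg_le (CARD('n) * d)" "\<And>a. a \<in> ?C \<Longrightarrow> poly_eval (e a) a = 1"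
    "\<And>a k. a \<in> ?C \<Longrightarrow> e a * (var_poly k - const_poly (a $ k)) \<in> ?I"
    using isolating_polynomial[OF morse _ d] by metis
  have delta: "poly_eval (e a) b = (if a = b then 1 else 0)" if ab: "a \<in> ?C" "b \<in> ?C" for a b
  proof (cases "a = b")
    case False
    then obtain k where "a $ k \<noteq> b $ k"
      by (auto simp: vec_eq_iff)
    then show ?thesis
      using gradient_ideal_vanishes[OF e(3)[OF ab(1), of k] ab(2)] False by (simp add: poly_eval_simps)
  qed (simp add: e(2) ab)
  \<comment> \<open>By \<open>delta\<close>, coefficient vectors of the \<open>e a\<close> and
    vectors of monomial values at critical points are biorthogonal, over the finitely many monomials
    of the common degree bound.\<close>
  have fin: "finite ?C"
  proof (rule finite_if_biorthogonal[OF finite_monom_degree_le[of "CARD('n) * d"]])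
    fix a b assume "a \<in> ?C" "b \<in> ?C"
    then show "(\<Sum>m\<in>{m. monom_degree m \<le> CARD('n) * d}. Poly_Mapping.lookup (e a) m * monom_eval m b) = (if a = b then 1 else 0)"
      using delta[of a b] e(1)[of a]
      by (subst poly_eval_superset[OF finite_monom_degree_le, symmetric]) (auto simp: deg_le_def)
  qed
  define J where "J = {u + (\<Sum>a\<in>?C. r a * e a) | u r. u \<in> ?I}"
  have JI: "u + (\<Sum>a\<in>?C. r a * e a) \<in> J" if "u \<in> ?I" for u r
    unfolding J_def using that by blast
  have "poly_ideal J"
    unfolding poly_ideal_def
  proof (intro conjI ballI allI)
    show "0 \<in> J"
      using JI[OF ideal(1), of "\<lambda>_. 0"] by simp
    fix p assume "p \<in> J"
    then obtain u r where p: "p = u + (\<Sum>a\<in>?C. r a * e a)" "u \<in> ?I" unfolding J_def by blast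
    {
      fix h
      show "h * p \<in> J"
        using JI[OF ideal(3)[OF p(2), of h], of "\<lambda>a. h * r a"]
        by (simp add: p(1) distrib_left sum_distrib_left mult.assoc)
    next
      fix q assume "q \<in> J"
      then obtain v t where q: "q = v + (\<Sum>a\<in>?C. t a * e a)" "v \<in> ?I" unfolding J_def by blast
      show "p + q \<in> J"
        using JI[OF ideal(2)[OF p(2) q(2)], of "\<lambda>a. r a + t a"]
        by (simp add: p(1) q(1) distrib_right sum.distrib add_ac)
    }
  qed
  moreover have "point_free J"
    unfolding point_free_def
  proof (intro exI[of _ "range (\<lambda>i. poly_partial i f) \<union> e ` ?C"] conjI allI)
    have "e a \<in> J" if "a \<in> ?C" for a
    proof -
      have "(\<Sum>b\<in>?C. (if b = a then 1 else 0) * e b) = e a"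
        using fin that by (subst sum.cong[OF refl, of _ _ "\<lambda>b. if b = a then e a else 0"]) auto
      then show ?thesis
        using JI[OF ideal(1), of "\<lambda>b. if b = a then 1 else 0"] by simp
    qed
    moreover have "poly_partial i f \<in> J" for i
      using JI[OF partial_in_gradient_ideal, of i "\<lambda>_. 0"] by simp
    ultimately show "range (\<lambda>i. poly_partial i f) \<union> e ` ?C \<subseteq> J" by blast
    show "finite (range (\<lambda>i. poly_partial i f) \<union> e ` ?C)"
      using fin by simp
    show "\<exists>h\<in>range (\<lambda>i. poly_partial i f) \<union> e ` ?C. poly_eval h x \<noteq> 0" for x
    proof (cases "x \<in> ?C")
      case True
      then show ?thesis
        using e(2)[OF True] by (intro bexI[of _ "e x"]) simp_all
    next
      case False
      then show ?thesis
        unfolding gradient_zeros_def by blast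
    qed
  qed
  ultimately obtain s where s: "s \<in> sums_of_squares" "1 + s \<in> J"
    using weak_real_Nullstellensatz by blast
  then obtain u r where ur: "1 + s = u + (\<Sum>a\<in>?C. r a * e a)" "u \<in> ?I" unfolding J_def by blast
  define E where "E = (\<Sum>a\<in>?C. e a)"
  define E' where "E' = 1 - E"
  have reduce: "e a * h - const_poly (poly_eval h a) * e a \<in> ?I" if "a \<in> ?C" for a h
    using isolating_reduce e(3) that by blast
  \<comment> \<open>At \<open>a\<close> exactly one of the idempotents takes the value 1, so
    \<open>E'\<close> vanishes there and reducing the product leaves nothing.\<close>
  have kill: "e a * E' \<in> ?I" if "a \<in> ?C" for a
  proof -
    have "poly_eval E a = (\<Sum>b\<in>?C. if a = b then 1 else 0)"
      unfolding E_def poly_eval_simps by (rule sum.cong) (auto simp: delta that)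
    then have "poly_eval E' a = 0"
      using fin that by (simp add: E'_def poly_eval_simps)
    with reduce[OF that, of E'] show ?thesis
      by (simp add: const_poly_simps)
  qed
  define half :: "'n rpoly" where "half = const_poly (1 / 2)"
  have half: "half * 4 * half = 1"
  proof -
    have "half * 4 * half = const_poly (1 / 2) * const_poly (of_nat 4) * const_poly (1 / 2)"
      unfolding half_def const_poly_simps(8) by simp
    also have "\<dots> = const_poly 1"
      by (simp only: const_poly_simps(4)[symmetric]) simp
    finally show ?thesis by (simp add: const_poly_simps)
  qed
  \<comment> \<open>Modulo the ideal \<open>e a\<close> is idempotent and \<open>e a * g\<close> is
    g(a) times \<open>e a\<close>; nonnegativity of g(a) provides the square root.\<close>
  define S1 where "S1 = (\<Sum>a\<in>?C. (const_poly (sqrt (poly_eval g a)) * e a)\<^sup>2)"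
  \<comment> \<open>On the complementary component \<open>g\<close> is the difference of the squares
    of (g + 1)/2 and (g - 1)/2. The minus sign is traded for \<open>s\<close>, as
    \<open>E' * (1 + s)\<close> lies in the ideal.\<close>
  define S2 where "S2 = (E' * (half * (g + 1)))\<^sup>2 + (E' * (half * (g - 1)))\<^sup>2 * s"
  have "S1 \<in> sums_of_squares" "S2 \<in> sums_of_squares"
    unfolding S1_def S2_def by (intro sos_sum sos_add sos_mult sos_square s)+
  then have "S1 + S2 \<in> sums_of_squares"
    by (rule sos_add)
  moreover have "g - (S1 + S2) \<in> ?I"
  proof -
    have "e a * g - (const_poly (sqrt (poly_eval g a)) * e a)\<^sup>2 \<in> ?I" if a: "a \<in> ?C" for a
    proof -
      have "(const_poly (sqrt (poly_eval g a)) * e a)\<^sup>2 = const_poly (poly_eval g a) * (e a * e a)"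
        using nonneg[OF a] by (simp add: power_mult_distrib const_poly_simps(7)[symmetric] power2_eq_square[of "e a"])
      then have "e a * g - (const_poly (sqrt (poly_eval g a)) * e a)\<^sup>2 =
          (e a * g - const_poly (poly_eval g a) * e a) - const_poly (poly_eval g a) * (e a * e a - e a)"
        by (simp add: algebra_simps)
      also have "\<dots> \<in> ?I"
      proof (rule ideal(6)[OF reduce[OF a] ideal(3)])
        show "e a * e a - e a \<in> ?I"
          using reduce[OF a, of "e a"] by (simp add: e(2)[OF a] const_poly_simps)
      qed
      finally show ?thesis .
    qed
    then have 1: "E * g - S1 \<in> ?I"
      unfolding E_def S1_def sum_distrib_right sum_subtractf[symmetric] by (rule poly_ideal_sum[OF I])
    have "E' * (1 + s) = E' * u + (\<Sum>a\<in>?C. r a * (e a * E'))"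
      by (simp add: ur(1) distrib_left sum_distrib_left ac_simps)
    also have "\<dots> \<in> ?I"
      by (rule ideal(2)[OF ideal(3)[OF ur(2)] poly_ideal_sum[OF I ideal(3)[OF kill]]])
    finally have 2: "E' * (1 + s) \<in> ?I" .
    have "E' * E = (\<Sum>a\<in>?C. e a * E')"
      by (simp add: E_def sum_distrib_left mult.commute)
    also have "\<dots> \<in> ?I"
      by (rule poly_ideal_sum[OF I kill])
    finally have 3: "E' * E \<in> ?I" .
    have "(half * (g + 1))\<^sup>2 - (half * (g - 1))\<^sup>2 = (half * 4 * half) * g"
      by (simp add: power2_eq_square algebra_simps)
    then have "(half * (g + 1))\<^sup>2 = (half * (g - 1))\<^sup>2 + g"
      unfolding half by (simp add: algebra_simps)
    then have "S2 = E'\<^sup>2 * g + (half * (g - 1))\<^sup>2 * E' * (E' * (1 + s))"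
      unfolding S2_def power_mult_distrib[of E'] by (simp add: algebra_simps power2_eq_square[of E'])
    \<comment> \<open>From E + E' = 1; passing from E' to its square costs a multiple of
      \<open>E' * E\<close>, which lies in the ideal.\<close>
    moreover have "g = E * g + E'\<^sup>2 * g + g * (E' * E)"
      by (simp add: E'_def power2_eq_square algebra_simps)
    ultimately have "g - (S1 + S2) = (E * g - S1) + g * (E' * E) - (half * (g - 1))\<^sup>2 * E' * (E' * (1 + s))"
      by (simp add: algebra_simps)
    also have "\<dots> \<in> ?I"
      by (rule ideal(6)[OF ideal(2)[OF 1 ideal(3)[OF 3]] ideal(3)[OF 2]])
    finally show ?thesis .
  qed
  ultimately show ?thesis by blast
qed

text \<open>The certificate exists at \<open>fstar\<close> itself, without positive slack, so the
  maximum is attained. Conversely, at a minimiser all gradient terms vanish, whatever their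
  multipliers, so no admissible bound exceeds \<open>fstar\<close>.\<close>

theorem theorem4p3:
  fixes f :: "('n::finite) rpoly" and fstar :: real
  assumes "morse (poly_eval f)"
    and "\<exists>p. poly_eval f p = fstar" and "\<forall>x. fstar \<le> poly_eval f x"
  shows "\<exists>N::int. is_maximum (grad_sos_bounds f N) fstar"
proof -
  have "0 \<le> poly_eval (f - const_poly fstar) a" for a
    using assms(3) by (simp add: poly_eval_simps)
  then obtain s where s: "s \<in> sums_of_squares" "f - const_poly fstar - s \<in> gradient_ideal f"
    using sos_modulo_gradient_ideal[OF assms(1)] by blast
  then obtain \<phi> where \<phi>: "f - const_poly fstar - s = (\<Sum>i\<in>UNIV. \<phi> i * poly_partial i f)"
    unfolding gradient_ideal_def by blast
  define M where "M = Max (range (\<lambda>i. total_degree (\<phi> i)))"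
  \<comment> \<open>With this choice the permitted degree is 2 M + d + 1, where d is the degree of
    \<open>f\<close>; it is at least \<open>M\<close>.\<close>
  define N where "N = int (M + total_degree f)"
  have "total_degree (\<phi> i) \<le> M" for i
    by (simp add: M_def)
  then have "int (total_degree (\<phi> i)) \<le> 2 * N - int (total_degree f) + 1" for i
    unfolding N_def by (smt (verit) of_nat_0_le_iff of_nat_add of_nat_mono)
  then have "\<phi> i \<in> polys_upto (2 * N - int (total_degree f) + 1)" for i
    by (simp add: polys_upto_def)
  moreover have "f - const_poly fstar - (\<Sum>i\<in>UNIV. \<phi> i * poly_partial i f) \<in> sums_of_squares"
    using s(1) by (simp add: \<phi>[symmetric])
  ultimately have "fstar \<in> grad_sos_bounds f N"
    unfolding grad_sos_bounds_def by blast
  moreover have "b \<le> fstar" if b: "b \<in> grad_sos_bounds f N" for b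
  proof -
    obtain p where p: "poly_eval f p = fstar"
      using assms(2) by blast
    have "(\<lambda>h. \<Sum>i\<in>UNIV. h $ i * poly_eval (poly_partial i f) p) = (\<lambda>h. 0)"
      using assms(3) p by (intro differential_zero_maxmin[OF _ open_UNIV has_derivative_poly_eval]) auto
    then have "(\<Sum>j\<in>UNIV. axis i 1 $ j * poly_eval (poly_partial j f) p) = 0" for i
      by (rule fun_cong)
    then have grad: "poly_eval (poly_partial i f) p = 0" for i
      by (simp only: sum_axis_mult)
    obtain \<psi> where "f - const_poly b - (\<Sum>i\<in>UNIV. \<psi> i * poly_partial i f) \<in> sums_of_squares"
      using b unfolding grad_sos_bounds_def by blast
    from sos_poly_eval_nonneg[OF this, of p] show ?thesis
      by (simp add: poly_eval_simps grad p)
  qed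
  ultimately show ?thesis
    unfolding is_maximum_def by blast
qed

end
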